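(* Let $N=r(\Sigma+1)$. For $i=1,\ldots,r$ let $b_i=(\mathbf a_i^1,\ldots,\mathbf a_i^d)\in\mathbb F^{n_1}\times\cdots\times\mathbb F^{n_d}$ and let $\mathbf p=\operatorname{vecr}(b_1,\ldots,b_r)$. Assume that $$\mathfrak A=f(\mathbf p)=\sum_{i=1}^r \mathbf a_i^1\otimes\cdots\otimes\mathbf a_i^d\in\sigma_r^0(\mathcal S_{\mathbb F})\subset\mathbb F^{\Pi}$$ is robustly $r$-identifiable, and let $\varsigma_N$ denote the $N$th largest singular value of Terracini's matrix $T_{\mathbf p}$. If $\varsigma_N>0$, then the absolute condition number $\kappa_A$ of the rank decomposition problem at $\mathbf p$ is $$\kappa_A=\lim_{\epsilon\to0}\ \max_{\substack{0<\|\Delta\mathfrak A\|\le\epsilon,\\ \mathfrak A+\Delta\mathfrak A\in\sigma_r^0(\mathcal S_{\mathbb F})}}\frac{d\bigl(\mathbf p,f^\dagger(\mathfrak A+\Delta\mathfrak A)\bigr)}{\|\Delta\mathfrak A\|}=\varsigma_N^{-1}.$$ (If $\varsigma_N=0$, or if $\mathfrak A$ is not robustly $r$-identifiable, the condition number is by definition $\infty$.)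
   Context: $\mathbb F$ is $\mathbb R$ or $\mathbb C$; $d\ge2$ and $n_1,\ldots,n_d\ge2$ are integers; $\Sigma=\sum_{k=1}^d(n_k-1)$, $\Pi=\prod_{k=1}^d n_k$, and $r\ge1$ satisfies $r(\Sigma+1)<\Pi$. $\mathbb F^{n_1}\otimes\cdots\otimes\mathbb F^{n_d}$ is identified with $\mathbb F^\Pi$ (tensor product = Kronecker product) and $\|\cdot\|$ is the Euclidean norm. For $b=(\mathbf a^1,\ldots,\mathbf a^d)$, $\operatorname{vec}(b)\in\mathbb F^{\Sigma+d}$ is the vector obtained by stacking $\mathbf a^1,\ldots,\mathbf a^d$, and $\operatorname{vecr}(b_1,\ldots,b_r)\in\mathbb F^{r(\Sigma+d)}$ is obtained by stacking $\operatorname{vec}(b_1),\ldots,\operatorname{vec}(b_r)$. The map $f:\mathbb F^{r(\Sigma+d)}\to\mathbb F^\Pi$ is $f(\operatorname{vecr}(b_1,\ldots,b_r))=\sum_{i=1}^r\mathbf a_i^1\otimes\cdots\otimes\mathbf a_i^d$ where $b_i=(\mathbf a_i^1,\ldots,\mathbf a_i^d)$. Its image is $\sigma_r^0(\mathcal S_{\mathbb F})$, the set of tensors of $\mathbb F$-rank at most $r$. Write $f^\dagger(\mathfrak A)=\{\mathbf x: f(\mathbf x)=\mathfrak A\}$. Terracini's matrix $T_{\mathbf p}\in\mathbb F^{\Pi\times r(\Sigma+d)}$ is the Jacobian matrix of $f$ at $\mathbf p$: $T_{\mathbf p}=[T_1\ \cdots\ T_r]$ with $T_i=[\,I_{n_1}\otimes\mathbf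 a_i^2\otimes\cdots\otimes\mathbf a_i^d\ \ \cdots\ \ \mathbf a_i^1\otimes\cdots\otimes\mathbf a_i^{d-1}\otimes I_{n_d}\,]$. Let $\mathcal D$ be the set of matrices $\operatorname{diag}((\alpha_2\cdots\alpha_d)^{-1}I_{n_1},\alpha_2I_{n_2},\ldots,\alpha_dI_{n_d})$ with $\alpha_2,\ldots,\alpha_d\in\mathbb F\setminus\{0\}$, let $\mathcal B=\{\operatorname{diag}(D_1,\ldots,D_r): D_i\in\mathcal D\}$, let $\mathcal P=\{P\otimes I_{\Sigma+d}: P \text{ an } r\times r\text{ permutation matrix}\}$, and let $\mathcal T=\{PB: P\in\mathcal P,\ B\in\mathcal B\}$, which is a group. Write $\mathbf p\sim\mathbf q$ if $\mathbf p=T\mathbf q$ for some $T\in\mathcal T$. A tensor $\mathfrak A$ of rank $r$ is $r$-identifiable if $|f^\dagger(\mathfrak A)/\!\sim|=1$. Regular points: for $\mathbb F=\mathbb C$, a regular point is a smooth point of the variety $\overline{\sigma_r^0(\mathcal S_{\mathbb C})}$; for $\mathbb F=\mathbb R$, write the semi-algebraic set as a finite disjoint union of semi-algebraically connected Nash manifolds (a Nash stratification); the regular points are those lying in the manifolds of maximal dimension. A rank-$r$ tensor $\mathfrak A\in\sigma_r^0(\mathcal S_{\mathbb F})$ is robustly $r$-identifiable if it is a regular point of $\sigma_r^0(\mathcal S_{\mathbb F})$ and there is an open neighborhood $\mathcal N\subset\sigma_r^0(\mathcal S_{\mathbb F})$ of $\mathfrak A$ (relative Euclidean topology) such that $|f^\dagger(\mathfrak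 B)/\!\sim|=1$ for all $\mathfrak B\in\mathcal N$. Distance: $d(\mathbf p,\mathbf q)=\inf_{T\in\mathcal T}\|\mathbf p-T\mathbf q\|$. If $\mathfrak B$ is $r$-identifiable, $d(\mathbf p,f^\dagger(\mathfrak B))$ denotes $d(\mathbf p,\mathbf q)$ for any $\mathbf q\in f^\dagger(\mathfrak B)$ (independent of the choice). *)

theory Defs
  imports
    "HOL-Analysis.Abstract_Metric_Spaces"
    "HOL-Analysis.L2_Norm"
    "HOL-Library.Extended_Real"
    "HOL-Library.Disjoint_Sets"
    "Jordan_Normal_Form.VS_Connect"
    "Jordan_Normal_Form.Schur_Decomposition"
begin

unbundle no vec_syntax
hide_type (open) Finite_Cartesian_Product.vec
hide_const (open) Finite_Cartesian_Product.vec


definition vnorm :: "'a::real_normed_field vec \<Rightarrow> real" where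
  "vnorm v = L2_set (\<lambda>i. norm (v $ i)) {..<dim_vec v}"

text \<open>The dimension is an explicit argument so that the distance is symmetric on the whole
  type, as the locale \<^locale>\<open>Metric_space\<close> demands.\<close>

definition vdist :: "nat \<Rightarrow> 'a::real_normed_field vec \<Rightarrow> 'a vec \<Rightarrow> real" where
  "vdist n x y = L2_set (\<lambda>i. norm (x $ i - y $ i)) {..<n}"

lemma Metric_space_vdist: "Metric_space (carrier_vec n) (vdist n)"
proof
  fix x y z :: "'a vec"
  show "0 \<le> vdist n x y" by (simp add: vdist_def L2_set_nonneg)
  show "vdist n x y = vdist n y x" by (simp add: vdist_def norm_minus_commute)
  assume x: "x \<in> carrier_vec n" and y: "y \<in> carrier_vec n"
  show "vdist n x y = 0 \<longleftrightarrow> x = y"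
    using x y by (auto simp: vdist_def L2_set_eq_0_iff)
  have "vdist n x z \<le> L2_set (\<lambda>i. norm (x $ i - y $ i) + norm (y $ i - z $ i)) {..<n}"
    unfolding vdist_def
  proof (rule L2_set_mono)
    show "norm (x $ i - z $ i) \<le> norm (x $ i - y $ i) + norm (y $ i - z $ i)" for i
      by (rule norm_diff_triangle_ineq[of "x $ i" "y $ i" "y $ i" "z $ i", simplified])
  qed simp
  also have "\<dots> \<le> vdist n x y + vdist n y z"
    unfolding vdist_def by (rule L2_set_triangle_ineq)
  finally show "vdist n x z \<le> vdist n x y + vdist n y z" .
qed

lemma vdist_eq_vnorm: "x \<in> carrier_vec n \<Longrightarrow> y \<in> carrier_vec n \<Longrightarrow> vdist n x y = vnorm (x - y)"
  by (auto simp: vdist_def vnorm_def intro!: L2_set_cong)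

definition vec_topology :: "nat \<Rightarrow> 'a::real_normed_field vec topology" where
  "vec_topology n = Metric_space.mtopology (carrier_vec n) (vdist n)"

text \<open>The list \<open>ns = [n\<^sub>1, \<dots>, n\<^sub>d]\<close> holds the mode sizes.  The dimension \<open>\<Sigma> + d\<close> of a stacked
  tuple of factors is \<open>sum_list ns\<close>, since all \<open>n\<^sub>k\<close> are positive, and \<open>\<Pi>\<close> is \<open>prod_list ns\<close>.\<close>

definition Sigma_dim :: "nat list \<Rightarrow> nat" where
  "Sigma_dim ns = (\<Sum>n\<leftarrow>ns. n - 1)"

definition kron :: "'a::semiring_1 mat \<Rightarrow> 'a mat \<Rightarrow> 'a mat" where
  "kron A B = mat (dim_row A * dim_row B) (dim_col A * dim_col B)
     (\<lambda>(i, j). A $$ (i div dim_row B, j div dim_col B) * B $$ (i mod dim_row B, j mod dim_col B))"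

definition kron_list :: "'a::semiring_1 mat list \<Rightarrow> 'a mat" where
  "kron_list As = foldr kron As (1\<^sub>m 1)"

definition col_mat :: "'a vec \<Rightarrow> 'a mat" where
  "col_mat v = mat_of_cols (dim_vec v) [v]"

definition tensor :: "'a::semiring_1 vec list \<Rightarrow> 'a vec" where
  "tensor b = col (kron_list (map col_mat b)) 0"

text \<open>A decomposition is a list of \<open>r\<close> tuples \<open>b = [a\<^sup>1, \<dots>, a\<^sup>d]\<close> with \<open>a\<^sup>k\<close> of dimension \<open>n\<^sub>k\<close>.\<close>

definition decompositions :: "nat list \<Rightarrow> nat \<Rightarrow> 'a vec list list set" where
  "decompositions ns r = {bs. length bs = r \<and> (\<forall>b\<in>set bs. map dim_vec b = ns)}"

definition stack :: "'a vec list \<Rightarrow> 'a vec" where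
  "stack vs = vec_of_list (concat (map list_of_vec vs))"

definition vecr :: "'a vec list list \<Rightarrow> 'a vec" where
  "vecr bs = stack (map stack bs)"

definition unvecr :: "nat list \<Rightarrow> nat \<Rightarrow> 'a vec \<Rightarrow> 'a vec list list" where
  "unvecr ns r x =
     map (\<lambda>i. map (\<lambda>k. vec (ns ! k) (\<lambda>j. x $ (i * sum_list ns + sum_list (take k ns) + j)))
            [0..<length ns]) [0..<r]"

definition cpd_map :: "nat list \<Rightarrow> nat \<Rightarrow> 'a::semiring_1 vec \<Rightarrow> 'a vec" where
  "cpd_map ns r x = vec (prod_list ns) (\<lambda>j. \<Sum>b\<leftarrow>unvecr ns r x. tensor b $ j)"

definition sigma :: "nat list \<Rightarrow> nat \<Rightarrow> 'a::semiring_1 vec set" where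
  "sigma ns r = cpd_map ns r ` carrier_vec (r * sum_list ns)"

definition tensor_rank :: "nat list \<Rightarrow> 'a::semiring_1 vec \<Rightarrow> nat" where
  "tensor_rank ns A = (LEAST s. A \<in> sigma ns s)"

definition cpd_fiber :: "nat list \<Rightarrow> nat \<Rightarrow> 'a::semiring_1 vec \<Rightarrow> 'a vec set" where
  "cpd_fiber ns r A = {x \<in> carrier_vec (r * sum_list ns). cpd_map ns r x = A}"

definition terracini_block :: "'a::semiring_1 vec list \<Rightarrow> nat \<Rightarrow> 'a mat" where
  "terracini_block b k =
     kron_list (map col_mat (take k b) @ [1\<^sub>m (dim_vec (b ! k))] @ map col_mat (drop (Suc k) b))"

definition terracini :: "nat list \<Rightarrow> nat \<Rightarrow> 'a::semiring_1 vec \<Rightarrow> 'a mat" where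
  "terracini ns r x = mat_of_cols (prod_list ns)
     (concat (map (\<lambda>b. concat (map (\<lambda>k. cols (terracini_block b k)) [0..<length b]))
       (unvecr ns r x)))"

lemma nth_concat_take:
  assumes "k < length xs" "j < length (xs ! k)"
  shows "concat xs ! (sum_list (take k (map length xs)) + j) = xs ! k ! j"
  using assms
proof (induction xs arbitrary: k)
  case (Cons x xs)
  show ?case
  proof (cases k)
    case 0
    then show ?thesis using Cons.prems by (simp add: nth_append)
  next
    case (Suc l)
    then show ?thesis using Cons.prems Cons.IH[of l] by (simp add: nth_append add.assoc)
  qed
qed simp

lemma sum_list_take_less:
  fixes ns :: "nat list"
  assumes "k < length ns" "j < ns ! k"
  shows "sum_list (take k ns) + j < sum_list ns"
proof -
  have "sum_list ns = sum_list (take k ns) + sum_list (drop k ns)"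
    by (metis append_take_drop_id sum_list_append)
  moreover have "sum_list (drop k ns) = ns ! k + sum_list (drop (Suc k) ns)"
    using assms(1) by (simp flip: Cons_nth_drop_Suc)
  ultimately show ?thesis using assms by simp
qed

lemma dim_stack: "dim_vec (stack vs) = sum_list (map dim_vec vs)"
  by (simp add: stack_def length_concat comp_def)

lemma stack_nth:
  assumes "k < length vs" "j < dim_vec (vs ! k)"
  shows "stack vs $ (sum_list (take k (map dim_vec vs)) + j) = vs ! k $ j"
proof -
  have "map length (map list_of_vec vs) = map dim_vec vs" by simp
  then have "concat (map list_of_vec vs) ! (sum_list (take k (map dim_vec vs)) + j) = vs ! k $ j"
    using assms nth_concat_take[of k "map list_of_vec vs" j]
    by (simp only: length_map nth_map length_list_of_vec list_of_vec_index)
  then show ?thesis by (simp add: stack_def vec_of_list_index)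
qed

lemma unvecr_vecr:
  assumes "bs \<in> decompositions ns r"
  shows "unvecr ns r (vecr bs) = bs"
proof -
  have len: "length bs = r" and dims: "\<And>i. i < r \<Longrightarrow> map dim_vec (bs ! i) = ns"
    using assms by (auto simp: decompositions_def)
  have st: "map dim_vec (map stack bs) = replicate r (sum_list ns)"
    using len dims by (intro nth_equalityI) (simp_all add: dim_stack)
  have "vecr bs $ (i * sum_list ns + sum_list (take k ns) + j) = bs ! i ! k $ j"
    if i: "i < r" and k: "k < length ns" and j: "j < ns ! k" for i k j
  proof -
    have lt: "sum_list (take k ns) + j < sum_list ns" using k j by (rule sum_list_take_less)
    have "sum_list (take i (map dim_vec (map stack bs))) = i * sum_list ns"
      using i unfolding st by (simp add: sum_list_replicate)
    then have "vecr bs $ (i * sum_list ns + (sum_list (take k ns) + j))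
        = stack (bs ! i) $ (sum_list (take k ns) + j)"
      using stack_nth[of i "map stack bs" "sum_list (take k ns) + j"] i len lt dims[OF i]
      by (simp add: vecr_def dim_stack)
    also have "\<dots> = bs ! i ! k $ j"
      using stack_nth[of k "bs ! i" j] k j dims[OF i] by (metis length_map nth_map)
    finally show ?thesis by (simp add: add.assoc)
  qed
  note entry = this
  show ?thesis
  proof (rule nth_equalityI)
    show "length (unvecr ns r (vecr bs)) = length bs" by (simp add: unvecr_def len)
  next
    fix i assume "i < length (unvecr ns r (vecr bs))"
    then have i: "i < r" by (simp add: unvecr_def)
    have li: "length (bs ! i) = length ns" using dims[OF i] by (metis length_map)
    show "unvecr ns r (vecr bs) ! i = bs ! i"
    proof (rule nth_equalityI)
      show "length (unvecr ns r (vecr bs) ! i) = length (bs ! i)"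
        using i by (simp add: unvecr_def li)
    next
      fix k assume "k < length (unvecr ns r (vecr bs) ! i)"
      then have k: "k < length ns" using i by (simp add: unvecr_def)
      have dk: "dim_vec (bs ! i ! k) = ns ! k"
        using dims[OF i] k li by (metis nth_map)
      show "unvecr ns r (vecr bs) ! i ! k = bs ! i ! k"
        by (rule eq_vecI) (use i k in \<open>simp_all add: unvecr_def dk entry\<close>)
    qed
  qed
qed

lemma cpd_map_vecr:
  assumes "bs \<in> decompositions ns r"
  shows "cpd_map ns r (vecr bs) = vec (prod_list ns) (\<lambda>j. \<Sum>b\<leftarrow>bs. tensor b $ j)"
  using unvecr_vecr[OF assms] by (simp add: cpd_map_def)

definition scaling_mats :: "nat list \<Rightarrow> 'a::field mat set" where
  "scaling_mats ns =
     {diag_block_mat (map2 (\<lambda>\<alpha> n. \<alpha> \<cdot>\<^sub>m 1\<^sub>m n) (inverse (prod_list \<alpha>s) # \<alpha>s) ns) | \<alpha>s.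
        length \<alpha>s = length ns - 1 \<and> 0 \<notin> set \<alpha>s}"

definition block_scaling_mats :: "nat list \<Rightarrow> nat \<Rightarrow> 'a::field mat set" where
  "block_scaling_mats ns r =
     {diag_block_mat Ds | Ds. length Ds = r \<and> set Ds \<subseteq> scaling_mats ns}"

definition block_perm_mats :: "nat list \<Rightarrow> nat \<Rightarrow> 'a::field mat set" where
  "block_perm_mats ns r =
     {kron (mat r r (\<lambda>(i, j). if i = \<pi> j then 1 else 0)) (1\<^sub>m (sum_list ns)) | \<pi>.
        \<pi> permutes {..<r}}"

definition symmetries :: "nat list \<Rightarrow> nat \<Rightarrow> 'a::field mat set" where
  "symmetries ns r = {P * B | P B. P \<in> block_perm_mats ns r \<and> B \<in> block_scaling_mats ns r}"

definition cpd_equiv :: "nat list \<Rightarrow> nat \<Rightarrow> 'a::field vec \<Rightarrow> 'a vec \<Rightarrow> bool" where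
  "cpd_equiv ns r p q \<longleftrightarrow> (\<exists>T\<in>symmetries ns r. p = T *\<^sub>v q)"

definition unique_cpd :: "nat list \<Rightarrow> nat \<Rightarrow> 'a::field vec \<Rightarrow> bool" where
  "unique_cpd ns r A \<longleftrightarrow>
     card (cpd_fiber ns r A //
       {(p, q). p \<in> cpd_fiber ns r A \<and> q \<in> cpd_fiber ns r A \<and> cpd_equiv ns r p q}) = 1"

text \<open>The notion of regular point depends on the field; \<open>reg n S\<close> is the set of regular points
  of \<open>S \<subseteq> \<F>\<^sup>n\<close>.\<close>

definition robustly_identifiable ::
  "(nat \<Rightarrow> 'a::real_normed_field vec set \<Rightarrow> 'a vec set) \<Rightarrow> nat list \<Rightarrow> nat \<Rightarrow> 'a vec \<Rightarrow> bool" where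
  "robustly_identifiable reg ns r A \<longleftrightarrow>
     A \<in> sigma ns r \<and> tensor_rank ns A = r \<and> A \<in> reg (prod_list ns) (sigma ns r) \<and>
     (\<exists>U. openin (subtopology (vec_topology (prod_list ns)) (sigma ns r)) U \<and> A \<in> U \<and>
          (\<forall>B\<in>U. unique_cpd ns r B))"

definition cpd_dist :: "nat list \<Rightarrow> nat \<Rightarrow> 'a::real_normed_field vec \<Rightarrow> 'a vec \<Rightarrow> real" where
  "cpd_dist ns r p q = (INF T\<in>symmetries ns r. vnorm (p - T *\<^sub>v q))"

definition fiber_dist :: "nat list \<Rightarrow> nat \<Rightarrow> 'a::real_normed_field vec \<Rightarrow> 'a vec \<Rightarrow> real" where
  "fiber_dist ns r p B = cpd_dist ns r p (SOME q. q \<in> cpd_fiber ns r B)"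

text \<open>Square roots of the eigenvalues of \<open>A\<^sup>H A\<close>, with algebraic multiplicity, in decreasing order.
  The eigenvalues are nonnegative reals, so \<^const>\<open>norm\<close> only casts them to \<^typ>\<open>real\<close>.  The list
  has \<open>dim_col A\<close> entries, those beyond the first \<open>min (dim_row A) (dim_col A)\<close> being 0.\<close>

definition singular_values :: "'a::{conjugatable_field,real_normed_field} mat \<Rightarrow> real list" where
  "singular_values A = rev (sorted_list_of_multiset
     (image_mset (\<lambda>\<mu>. sqrt (norm \<mu>)) (proots (char_poly (mat_adjoint A * A)))))"

definition sing_val :: "nat \<Rightarrow> 'a::{conjugatable_field,real_normed_field} mat \<Rightarrow> real" where
  "sing_val k A = singular_values A ! (k - 1)"

definition varsigma :: "nat list \<Rightarrow> nat \<Rightarrow> 'a::{conjugatable_field,real_normed_field} vec \<Rightarrow> real" where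
  "varsigma ns r p = sing_val (r * (Sigma_dim ns + 1)) (terracini ns r p)"

text \<open>The maximum of the difference quotients need not be attained, so it is a supremum, taken in
  \<^typ>\<open>ereal\<close> since it may be infinite for large \<open>\<epsilon>\<close>.  For large \<open>\<epsilon>\<close> the perturbed tensor may
  also fail to have a unique decomposition; only the limit \<open>\<epsilon> \<rightarrow> 0\<close> matters.\<close>

definition max_ratio :: "nat list \<Rightarrow> nat \<Rightarrow> 'a::real_normed_field vec \<Rightarrow> real \<Rightarrow> ereal" where
  "max_ratio ns r p \<epsilon> =
     (SUP \<Delta>\<in>{\<Delta> \<in> carrier_vec (prod_list ns). 0 < vnorm \<Delta> \<and> vnorm \<Delta> \<le> \<epsilon> \<and>
                 cpd_map ns r p + \<Delta> \<in> sigma ns r}.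
        ereal (fiber_dist ns r p (cpd_map ns r p + \<Delta>) / vnorm \<Delta>))"

definition cond_number ::
  "(nat \<Rightarrow> 'a vec set \<Rightarrow> 'a vec set) \<Rightarrow> nat list \<Rightarrow> nat \<Rightarrow>
     'a::{conjugatable_field,real_normed_field} vec \<Rightarrow> ereal" where
  "cond_number reg ns r p =
     (if robustly_identifiable reg ns r (cpd_map ns r p) \<and> varsigma ns r p > 0
      then Lim (at_right 0) (max_ratio ns r p) else \<infinity>)"

inductive_set poly_fun :: "nat \<Rightarrow> ('a::comm_ring_1 vec \<Rightarrow> 'a) set" for n where
  const: "(\<lambda>x. c) \<in> poly_fun n"
| coord: "i < n \<Longrightarrow> (\<lambda>x. x $ i) \<in> poly_fun n"
| add: "f \<in> poly_fun n \<Longrightarrow> g \<in> poly_fun n \<Longrightarrow> (\<lambda>x. f x + g x) \<in> poly_fun n"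
| mult: "f \<in> poly_fun n \<Longrightarrow> g \<in> poly_fun n \<Longrightarrow> (\<lambda>x. f x * g x) \<in> poly_fun n"

definition algebraic_set :: "nat \<Rightarrow> complex vec set \<Rightarrow> bool" where
  "algebraic_set n V \<longleftrightarrow> (\<exists>F\<subseteq>poly_fun n. V = {x \<in> carrier_vec n. \<forall>f\<in>F. f x = 0})"

definition zariski_closure :: "nat \<Rightarrow> complex vec set \<Rightarrow> complex vec set" where
  "zariski_closure n S = \<Inter>{V. algebraic_set n V \<and> S \<subseteq> V}"

definition irreducible_set :: "nat \<Rightarrow> complex vec set \<Rightarrow> bool" where
  "irreducible_set n V \<longleftrightarrow> algebraic_set n V \<and> V \<noteq> {} \<and>
     (\<forall>V1 V2. algebraic_set n V1 \<and> algebraic_set n V2 \<and> V = V1 \<union> V2 \<longrightarrow> V = V1 \<or> V = V2)"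

definition variety_dim :: "nat \<Rightarrow> complex vec set \<Rightarrow> enat" where
  "variety_dim n V =
     (SUP k\<in>{k. \<exists>C. (\<forall>i\<le>k. irreducible_set n (C i) \<and> C i \<subseteq> V) \<and> (\<forall>i<k. C i \<subset> C (Suc i))}. enat k)"

definition zariski_tangent :: "nat \<Rightarrow> complex vec set \<Rightarrow> complex vec \<Rightarrow> complex vec set" where
  "zariski_tangent n V x =
     {v \<in> carrier_vec n. \<forall>f\<in>poly_fun n. (\<forall>y\<in>V. f y = 0) \<longrightarrow>
        ((\<lambda>t. f (x + t \<cdot>\<^sub>v v)) has_field_derivative 0) (at 0)}"

definition subspace_dim :: "nat \<Rightarrow> complex vec set \<Rightarrow> nat" where
  "subspace_dim n W = vectorspace.dim class_ring (module_vec TYPE(complex) n\<lparr>carrier := W\<rparr>)"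

text \<open>Comparing with the global dimension is the right criterion for irreducible varieties; the
  closure of the set of tensors of rank at most \<open>r\<close> is irreducible, being the closure of the image
  of an affine space.\<close>

definition complex_regular :: "nat \<Rightarrow> complex vec set \<Rightarrow> complex vec set" where
  "complex_regular n S =
     {x \<in> S. enat (subspace_dim n (zariski_tangent n (zariski_closure n S) x))
               = variety_dim n (zariski_closure n S)}"

inductive_set semialgebraic :: "nat \<Rightarrow> real vec set set" for n where
  pos: "f \<in> poly_fun n \<Longrightarrow> {x \<in> carrier_vec n. f x > 0} \<in> semialgebraic n"
| Un: "S \<in> semialgebraic n \<Longrightarrow> S' \<in> semialgebraic n \<Longrightarrow> S \<union> S' \<in> semialgebraic n"
| Int: "S \<in> semialgebraic n \<Longrightarrow> S' \<in> semialgebraic n \<Longrightarrow> S \<inter> S' \<in> semialgebraic n"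
| compl: "S \<in> semialgebraic n \<Longrightarrow> carrier_vec n - S \<in> semialgebraic n"

definition semialgebraically_connected :: "nat \<Rightarrow> real vec set \<Rightarrow> bool" where
  "semialgebraically_connected n S \<longleftrightarrow> S \<in> semialgebraic n \<and>
     (\<forall>F1 F2. F1 \<in> semialgebraic n \<and> F2 \<in> semialgebraic n \<and>
        closedin (subtopology (vec_topology n) S) F1 \<and>
        closedin (subtopology (vec_topology n) S) F2 \<and>
        F1 \<inter> F2 = {} \<and> F1 \<union> F2 = S \<longrightarrow> F1 = S \<or> F2 = S)"

text \<open>\<open>Ck n k U g\<close>: on the open set \<open>U \<subseteq> \<real>\<^sup>n\<close>, all partial derivatives of \<open>g\<close> up to order \<open>k\<close>
  exist and are continuous.\<close>

primrec Ck :: "nat \<Rightarrow> nat \<Rightarrow> real vec set \<Rightarrow> (real vec \<Rightarrow> real) \<Rightarrow> bool" where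
  "Ck n 0 U g = continuous_map (subtopology (vec_topology n) U) euclideanreal g"
| "Ck n (Suc k) U g =
     (continuous_map (subtopology (vec_topology n) U) euclideanreal g \<and>
      (\<exists>D. \<forall>i<n. Ck n k U (D i) \<and>
         (\<forall>x\<in>U. ((\<lambda>t. g (x + t \<cdot>\<^sub>v unit_vec n i)) has_real_derivative D i x) (at 0))))"

definition nash_map :: "nat \<Rightarrow> nat \<Rightarrow> real vec set \<Rightarrow> (real vec \<Rightarrow> real vec) \<Rightarrow> bool" where
  "nash_map n m U \<phi> \<longleftrightarrow>
     openin (vec_topology n) U \<and> U \<in> semialgebraic n \<and> \<phi> ` U \<subseteq> carrier_vec m \<and>
     {x @\<^sub>v \<phi> x | x. x \<in> U} \<in> semialgebraic (n + m) \<and>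
     (\<forall>i<m. \<forall>k. Ck n k U (\<lambda>x. \<phi> x $ i))"

definition nash_diffeo :: "nat \<Rightarrow> real vec set \<Rightarrow> real vec set \<Rightarrow> (real vec \<Rightarrow> real vec) \<Rightarrow> bool" where
  "nash_diffeo n U V \<phi> \<longleftrightarrow>
     bij_betw \<phi> U V \<and> nash_map n n U \<phi> \<and> nash_map n n V (inv_into U \<phi>)"

definition nash_submanifold :: "nat \<Rightarrow> nat \<Rightarrow> real vec set \<Rightarrow> bool" where
  "nash_submanifold n m M \<longleftrightarrow> m \<le> n \<and> M \<in> semialgebraic n \<and>
     (\<forall>x\<in>M. \<exists>U V \<phi>. nash_diffeo n U V \<phi> \<and> 0\<^sub>v n \<in> U \<and> x \<in> V \<and> \<phi> (0\<^sub>v n) = x \<and>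
        \<phi> ` {y \<in> U. \<forall>i\<in>{m..<n}. y $ i = 0} = M \<inter> V)"

text \<open>A Nash stratification is a finite partition into semialgebraically connected Nash
  submanifolds that satisfies the frontier condition.  Without that condition the origin of the
  cross \<open>{(x, y). x * y = 0}\<close> would lie in a stratum of maximal dimension.\<close>

definition nash_stratification ::
  "nat \<Rightarrow> real vec set \<Rightarrow> real vec set set \<Rightarrow> (real vec set \<Rightarrow> nat) \<Rightarrow> bool" where
  "nash_stratification n S \<M> \<delta> \<longleftrightarrow>
     finite \<M> \<and> partition_on S \<M> \<and>
     (\<forall>M\<in>\<M>. nash_submanifold n (\<delta> M) M \<and> semialgebraically_connected n M) \<and>
     (\<forall>M\<in>\<M>. \<forall>M'\<in>\<M>. M \<noteq> M' \<and> M \<inter> Abstract_Topology.closure_of (vec_topology n) M' \<noteq> {} \<longrightarrow>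
        M \<subseteq> Abstract_Topology.closure_of (vec_topology n) M' \<and> \<delta> M < \<delta> M')"

definition real_regular :: "nat \<Rightarrow> real vec set \<Rightarrow> real vec set" where
  "real_regular n S =
     {x. \<exists>\<M> \<delta>. nash_stratification n S \<M> \<delta> \<and>
        (\<exists>M\<in>\<M>. x \<in> M \<and> (\<forall>M'\<in>\<M>. \<delta> M' \<le> \<delta> M))}"

end

theory Submission
  imports Defs "HOL-Homology.Invariance_of_Domain"
begin

text \<open>Let \<open>J\<close> be Terracini's matrix at \<open>p\<close>, \<open>u\<^sub>1, u\<^sub>2, \<dots>\<close> its right singular vectors in order of
  decreasing singular value, and \<open>H\<close> the affine slice through \<open>p\<close> spanned by the first
  \<open>N = r(\<Sigma> + 1)\<close> of them. Since \<open>\<varsigma>\<^sub>N > 0\<close>, the map \<open>f\<close> is injective on \<open>H\<close> near \<open>p\<close>.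
  Regularity of \<open>f(p)\<close> shows that the set of tensors of rank at most \<open>r\<close> embeds near \<open>f(p)\<close> into
  \<open>\<F>\<^sup>N\<close>, because any \<open>N + 1\<close> polynomials are algebraically dependent on it. By invariance of domain
  \<open>f(H)\<close> covers a neighbourhood of \<open>f(p)\<close> in this set, so every tensor \<open>B\<close> of rank at most
  \<open>r\<close> near \<open>f(p)\<close> is \<open>f(q)\<close> with \<open>q \<in> H\<close>; then \<open>\<parallel>B - f(p)\<parallel>\<close> is
  \<open>\<parallel>J(q - p)\<parallel> \<ge> \<varsigma>\<^sub>N \<parallel>q - p\<parallel>\<close> up to higher order terms, which bounds the condition number from above.
  For the lower bound perturb \<open>p\<close> to \<open>p + t u\<^sub>N\<close>: all decompositions \<open>y\<close> close to \<open>p\<close> of the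
  perturbed tensor satisfy \<open>J(y - p - t u\<^sub>N) = o(t)\<close>, so the component of \<open>y - p\<close> along \<open>u\<^sub>N\<close>
  is at least \<open>t - o(t)\<close>.\<close>

text \<open>The obstacle is that f is not locally injective: rescaling the factors moves p along its
  fibre, so the inverse function theorem does not apply to f, and it is not clear beforehand that a
  tensor near f(p) has a decomposition near p. Invariance of domain supplies these decompositions.
  It asks of the target only that it embeds continuously into F^N, and this is all that is extracted
  from regularity: the real and the complex notion both lead to the predicate
  \<open>locally_embeds\<close>, and what follows it is done once for both fields in the class
  \<open>rc_field\<close>. The bound N is a count of parameters: after one entry of every factor but
  the first is normalised to 1, r(\<Sigma> + d) - r(d - 1) = N free entries remain. Over C this
  bounds chains of irreducible sets, over R the dimension of a chart. The normalised decompositions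
  serve this count alone; the slice H is a different one, adapted to the singular values.
  Derivatives are strict, comparing two points near p, because the lower bound compares two
  decompositions of one tensor, neither of which is p.\<close>

unbundle no vec_syntax
hide_type (open) Finite_Cartesian_Product.vec
hide_const (open) Finite_Cartesian_Product.vec

section \<open>Singular values\<close>

text \<open>Gaussian elimination, by induction on the set of equations \<open>M\<close>: an equation
  that involves some unknown \<open>e0\<close> is solved for it and eliminated, which costs one
  equation and one unknown. Used for a vector orthogonal to few others and for the monomial count
  behind algebraic dependence.\<close>

lemma underdetermined_system:
  fixes A :: "'e \<Rightarrow> 'm \<Rightarrow> 'a::field"
  assumes "finite M" "finite E" "card M < card E"
  shows "\<exists>c. (\<exists>e\<in>E. c e \<noteq> 0) \<and> (\<forall>m\<in>M. (\<Sum>e\<in>E. c e * A e m) = 0)"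
  using assms
proof (induction M arbitrary: E A rule: finite_induct)
  case empty
  then obtain e where "e \<in> E" by fastforce
  then show ?case by (intro exI[of _ "\<lambda>_. 1"]) auto
next
  case (insert m M)
  show ?case
  proof (cases "\<forall>e\<in>E. A e m = 0")
    case True
    from insert.IH[of E A] insert.prems insert.hyps obtain c where
      c: "\<exists>e\<in>E. c e \<noteq> 0" "\<forall>m\<in>M. (\<Sum>e\<in>E. c e * A e m) = 0" by auto
    then show ?thesis using True by (intro exI[of _ c]) auto
  next
    case False
    then obtain e0 where e0: "e0 \<in> E" "A e0 m \<noteq> 0" by auto
    \<comment> \<open>The coefficients once \<open>e0\<close> has been eliminated by means of
      equation \<open>m\<close>.\<close>
    define B where "B = (\<lambda>e m'. A e m' - A e m / A e0 m * A e0 m')"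
    have "card M < card (E - {e0})" using insert e0 by simp
    from insert.IH[of "E - {e0}" B, OF _ this] insert.prems obtain c where
      c: "\<exists>e\<in>E - {e0}. c e \<noteq> 0" "\<And>m'. m' \<in> M \<Longrightarrow> (\<Sum>e\<in>E - {e0}. c e * B e m') = 0" by auto
    \<comment> \<open>The value of \<open>e0\<close> that equation \<open>m\<close> prescribes for
      the given values of the other unknowns.\<close>
    define c' where "c' = c(e0 := - (\<Sum>e\<in>E - {e0}. c e * A e m / A e0 m))"
    have *: "(\<Sum>e\<in>E. c' e * A e m') = (\<Sum>e\<in>E - {e0}. c e * B e m')" for m'
    proof -
      have "(\<Sum>e\<in>E. c' e * A e m') = c' e0 * A e0 m' + (\<Sum>e\<in>E - {e0}. c' e * A e m')"
        using e0 insert.prems by (simp add: sum.remove)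
      also have "(\<Sum>e\<in>E - {e0}. c' e * A e m') = (\<Sum>e\<in>E - {e0}. c e * A e m')"
        by (rule sum.cong) (auto simp: c'_def)
      also have "c' e0 * A e0 m' = - (\<Sum>e\<in>E - {e0}. c e * A e m / A e0 m * A e0 m')"
        by (simp add: c'_def sum_distrib_right)
      finally show ?thesis by (simp add: B_def algebra_simps sum_subtractf)
    qed
    have "(\<Sum>e\<in>E. c' e * A e m) = 0" unfolding * B_def using e0 by simp
    moreover have "\<exists>e\<in>E. c' e \<noteq> 0" using c(1) by (auto simp: c'_def)
    ultimately show ?thesis using c(2) * by (intro exI[of _ c']) auto
  qed
qed

text \<open>A class specification cannot mention \<^const>\<open>of_real\<close>, hence the scalar multiples of \<open>1\<close>.\<close>

class rc_field = conjugatable_field + real_normed_field + euclidean_space +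
  assumes conjugate_mult_scaleR: "conjugate x * x = (norm x)\<^sup>2 *\<^sub>R 1"
    and conjugate_scaleR_one: "conjugate (t *\<^sub>R 1) = t *\<^sub>R 1"

instance real :: rc_field
  by standard (auto simp: power2_eq_square)

instance complex :: rc_field
  by standard (auto simp: scaleR_conv_of_real complex_norm_square mult.commute simp del: of_real_power)

lemma conjugate_mult_self: "conjugate x * x = of_real ((norm (x :: 'a::rc_field))\<^sup>2)"
  by (simp only: of_real_def conjugate_mult_scaleR)

lemma conjugate_of_real [simp]: "conjugate (of_real t :: 'a::rc_field) = of_real t"
  by (simp only: of_real_def conjugate_scaleR_one)

lemma norm_conjugate [simp]: "norm (conjugate x) = norm (x :: 'a::rc_field)"
proof -
  have "of_real ((norm (conjugate x))\<^sup>2) = (of_real ((norm x)\<^sup>2) :: 'a)"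
    using conjugate_mult_self[of x] conjugate_mult_self[of "conjugate x"] by (simp add: mult.commute)
  then show ?thesis by (metis norm_ge_zero of_real_eq_iff power2_eq_iff_nonneg)
qed

lemma tendsto_conjugate [tendsto_intros]:
  assumes "(f \<longlongrightarrow> (l :: 'a::rc_field)) F"
  shows "((\<lambda>x. conjugate (f x)) \<longlongrightarrow> conjugate l) F"
proof -
  have "norm (conjugate (f x) - conjugate l) = norm (f x - l)" for x
    by (metis conjugate_dist_add conjugate_neg diff_conv_add_uminus norm_conjugate)
  with assms show ?thesis by (simp add: tendsto_iff dist_norm)
qed

section \<open>Inner product, norm and compactness in coordinates\<close>

definition cinner :: "nat \<Rightarrow> 'a::conjugatable_field vec \<Rightarrow> 'a vec \<Rightarrow> 'a" where
  "cinner n x y = (\<Sum>i<n. conjugate (x $ i) * y $ i)"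

definition sqnorm :: "nat \<Rightarrow> 'a::real_normed_field vec \<Rightarrow> real" where
  "sqnorm n x = (\<Sum>i<n. (norm (x $ i))\<^sup>2)"

lemma cinner_self: "cinner n x x = of_real (sqnorm n (x :: 'a::rc_field vec))"
  by (simp add: cinner_def sqnorm_def conjugate_mult_self)

lemma sqnorm_nonneg [simp]: "sqnorm n x \<ge> 0"
  by (simp add: sqnorm_def sum_nonneg)

lemma sqnorm_eq_0: "x \<in> carrier_vec n \<Longrightarrow> sqnorm n x = 0 \<longleftrightarrow> x = 0\<^sub>v n"
  by (auto simp: sqnorm_def sum_nonneg_eq_0_iff)

lemma sqnorm_smult: "x \<in> carrier_vec n \<Longrightarrow> sqnorm n (a \<cdot>\<^sub>v x) = (norm a)\<^sup>2 * sqnorm n x"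
  by (auto simp: sqnorm_def norm_mult power_mult_distrib sum_distrib_left intro!: sum.cong)

lemma conjugate_cinner: "conjugate (cinner n x y) = cinner n y (x :: 'a::conjugatable_field vec)"
  by (simp add: cinner_def sum_conjugate conjugate_dist_mul mult.commute)

lemma cinner_add_right: "y \<in> carrier_vec n \<Longrightarrow> z \<in> carrier_vec n \<Longrightarrow> cinner n x (y + z) = cinner n x y + cinner n x z"
  by (simp add: cinner_def algebra_simps sum.distrib)

lemma cinner_smult_right: "y \<in> carrier_vec n \<Longrightarrow> cinner n x (a \<cdot>\<^sub>v y) = a * cinner n x y"
  by (simp add: cinner_def algebra_simps sum_distrib_left)

lemma cinner_add_left: "y \<in> carrier_vec n \<Longrightarrow> z \<in> carrier_vec n \<Longrightarrow> cinner n (y + z) x = cinner n y x + cinner n z x"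
  by (simp add: cinner_def algebra_simps sum.distrib conjugate_dist_add)

lemma cinner_smult_left: "y \<in> carrier_vec n \<Longrightarrow> cinner n (a \<cdot>\<^sub>v y) x = conjugate a * cinner n y x"
  by (simp add: cinner_def algebra_simps sum_distrib_left conjugate_dist_mul)

lemma cinner_minus_right: "y \<in> carrier_vec n \<Longrightarrow> z \<in> carrier_vec n \<Longrightarrow> cinner n x (y - z) = cinner n x y - cinner n x z"
  by (simp add: cinner_def algebra_simps sum_subtractf)

lemma vnorm_sq: "x \<in> carrier_vec n \<Longrightarrow> (vnorm x)\<^sup>2 = sqnorm n x"
  by (simp add: vnorm_def L2_set_def sqnorm_def real_sqrt_pow2 sum_nonneg)

lemma vnorm_nonneg [simp]: "0 \<le> vnorm x"
  by (simp add: vnorm_def L2_set_nonneg)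

text \<open>Bolzano-Weierstrass, one coordinate at a time: each new coordinate refines the
  subsequence, and the limits already found persist.\<close>

lemma bounded_coordinates_subsequence:
  fixes X :: "nat \<Rightarrow> nat \<Rightarrow> 'a::euclidean_space"
  assumes "\<And>i. i < n \<Longrightarrow> bounded (range (\<lambda>j. X j i))"
  shows "\<exists>s l. strict_mono (s :: nat \<Rightarrow> nat) \<and> (\<forall>i<n. (\<lambda>j. X (s j) i) \<longlonglongrightarrow> l i)"
  using assms
proof (induction n)
  case 0
  then show ?case by (intro exI[of _ id]) (auto simp: strict_mono_def)
next
  case (Suc n)
  then obtain s l where s: "strict_mono (s :: nat \<Rightarrow> nat)" "\<forall>i<n. (\<lambda>j. X (s j) i) \<longlonglongrightarrow> l i" by fastforce
  have "bounded (range (\<lambda>j. X (s j) n))" by (rule bounded_subset[OF Suc.prems[of n]]) auto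
  then obtain l' s' where s': "strict_mono s'" "((\<lambda>j. X (s j) n) \<circ> s') \<longlonglongrightarrow> l'"
    using bounded_imp_convergent_subsequence by metis
  have "(\<lambda>j. X (s (s' j)) i) \<longlonglongrightarrow> l i" if "i < n" for i
    using LIMSEQ_subseq_LIMSEQ[OF s(2)[rule_format, OF that] s'(1)] by (simp add: o_def)
  then show ?case using s(1) s'
    by (intro exI[of _ "s \<circ> s'"] exI[of _ "l(n := l')"]) (auto simp: less_Suc_eq o_def strict_mono_def)
qed

lemma norm_coord_le_sqnorm: "i < n \<Longrightarrow> (norm (x $ i))\<^sup>2 \<le> sqnorm n x"
  unfolding sqnorm_def by (rule member_le_sum) auto

lemma mult_mat_vec_entry:
  "A \<in> carrier_mat m n \<Longrightarrow> x \<in> carrier_vec n \<Longrightarrow> a < m \<Longrightarrow> (A *\<^sub>v x) $ a = (\<Sum>q<n. A $$ (a, q) * x $ q)"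
  by (auto simp: scalar_prod_def lessThan_atLeast0)

text \<open>The next vector maximises the norm of \<open>A x\<close> on the unit sphere orthogonal to those chosen so far;
  the images of orthogonal vectors then stay orthogonal.\<close>

lemma maximal_vector:
  fixes A :: "'a::rc_field mat"
  assumes A: "A \<in> carrier_mat m n" and u: "\<And>i. i < k \<Longrightarrow> u i \<in> carrier_vec n" and k: "k < n"
  shows "\<exists>v\<in>carrier_vec n. sqnorm n v = 1 \<and> (\<forall>i<k. cinner n (u i) v = 0) \<and>
    (\<forall>x\<in>carrier_vec n. (\<forall>i<k. cinner n (u i) x = 0) \<longrightarrow> sqnorm m (A *\<^sub>v x) \<le> sqnorm m (A *\<^sub>v v) * sqnorm n x)"
proof -
  define W where "W = {x\<in>carrier_vec n. \<forall>i<k. cinner n (u i) x = 0}"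
  define S where "S = {x\<in>W. sqnorm n x = 1}"
  define q where "q = (\<lambda>x. sqnorm m (A *\<^sub>v x))"
  \<comment> \<open>Reduction to unit vectors: both sides of the claimed bound scale with the square
    of the norm of the factor \<open>t\<close>.\<close>
  have norm_W: "\<exists>y\<in>S. \<exists>t. t \<noteq> 0 \<and> x = t \<cdot>\<^sub>v y \<and> (norm t)\<^sup>2 = sqnorm n x" if x: "x \<in> W" "x \<noteq> 0\<^sub>v n" for x
  proof -
    define t where "t = sqrt (sqnorm n x)"
    have t: "t > 0" using x sqnorm_eq_0[of x n] sqnorm_nonneg[of n x] by (auto simp: W_def t_def less_le)
    define y where "y = of_real (1 / t) \<cdot>\<^sub>v x"
    have "sqnorm n y = (1 / t)\<^sup>2 * sqnorm n x"
      using x t by (auto simp: y_def W_def sqnorm_smult norm_divide)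
    then have "sqnorm n y = 1" using t by (simp add: t_def power_divide real_sqrt_pow2)
    then have "y \<in> S" using x by (auto simp: S_def W_def y_def cinner_smult_right)
    moreover have "x = of_real t \<cdot>\<^sub>v y" using t by (simp add: y_def smult_smult_assoc)
    ultimately show ?thesis using t by (intro bexI[of _ y] exI[of _ "of_real t"]) (auto simp: t_def)
  qed
  have q_smult: "q (t \<cdot>\<^sub>v y) = (norm t)\<^sup>2 * q y" if "y \<in> carrier_vec n" for t y
    using that A by (simp add: q_def sqnorm_def mult_mat_vec norm_mult power_mult_distrib sum_distrib_left)
  have "\<exists>x\<in>W. x \<noteq> 0\<^sub>v n"
  proof -
    \<comment> \<open>Orthogonality to k vectors imposes k < n linear conditions on n
      coordinates.\<close>
    obtain c where c: "\<exists>e<n. c e \<noteq> 0" "\<forall>i<k. (\<Sum>e<n. c e * conjugate (u i $ e)) = 0"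
      using underdetermined_system[of "{..<k}" "{..<n}" "\<lambda>e i. conjugate (u i $ e)"] k by auto
    then have "vec n c \<in> W" by (auto simp: W_def cinner_def mult.commute)
    moreover have "vec n c \<noteq> 0\<^sub>v n" using c by (auto simp: vec_eq_iff)
    ultimately show ?thesis by blast
  qed
  then obtain y0 where y0: "y0 \<in> S" using norm_W by blast
  define C where "C = (\<Sum>a<m. (\<Sum>i<n. norm (A $$ (a, i)))\<^sup>2)"
  have coord: "norm (x $ i) \<le> 1" if "x \<in> S" "i < n" for x i
    using norm_coord_le_sqnorm[OF that(2), of x] that by (simp add: S_def abs_square_le_1)
  have "q x \<le> C" if "x \<in> S" for x
    unfolding q_def C_def sqnorm_def
  proof (rule sum_mono)
    fix a assume a: "a \<in> {..<m}"
    have "norm ((A *\<^sub>v x) $ a) \<le> (\<Sum>i<n. norm (A $$ (a, i)))"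
      using that a coord[OF that] A
      by (subst mult_mat_vec_entry[OF A]) (auto simp: S_def W_def norm_mult intro!: sum_norm_le mult_left_le)
    then show "(norm ((A *\<^sub>v x) $ a))\<^sup>2 \<le> (\<Sum>i<n. norm (A $$ (a, i)))\<^sup>2" by (simp add: power_mono)
  qed
  then have bdd: "bdd_above (q ` S)" by (auto intro!: bdd_aboveI2)
  define s where "s = Sup (q ` S)"
  have "\<exists>x\<in>S. q x > s - 1 / real (Suc j)" for j
    using less_cSup_iff[OF _ bdd, of "s - 1 / real (Suc j)"] y0 by (auto simp: s_def)
  then obtain X where X: "\<And>j. X j \<in> S" "\<And>j. q (X j) > s - 1 / real (Suc j)" by metis
  have "bounded (range (\<lambda>j. X j $ i))" if "i < n" for i
    using coord[OF X(1) that] by (auto simp: bounded_iff)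
  then obtain r l where r: "strict_mono (r :: nat \<Rightarrow> nat)" and l: "\<And>i. i < n \<Longrightarrow> (\<lambda>j. X (r j) $ i) \<longlonglongrightarrow> l i"
    using bounded_coordinates_subsequence[of n "\<lambda>j i. X j $ i"] by auto
  define v where "v = vec n l"
  have v: "v \<in> carrier_vec n" by (simp add: v_def)
  have vl: "(\<lambda>j. X (r j) $ i) \<longlonglongrightarrow> v $ i" if "i < n" for i using l that by (simp add: v_def)
  have XW: "X j \<in> carrier_vec n" for j using X by (auto simp: S_def W_def)
  have qv: "(\<lambda>j. q (X (r j))) \<longlonglongrightarrow> q v"
  proof -
    have e: "q x = (\<Sum>a<m. (norm (\<Sum>i<n. A $$ (a, i) * x $ i))\<^sup>2)" if "x \<in> carrier_vec n" for x
      using that A by (simp add: q_def sqnorm_def mult_mat_vec_entry[OF A] del: index_mult_mat_vec)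
    show ?thesis unfolding e[OF v] e[OF XW] by (intro tendsto_intros vl) auto
  qed
  have "v \<in> S"
  proof -
    have "(\<lambda>j. sqnorm n (X (r j))) \<longlonglongrightarrow> sqnorm n v" unfolding sqnorm_def by (intro tendsto_intros vl) auto
    moreover have "sqnorm n (X (r j)) = 1" for j using X(1) by (auto simp: S_def)
    ultimately have 1: "sqnorm n v = 1" by (simp add: LIMSEQ_const_iff)
    have "cinner n (u i) v = 0" if "i < k" for i
    proof -
      have "(\<lambda>j. cinner n (u i) (X (r j))) \<longlonglongrightarrow> cinner n (u i) v" unfolding cinner_def by (intro tendsto_intros vl) auto
      moreover have "cinner n (u i) (X (r j)) = 0" for j using X(1) that by (auto simp: S_def W_def)
      ultimately show ?thesis by (simp add: LIMSEQ_const_iff)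
    qed
    with 1 v show ?thesis by (auto simp: S_def W_def)
  qed
  have "(\<lambda>j. s - 1 / real (Suc j)) \<longlonglongrightarrow> s - 0"
    by (intro tendsto_intros) (rule LIMSEQ_Suc[OF lim_1_over_n])
  then have "(\<lambda>j. s - 1 / real (Suc (r j))) \<longlonglongrightarrow> s"
    using LIMSEQ_subseq_LIMSEQ[OF _ r] by (force simp: o_def)
  then have "q v \<ge> s" by (rule LIMSEQ_le[OF _ qv]) (use X(2) in \<open>auto intro!: exI[of _ 0] less_imp_le\<close>)
  then have qmax: "q y \<le> q v" if "y \<in> S" for y
    using cSup_upper[OF _ bdd, of "q y"] that by (auto simp: s_def)
  have "q x \<le> q v * sqnorm n x" if xW: "x \<in> W" for x
  proof (cases "x = 0\<^sub>v n")
    case True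
    have "A *\<^sub>v 0\<^sub>v n = 0\<^sub>v m" using A by auto
    then show ?thesis using True by (simp add: q_def sqnorm_def)
  next
    case False
    then obtain y t where "y \<in> S" "x = t \<cdot>\<^sub>v y" "(norm t)\<^sup>2 = sqnorm n x" using norm_W[OF xW] by blast
    then show ?thesis using qmax[of y] q_smult[of y t]
      by (simp add: S_def W_def mult_right_mono mult.commute[of _ "q y"])
  qed
  with \<open>v \<in> S\<close> show ?thesis by (auto simp: S_def W_def q_def)
qed

text \<open>First-order optimality. With z the inner product of the images, passing from v to v + s
  w raises the left side of \<open>max\<close> by at least 2 Re(s z), the right side only by \<mu>
  |s|^2. The choice s = t conj(z) makes the first-order term real and positive, so it wins for small
  t.\<close>

lemma maximal_vectors_orthogonal_images:
  fixes A :: "'a::rc_field mat"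
  assumes A: "A \<in> carrier_mat m n" and v: "v \<in> carrier_vec n" and w: "w \<in> carrier_vec n"
    and 1: "sqnorm n v = 1" "sqnorm n w = 1" and vw: "cinner n v w = 0"
    and max: "\<And>s. sqnorm m (A *\<^sub>v (v + s \<cdot>\<^sub>v w)) \<le> sqnorm m (A *\<^sub>v v) * sqnorm n (v + s \<cdot>\<^sub>v w)"
  shows "cinner m (A *\<^sub>v v) (A *\<^sub>v w) = 0"
proof (rule ccontr)
  define z where "z = cinner m (A *\<^sub>v v) (A *\<^sub>v w)"
  define \<mu> where "\<mu> = sqnorm m (A *\<^sub>v v)"
  \<comment> \<open>The final inequality is \<open>2 \<le> \<mu> * t\<close>; this t gives
    \<open>\<mu> * t < 1\<close>.\<close>
  define t where "t = 1 / (\<mu> + 1)"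
  define s where "s = of_real t * conjugate z"
  assume "cinner m (A *\<^sub>v v) (A *\<^sub>v w) \<noteq> 0"
  then have z: "norm z > 0" by (simp add: z_def)
  have \<mu>: "\<mu> \<ge> 0" by (simp add: \<mu>_def)
  have t: "t > 0" using \<mu> by (simp add: t_def)
  have Av: "A *\<^sub>v v \<in> carrier_vec m" "A *\<^sub>v w \<in> carrier_vec m" using A v w by auto
  have ns: "norm s = t * norm z" using t by (simp add: s_def norm_mult)
  have "cinner n w v = 0" using vw conjugate_cinner[of n v w] by simp
  then have "(of_real (sqnorm n (v + s \<cdot>\<^sub>v w)) :: 'a) = of_real (1 + (norm s)\<^sup>2)"
    using v w vw 1 by (simp add: cinner_self[symmetric] cinner_add_left cinner_add_right cinner_smult_left cinner_smult_right)
      (simp add: cinner_self flip: mult.assoc conjugate_mult_self of_real_power)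
  then have e1: "sqnorm n (v + s \<cdot>\<^sub>v w) = 1 + (norm s)\<^sup>2" by (simp only: of_real_eq_iff)
  have sz: "s * z = of_real (t * (norm z)\<^sup>2)"
    using conjugate_mult_self[of z] by (simp add: s_def mult.assoc)
  have "conjugate (s * z) = of_real (t * (norm z)\<^sup>2)" unfolding sz by (rule conjugate_of_real)
  then have sz': "conjugate s * conjugate z = of_real (t * (norm z)\<^sup>2)" by (simp only: conjugate_dist_mul)
  have "A *\<^sub>v (v + s \<cdot>\<^sub>v w) = A *\<^sub>v v + s \<cdot>\<^sub>v (A *\<^sub>v w)"
    using A v w by (simp add: mult_add_distrib_mat_vec mult_mat_vec)
  then have "(of_real (sqnorm m (A *\<^sub>v (v + s \<cdot>\<^sub>v w))) :: 'a)
      = of_real \<mu> + s * z + conjugate s * conjugate z + (conjugate s * s) * of_real (sqnorm m (A *\<^sub>v w))"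
    using Av by (simp add: cinner_self[symmetric] cinner_add_left cinner_add_right cinner_smult_left cinner_smult_right)
      (simp add: cinner_self \<mu>_def z_def conjugate_cinner algebra_simps)
  also have "\<dots> = of_real (\<mu> + 2 * (t * (norm z)\<^sup>2) + (norm s)\<^sup>2 * sqnorm m (A *\<^sub>v w))"
    unfolding sz sz' conjugate_mult_self by simp
  finally have e2: "sqnorm m (A *\<^sub>v (v + s \<cdot>\<^sub>v w)) = \<mu> + 2 * (t * (norm z)\<^sup>2) + (norm s)\<^sup>2 * sqnorm m (A *\<^sub>v w)"
    by (simp only: of_real_eq_iff)
  have "0 \<le> (norm s)\<^sup>2 * sqnorm m (A *\<^sub>v w)" by simp
  moreover have "\<mu> + 2 * (t * (norm z)\<^sup>2) + (norm s)\<^sup>2 * sqnorm m (A *\<^sub>v w) \<le> \<mu> * (1 + (norm s)\<^sup>2)"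
    using max[of s] unfolding e1 e2 \<mu>_def[symmetric] .
  ultimately have "2 * (t * (norm z)\<^sup>2) \<le> \<mu> * (norm s)\<^sup>2"
    unfolding distrib_left by linarith
  then have "2 * (t * (norm z)\<^sup>2) \<le> \<mu> * (t * norm z)\<^sup>2" unfolding ns .
  then have "2 * (t * (norm z)\<^sup>2) \<le> (\<mu> * t) * (t * (norm z)\<^sup>2)"
    by (simp add: power2_eq_square algebra_simps)
  then have "2 \<le> \<mu> * t" using t z by (simp add: mult_le_cancel_right)
  then show False using \<mu> by (simp add: t_def field_simps)
qed

text \<open>For i < j every combination of \<open>u i\<close> with a multiple of \<open>u j\<close>
  is orthogonal to the vectors before \<open>u i\<close>, so it took part in the maximisation that
  produced \<open>u i\<close>; first-order optimality then makes the two images orthogonal.\<close>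

lemma singular_vectors_exist:
  fixes A :: "'a::rc_field mat"
  assumes A: "A \<in> carrier_mat m n"
  shows "\<exists>u. (\<forall>i<n. u i \<in> carrier_vec n) \<and> (\<forall>i<n. \<forall>j<n. cinner n (u i) (u j) = (if i = j then 1 else 0)) \<and>
    (\<forall>i<n. \<forall>j<n. i \<noteq> j \<longrightarrow> cinner m (A *\<^sub>v u i) (A *\<^sub>v u j) = 0)"
proof -
  define P where "P = (\<lambda>k (u :: nat \<Rightarrow> 'a vec). \<forall>i<k. u i \<in> carrier_vec n \<and> sqnorm n (u i) = 1 \<and> (\<forall>j<i. cinner n (u j) (u i) = 0) \<and>
    (\<forall>x\<in>carrier_vec n. (\<forall>j<i. cinner n (u j) x = 0) \<longrightarrow> sqnorm m (A *\<^sub>v x) \<le> sqnorm m (A *\<^sub>v u i) * sqnorm n x))"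
  have "\<exists>u. P k u" if "k \<le> n" for k
    using that
  proof (induction k)
    case (Suc k)
    then obtain u where u: "P k u" by auto
    obtain v where v: "v \<in> carrier_vec n" "sqnorm n v = 1" "\<forall>i<k. cinner n (u i) v = 0"
      "\<forall>x\<in>carrier_vec n. (\<forall>i<k. cinner n (u i) x = 0) \<longrightarrow> sqnorm m (A *\<^sub>v x) \<le> sqnorm m (A *\<^sub>v v) * sqnorm n x"
      using maximal_vector[OF A, of k u] u Suc.prems by (auto simp: P_def)
    have "P (Suc k) (u(k := v))" using u v by (auto simp: P_def less_Suc_eq)
    then show ?case by blast
  qed (simp add: P_def)
  then obtain u where u: "P n u" by blast
  have uc: "u i \<in> carrier_vec n" "sqnorm n (u i) = 1" if "i < n" for i using u that by (auto simp: P_def)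
  have o1: "cinner n (u i) (u j) = 0" if "i < n" "j < n" "i \<noteq> j" for i j
  proof (cases "i < j")
    case True then show ?thesis using u that by (auto simp: P_def)
  next
    case False
    then have "cinner n (u j) (u i) = 0" using u that by (auto simp: P_def)
    then show ?thesis using conjugate_cinner[of n "u j" "u i"] by simp
  qed
  have o2: "cinner m (A *\<^sub>v u i) (A *\<^sub>v u j) = 0" if "i < j" "j < n" for i j
  proof (rule maximal_vectors_orthogonal_images[OF A])
    fix s
    have "\<forall>l<i. cinner n (u l) (u i + s \<cdot>\<^sub>v u j) = 0"
      using that uc by (auto simp: cinner_add_right cinner_smult_right o1)
    then show "sqnorm m (A *\<^sub>v (u i + s \<cdot>\<^sub>v u j)) \<le> sqnorm m (A *\<^sub>v u i) * sqnorm n (u i + s \<cdot>\<^sub>v u j)"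
      using u that uc[of j] by (auto simp: P_def)
  qed (use that uc o1 in auto)
  have "cinner m (A *\<^sub>v u i) (A *\<^sub>v u j) = 0" if "i < n" "j < n" "i \<noteq> j" for i j
  proof (cases "i < j")
    case True then show ?thesis using o2 that by auto
  next
    case False
    then have "cinner m (A *\<^sub>v u j) (A *\<^sub>v u i) = 0" using o2 that by auto
    then show ?thesis using conjugate_cinner[of m "A *\<^sub>v u j" "A *\<^sub>v u i"] by simp
  qed
  then show ?thesis using uc o1 by (intro exI[of _ u]) (auto simp: cinner_self)
qed

section \<open>Unitary change of basis and the spectrum of the Gram matrix\<close>

lemma mat_adjoint_index:
  assumes "A \<in> carrier_mat m n" "i < n" "j < m"
  shows "mat_adjoint A $$ (i, j) = conjugate (A $$ (j, i))"
  using assms by (simp add: mat_adjoint_def mat_of_rows_index conjugate_vec_def)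

lemma mat_adjoint_carrier: "A \<in> carrier_mat m n \<Longrightarrow> mat_adjoint A \<in> carrier_mat n m"
  unfolding mat_adjoint_def by (intro carrier_matI) auto

lemma mat_adjoint_mult:
  fixes A B :: "'a::conjugatable_field mat"
  assumes A: "A \<in> carrier_mat m n" and B: "B \<in> carrier_mat n k"
  shows "mat_adjoint (A * B) = mat_adjoint B * mat_adjoint A"
proof (rule eq_matI)
  have AB: "A * B \<in> carrier_mat m k" using A B by simp
  note c = mat_adjoint_carrier[OF A] mat_adjoint_carrier[OF B] mat_adjoint_carrier[OF AB]
  fix i j assume "i < dim_row (mat_adjoint B * mat_adjoint A)" "j < dim_col (mat_adjoint B * mat_adjoint A)"
  then have ij: "i < k" "j < m" using c by auto
  show "mat_adjoint (A * B) $$ (i, j) = (mat_adjoint B * mat_adjoint A) $$ (i, j)"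
    using ij A B c by (simp add: mat_adjoint_index[OF AB] scalar_prod_def sum_conjugate conjugate_dist_mul
        mat_adjoint_index[OF A] mat_adjoint_index[OF B] mult.commute)
qed (use mat_adjoint_carrier[OF mult_carrier_mat[OF A B]] mat_adjoint_carrier[OF A] mat_adjoint_carrier[OF B] in auto)

lemma mat_adjoint_mult_index:
  assumes A: "A \<in> carrier_mat m n" and "i < n" "j < n"
  shows "(mat_adjoint A * A) $$ (i, j) = cinner m (col A i) (col A j)"
  using assms mat_adjoint_carrier[OF A]
  by (auto simp: scalar_prod_def cinner_def mat_adjoint_index[OF A] lessThan_atLeast0 intro!: sum.cong)

text \<open>Orthonormal columns make the adjoint a left inverse of U, and U is square, so it is also
  a right inverse; the expansion is x = U (U* x) read entrywise, with U* the adjoint.\<close>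

lemma orthonormal_expansion:
  fixes u :: "nat \<Rightarrow> 'a::rc_field vec"
  assumes u: "\<And>i. i < n \<Longrightarrow> u i \<in> carrier_vec n"
    and on: "\<And>i j. i < n \<Longrightarrow> j < n \<Longrightarrow> cinner n (u i) (u j) = (if i = j then 1 else 0)"
  defines "U \<equiv> mat n n (\<lambda>(i, j). u j $ i)"
  shows "mat_adjoint U * U = 1\<^sub>m n" "U * mat_adjoint U = 1\<^sub>m n"
    "x \<in> carrier_vec n \<Longrightarrow> q < n \<Longrightarrow> x $ q = (\<Sum>i<n. u i $ q * cinner n (u i) x)"
proof -
  have U: "U \<in> carrier_mat n n" by (simp add: U_def)
  have cU: "col U i = u i" if "i < n" for i using that u[OF that] by (auto simp: U_def)
  show 1: "mat_adjoint U * U = 1\<^sub>m n"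
    by (rule eq_matI) (use U mat_adjoint_carrier[OF U] in \<open>auto simp: mat_adjoint_mult_index[OF U] cU on simp del: index_mult_mat(1)\<close>)
  show 2: "U * mat_adjoint U = 1\<^sub>m n"
    by (rule mat_mult_left_right_inverse[OF mat_adjoint_carrier[OF U] U 1])
  assume x: "x \<in> carrier_vec n" and q: "q < n"
  have "x $ q = ((U * mat_adjoint U) *\<^sub>v x) $ q" using x q by (simp add: 2)
  also have "\<dots> = (U *\<^sub>v (mat_adjoint U *\<^sub>v x)) $ q"
    using assoc_mult_mat_vec[OF U mat_adjoint_carrier[OF U] x] by simp
  also have "\<dots> = (\<Sum>i<n. U $$ (q, i) * (mat_adjoint U *\<^sub>v x) $ i)"
    using mult_mat_vec_entry[OF U _ q, of "mat_adjoint U *\<^sub>v x"] mat_adjoint_carrier[OF U] x by auto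
  also have "\<dots> = (\<Sum>i<n. u i $ q * cinner n (u i) x)"
  proof (rule sum.cong)
    fix i assume i: "i \<in> {..<n}"
    have "(mat_adjoint U *\<^sub>v x) $ i = (\<Sum>k<n. conjugate (U $$ (k, i)) * x $ k)"
      using i mult_mat_vec_entry[OF mat_adjoint_carrier[OF U] x, of i]
      by (auto simp: mat_adjoint_index[OF U] simp del: index_mult_mat_vec intro!: sum.cong)
    then show "U $$ (q, i) * (mat_adjoint U *\<^sub>v x) $ i = u i $ q * cinner n (u i) x"
      using i q by (simp add: U_def cinner_def)
  qed simp
  finally show "x $ q = (\<Sum>i<n. u i $ q * cinner n (u i) x)" .
qed

text \<open>Pythagoras for orthogonal vectors of squared length \<open>s i\<close>. With
  \<open>s i = 1\<close> it gives Parseval's identity for x, with squared singular values the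
  analogous formula for the image of x.\<close>

lemma sqnorm_orthogonal_sum:
  fixes w :: "nat \<Rightarrow> 'a::rc_field vec"
  assumes y: "\<And>a. a < m \<Longrightarrow> y $ a = (\<Sum>i\<in>I. w i $ a * c i)" and "finite I"
    and on: "\<And>i j. i \<in> I \<Longrightarrow> j \<in> I \<Longrightarrow> cinner m (w i) (w j) = (if i = j then of_real (s i) else 0)"
  shows "sqnorm m y = (\<Sum>i\<in>I. s i * (norm (c i))\<^sup>2)"
proof -
  have "of_real (sqnorm m y) = (\<Sum>a<m. (\<Sum>i\<in>I. conjugate (w i $ a) * conjugate (c i)) * (\<Sum>j\<in>I. w j $ a * c j))"
    using assms(2) by (simp add: cinner_self[symmetric] cinner_def y sum_conjugate conjugate_dist_mul)
  also have "\<dots> = (\<Sum>a<m. \<Sum>i\<in>I. \<Sum>j\<in>I. conjugate (c i) * c j * (conjugate (w i $ a) * w j $ a))"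
    unfolding sum_product by (intro sum.cong refl) (simp add: mult_ac)
  also have "\<dots> = (\<Sum>i\<in>I. \<Sum>a<m. \<Sum>j\<in>I. conjugate (c i) * c j * (conjugate (w i $ a) * w j $ a))"
    by (rule sum.swap)
  also have "\<dots> = (\<Sum>i\<in>I. \<Sum>j\<in>I. conjugate (c i) * c j * cinner m (w i) (w j))"
    unfolding cinner_def sum_distrib_left by (intro sum.cong refl sum.swap)
  also have "\<dots> = (\<Sum>i\<in>I. \<Sum>j\<in>I. if i = j then of_real (s i) * (conjugate (c i) * c j) else 0)"
    by (intro sum.cong refl) (simp add: on)
  also have "\<dots> = of_real (\<Sum>i\<in>I. s i * (norm (c i))\<^sup>2)"
    using assms(2) by (simp add: conjugate_mult_self)
  finally show ?thesis by (simp only: of_real_eq_iff)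
qed

text \<open>\<open>singular_values\<close> is defined by the characteristic polynomial of the Gram
  matrix \<open>G\<close>. A basis with orthogonal images conjugates \<open>G\<close> to the
  diagonal matrix \<open>D\<close> of squared image lengths, so the image lengths are the singular
  values up to order; the permutation \<open>p\<close> rearranges the basis to match the sorted
  list.\<close>

lemma singular_basis:
  fixes A :: "'a::rc_field mat"
  assumes A: "A \<in> carrier_mat m n"
  shows "length (singular_values A) = n \<and> sorted (rev (singular_values A)) \<and>
    (\<forall>s\<in>set (singular_values A). 0 \<le> s) \<and>
    (\<exists>u. (\<forall>i<n. u i \<in> carrier_vec n) \<and> (\<forall>i<n. \<forall>j<n. cinner n (u i) (u j) = (if i = j then 1 else 0)) \<and>
      (\<forall>i<n. \<forall>j<n. cinner m (A *\<^sub>v u i) (A *\<^sub>v u j) = (if i = j then of_real ((singular_values A ! i)\<^sup>2) else 0)))"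
proof -
  obtain u where u: "\<And>i. i < n \<Longrightarrow> u i \<in> carrier_vec n"
    and on: "\<And>i j. i < n \<Longrightarrow> j < n \<Longrightarrow> cinner n (u i) (u j) = (if i = j then 1 else 0)"
    and im: "\<And>i j. i < n \<Longrightarrow> j < n \<Longrightarrow> i \<noteq> j \<Longrightarrow> cinner m (A *\<^sub>v u i) (A *\<^sub>v u j) = 0"
    using singular_vectors_exist[OF A] by metis
  define U where "U = mat n n (\<lambda>(i, j). u j $ i)"
  have U: "U \<in> carrier_mat n n" by (simp add: U_def)
  have cU: "col U i = u i" if "i < n" for i using that u[OF that] by (auto simp: U_def)
  have UU: "mat_adjoint U * U = 1\<^sub>m n" "U * mat_adjoint U = 1\<^sub>m n"
    using orthonormal_expansion(1,2)[of n u] u on by (simp_all add: U_def)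
  note Uh = mat_adjoint_carrier[OF U] and Ah = mat_adjoint_carrier[OF A]
  define G where "G = mat_adjoint A * A"
  have G: "G \<in> carrier_mat n n" using A Ah by (simp add: G_def)
  define D where "D = mat_adjoint (A * U) * (A * U)"
  have AU: "A * U \<in> carrier_mat m n" using A U by simp
  have D: "D \<in> carrier_mat n n" using AU mat_adjoint_carrier[OF AU] by (simp add: D_def)
  have D_eq: "D = mat_adjoint U * G * U"
    using A U Ah Uh by (simp add: D_def mat_adjoint_mult[OF A U] G_def assoc_mult_mat[of _ n n _ n _ n] assoc_mult_mat[of _ n m _ n _ n] assoc_mult_mat[of _ n n _ m _ n])
  have "U * D * mat_adjoint U = (U * mat_adjoint U) * G * (U * mat_adjoint U)"
    unfolding D_eq using U Uh G by (simp add: assoc_mult_mat[of _ n n _ n _ n])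
  also have "\<dots> = G" using G by (simp add: UU)
  finally have "similar_mat_wit G D U (mat_adjoint U)"
    using U Uh G D UU by (auto intro!: similar_mat_witI)
  then have "char_poly G = char_poly D" by (intro char_poly_similar) (auto simp: similar_mat_def)
  define t where "t = (\<lambda>i. sqnorm m (A *\<^sub>v u i))"
  have Dij: "D $$ (i, j) = (if i = j then of_real (t i) else 0)" if "i < n" "j < n" for i j
  proof -
    have "D $$ (i, j) = cinner m (A *\<^sub>v u i) (A *\<^sub>v u j)"
      unfolding D_def using that by (simp add: mat_adjoint_mult_index[OF AU] col_mult2[OF A U] cU del: index_mult_mat(1))
    then show ?thesis using im that by (auto simp: t_def cinner_self)
  qed
  have "char_poly D = (\<Prod>a\<leftarrow>diag_mat D. [:- a, 1:])"
    by (rule char_poly_upper_triangular[OF D]) (use D in \<open>auto simp: Dij\<close>)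
  also have "diag_mat D = map (\<lambda>i. of_real (t i)) [0..<n]"
    using D by (auto simp: diag_mat_def Dij)
  finally have cp: "char_poly G = (\<Prod>i\<leftarrow>[0..<n]. [:- of_real (t i), 1:])"
    using \<open>char_poly G = char_poly D\<close> by (simp add: o_def)
  have pr: "proots (\<Prod>i\<leftarrow>is. [:- (of_real (t i) :: 'a), 1:]) = mset (map (\<lambda>i. of_real (t i)) is)" for "is"
  proof (induction "is")
    case (Cons i "is")
    have "(\<Prod>i\<leftarrow>is. [:- (of_real (t i) :: 'a), 1:]) \<noteq> 0" by (auto simp: prod_list_zero_iff)
    then show ?case using Cons by (simp add: proots_mult del: mult_pCons_left mult_pCons_right)
  qed simp
  define xs where "xs = map (\<lambda>i. sqrt (t i)) [0..<n]"
  have "image_mset (\<lambda>\<mu>. sqrt (norm \<mu>)) (proots (char_poly G)) = mset xs"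
    unfolding cp pr xs_def by (simp add: image_mset.compositionality o_def t_def)
  then have sv: "singular_values A = rev (sort xs)"
    by (simp add: singular_values_def G_def)
  then obtain p where p: "p permutes {..<n}" "permute_list p xs = singular_values A"
    using mset_eq_permutation[of "singular_values A" xs] by (auto simp: xs_def)
  have svi: "singular_values A ! i = sqrt (t (p i))" if "i < n" for i
    using p that permutes_in_image[OF p(1)] by (auto simp: permute_list_nth xs_def simp flip: p(2))
  have pn: "p i < n" if "i < n" for i using permutes_in_image[OF p(1)] that by auto
  have pe: "p i = p j \<longleftrightarrow> i = j" for i j using permutes_inj[OF p(1)] by (auto dest: injD)
  have t0: "t i \<ge> 0" for i by (simp add: t_def)
  show ?thesis
  proof (intro conjI exI[of _ "\<lambda>i. u (p i)"] allI impI)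
    show "length (singular_values A) = n" "sorted (rev (singular_values A))"
      by (simp_all add: sv xs_def)
    show "\<forall>s\<in>set (singular_values A). 0 \<le> s" using t0 by (auto simp: sv xs_def)
    fix i j assume ij: "i < n" "j < n"
    show "cinner n (u (p i)) (u (p j)) = (if i = j then 1 else 0)" using ij by (simp add: on pn pe)
    show "cinner m (A *\<^sub>v u (p i)) (A *\<^sub>v u (p j)) = (if i = j then of_real ((singular_values A ! i)\<^sup>2) else 0)"
      using ij t0[of "p i"] by (simp add: im pn pe svi t_def cinner_self del: of_real_power)
  qed (simp add: u pn)
qed

section \<open>Coordinates of decompositions\<close>

text \<open>The position in a stacked vector of entry \<open>j\<close> of factor \<open>k\<close> of term \<open>i\<close>, and the
  mixed-radix digits of a position \<open>j\<close> in a Kronecker product.\<close>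

definition entry_pos :: "nat list \<Rightarrow> nat \<Rightarrow> nat \<Rightarrow> nat \<Rightarrow> nat" where
  "entry_pos ns i k j = i * sum_list ns + sum_list (take k ns) + j"

fun digits :: "nat list \<Rightarrow> nat \<Rightarrow> nat list" where
  "digits [] j = []"
| "digits (n # ns) j = (j div prod_list ns) # digits ns (j mod prod_list ns)"

lemma length_digits [simp]: "length (digits ns j) = length ns"
  by (induction ns arbitrary: j) auto

lemma digits_less: "j < prod_list ns \<Longrightarrow> k < length ns \<Longrightarrow> digits ns j ! k < ns ! k"
proof (induction ns arbitrary: j k)
  case (Cons n ns)
  then have "prod_list ns > 0" by (metis gr0I mult_is_0 not_less0 prod_list.Cons)
  with Cons show ?case
    by (cases k) (auto simp: less_mult_imp_div_less)
qed simp

lemma kron_list_dims: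
  "dim_row (kron_list As) = prod_list (map dim_row As)"
  "dim_col (kron_list As) = prod_list (map dim_col As)"
  by (induction As) (auto simp: kron_list_def kron_def)

lemma kron_list_entry:
  assumes "i < prod_list (map dim_row As)" "j < prod_list (map dim_col As)"
  shows "kron_list As $$ (i, j) =
    (\<Prod>k<length As. As ! k $$ (digits (map dim_row As) i ! k, digits (map dim_col As) j ! k) :: 'a::comm_semiring_1)"
  using assms
proof (induction As arbitrary: i j)
  case Nil
  then show ?case by (simp add: kron_list_def)
next
  case (Cons A As)
  let ?R = "prod_list (map dim_row As)" and ?C = "prod_list (map dim_col As)"
  have RC: "?R > 0" "?C > 0" using Cons.prems by (auto intro: Nat.gr0I)
  have "kron_list (A # As) = kron A (kron_list As)" by (simp add: kron_list_def)
  then have "kron_list (A # As) $$ (i, j) = A $$ (i div ?R, j div ?C) * kron_list As $$ (i mod ?R, j mod ?C)"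
    using Cons.prems by (simp add: kron_def kron_list_dims)
  also have "kron_list As $$ (i mod ?R, j mod ?C) = (\<Prod>k<length As. As ! k $$
      (digits (map dim_row As) (i mod ?R) ! k, digits (map dim_col As) (j mod ?C) ! k))"
    by (rule Cons.IH) (use RC in auto)
  finally show ?case by (simp only: length_Cons prod.lessThan_Suc_shift) simp
qed

lemma tensor_entry:
  assumes "j < prod_list (map dim_vec b)"
  shows "tensor b $ j = (\<Prod>k<length b. b ! k $ (digits (map dim_vec b) j ! k) :: 'a::comm_semiring_1)"
proof -
  have rows: "map dim_row (map col_mat b) = map dim_vec b" and cols: "map dim_col (map col_mat b) = replicate (length b) 1"
    by (auto simp: col_mat_def intro: nth_equalityI)
  have c1: "prod_list (map dim_col (map col_mat b)) = 1" unfolding cols by (induction b) auto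
  have "tensor b $ j = kron_list (map col_mat b) $$ (j, 0)"
    using assms c1 by (simp add: tensor_def kron_list_dims rows del: map_map)
  also have "\<dots> = (\<Prod>k<length b. col_mat (b ! k) $$ (digits (map dim_vec b) j ! k, digits (replicate (length b) 1) 0 ! k))"
    using kron_list_entry[of j "map col_mat b" 0] assms c1 unfolding rows cols by simp
  also have "\<dots> = (\<Prod>k<length b. b ! k $ (digits (map dim_vec b) j ! k))"
  proof (rule prod.cong)
    fix k assume k: "k \<in> {..<length b}"
    have "digits (replicate (length b) 1) 0 ! k = 0"
      using digits_less[of 0 "replicate (length b) 1" k] k c1 cols by simp
    moreover have "digits (map dim_vec b) j ! k < dim_vec (b ! k)" using digits_less[OF assms, of k] k by simp
    ultimately show "col_mat (b ! k) $$ (digits (map dim_vec b) j ! k, digits (replicate (length b) 1) 0 ! k)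
        = b ! k $ (digits (map dim_vec b) j ! k)" by (simp add: col_mat_def mat_of_cols_index)
  qed simp
  finally show ?thesis .
qed

text \<open>Meant for the columns of a Terracini block: every factor but the one at position k has a
  single column, so the column index is its own digit at position k.\<close>

lemma digits_unit: "c < n \<Longrightarrow> digits (replicate k 1 @ n # replicate m 1) c ! k = c"
  by (induction k) auto

text \<open>The identity matrix at position k contributes a Kronecker delta and the other factors
  one entry each: column c is the derivative of the rank-one tensor with respect to entry c of
  factor k.\<close>

lemma terracini_block_entry:
  fixes b :: "'a::comm_semiring_1 vec list"
  assumes k: "k < length b" and c: "c < dim_vec (b ! k)" and j: "j < prod_list (map dim_vec b)"
  shows "terracini_block b k $$ (j, c) =
    (if digits (map dim_vec b) j ! k = c then (\<Prod>l\<in>{..<length b} - {k}. b ! l $ (digits (map dim_vec b) j ! l)) else 0)"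
    "dim_col (terracini_block b k) = dim_vec (b ! k)" "dim_row (terracini_block b k) = prod_list (map dim_vec b)"
proof -
  define As where "As = map col_mat (take k b) @ [1\<^sub>m (dim_vec (b ! k))] @ map col_mat (drop (Suc k) b)"
  define m where "m = length b - Suc k"
  have tb: "terracini_block b k = kron_list As" by (simp add: terracini_block_def As_def)
  have lA: "length As = length b" using k by (simp add: As_def)
  have nthA: "As ! l = (if l = k then 1\<^sub>m (dim_vec (b ! k)) else col_mat (b ! l))" if "l < length b" for l
    using that k by (auto simp: As_def nth_append nth_Cons' min_def)
  have rows: "map dim_row As = map dim_vec b"
    by (rule nth_equalityI) (auto simp: lA nthA col_mat_def)
  have cols: "map dim_col As = replicate k 1 @ dim_vec (b ! k) # replicate m 1"
    using k by (intro nth_equalityI) (auto simp: lA nthA col_mat_def nth_append nth_Cons' m_def)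
  have pc: "prod_list (map dim_col As) = dim_vec (b ! k)" unfolding cols by simp
  show "dim_col (terracini_block b k) = dim_vec (b ! k)" "dim_row (terracini_block b k) = prod_list (map dim_vec b)"
    by (simp_all add: tb kron_list_dims pc rows)
  let ?j = "digits (map dim_vec b) j" and ?c = "digits (map dim_col As) c"
  have ck: "?c ! k = c" unfolding cols by (rule digits_unit[OF c])
  have cl: "?c ! l = 0" if "l < length b" "l \<noteq> k" for l
    using digits_less[of c "map dim_col As" l] that c pc by (simp add: lA nthA col_mat_def)
  have jl: "?j ! l < dim_vec (b ! l)" if "l < length b" for l using digits_less[OF j, of l] that by simp
  have "terracini_block b k $$ (j, c) = (\<Prod>l<length b. As ! l $$ (?j ! l, ?c ! l))"
    using kron_list_entry[of j As c] j c by (simp add: tb rows pc lA)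
  also have "\<dots> = As ! k $$ (?j ! k, ?c ! k) * (\<Prod>l\<in>{..<length b} - {k}. As ! l $$ (?j ! l, ?c ! l))"
    using k by (simp add: prod.remove)
  also have "As ! k $$ (?j ! k, ?c ! k) = (if ?j ! k = c then 1 else 0)"
    using k c jl[OF k] by (simp add: nthA ck)
  also have "(\<Prod>l\<in>{..<length b} - {k}. As ! l $$ (?j ! l, ?c ! l)) = (\<Prod>l\<in>{..<length b} - {k}. b ! l $ (?j ! l))"
    by (rule prod.cong) (use jl cl in \<open>auto simp: nthA col_mat_def mat_of_cols_index\<close>)
  finally show "terracini_block b k $$ (j, c) = (if ?j ! k = c then (\<Prod>l\<in>{..<length b} - {k}. b ! l $ (?j ! l)) else 0)"
    by simp
qed

section \<open>Entries of f and of Terracini's matrix\<close>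

lemma unvecr_nth:
  assumes "i < r" "k < length ns" "j < ns ! k"
  shows "unvecr ns r x ! i ! k $ j = x $ entry_pos ns i k j"
  using assms by (simp add: unvecr_def entry_pos_def)

lemma unvecr_dims:
  "length (unvecr ns r x) = r" "i < r \<Longrightarrow> map dim_vec (unvecr ns r x ! i) = ns"
  "i < r \<Longrightarrow> length (unvecr ns r x ! i) = length ns"
  by (auto simp: unvecr_def intro: nth_equalityI)

lemma dim_cpd_map [simp]: "dim_vec (cpd_map ns r x) = prod_list ns"
  by (simp add: cpd_map_def)

lemma cpd_map_carrier [simp]: "cpd_map ns r x \<in> carrier_vec (prod_list ns)"
  by (simp add: cpd_map_def)

lemma cpd_map_entry:
  fixes x :: "'a::comm_semiring_1 vec"
  assumes "j < prod_list ns"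
  shows "cpd_map ns r x $ j = (\<Sum>i<r. \<Prod>k<length ns. x $ entry_pos ns i k (digits ns j ! k))"
proof -
  have "cpd_map ns r x $ j = (\<Sum>i<r. tensor (unvecr ns r x ! i) $ j)"
    using assms by (simp add: cpd_map_def sum_list_sum_nth unvecr_dims lessThan_atLeast0)
  also have "\<dots> = (\<Sum>i<r. \<Prod>k<length ns. x $ entry_pos ns i k (digits ns j ! k))"
  proof (intro sum.cong refl)
    fix i assume i: "i \<in> {..<r}"
    have "tensor (unvecr ns r x ! i) $ j = (\<Prod>k<length ns. unvecr ns r x ! i ! k $ (digits ns j ! k))"
      using tensor_entry[of j "unvecr ns r x ! i"] assms i by (simp add: unvecr_dims)
    also have "\<dots> = (\<Prod>k<length ns. x $ entry_pos ns i k (digits ns j ! k))"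
      by (rule prod.cong) (use i assms in \<open>auto simp: unvecr_nth digits_less\<close>)
    finally show "tensor (unvecr ns r x ! i) $ j = (\<Prod>k<length ns. x $ entry_pos ns i k (digits ns j ! k))" .
  qed
  finally show ?thesis .
qed

lemma entry_pos_less: "i < r \<Longrightarrow> k < length ns \<Longrightarrow> j < ns ! k \<Longrightarrow> entry_pos ns i k j < r * sum_list ns"
proof -
  assume a: "i < r" "k < length ns" "j < ns ! k"
  have "entry_pos ns i k j < i * sum_list ns + sum_list ns"
    using sum_list_take_less[OF a(2,3)] by (simp add: entry_pos_def)
  also have "\<dots> = Suc i * sum_list ns" by simp
  also have "\<dots> \<le> r * sum_list ns" using a by (intro mult_le_mono1) simp
  finally show ?thesis .
qed

lemma take_sum_mono: "k < k' \<Longrightarrow> k' \<le> length ns \<Longrightarrow> sum_list (take k ns) + ns ! k \<le> sum_list (take k' (ns :: nat list))"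
proof -
  assume a: "k < k'" "k' \<le> length ns"
  have "take (Suc k) ns = take k ns @ [ns ! k]" using a by (simp add: take_Suc_conv_app_nth)
  moreover have "take k' ns = take (Suc k) ns @ drop (Suc k) (take k' ns)"
    using a by (metis append_take_drop_id min.absorb1 Suc_leI take_take)
  ultimately have "sum_list (take k' ns) = (sum_list (take k ns) + ns ! k) + sum_list (drop (Suc k) (take k' ns))"
    by (metis sum_list_append sum_list.Cons sum_list.Nil add.right_neutral)
  then show ?thesis by simp
qed

lemma take_sum_inj:
  fixes ns :: "nat list"
  assumes "k < length ns" "j < ns ! k" "k' < length ns" "j' < ns ! k'"
    and eq: "sum_list (take k ns) + j = sum_list (take k' ns) + j'"
  shows "k = k' \<and> j = j'"
proof -
  have "\<not> k < k'" "\<not> k' < k"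
    using take_sum_mono[of k k' ns] take_sum_mono[of k' k ns] assms by auto
  then show ?thesis using eq by auto
qed

lemma block_div_mod: "m < s \<Longrightarrow> (j * s + m) div s = j \<and> (j * s + m) mod s = (m :: nat)"
  by simp

lemma block_index_inj: "l < s \<Longrightarrow> l' < s \<Longrightarrow> i * s + l = i' * s + (l' :: nat) \<Longrightarrow> i = i' \<and> l = l'"
  by (metis add_left_cancel add.right_neutral div_less div_mult_self3 not_less0)

lemma entry_pos_inj:
  assumes "k < length ns" "j < ns ! k" "k' < length ns" "j' < ns ! k'"
  shows "entry_pos ns i k j = entry_pos ns i' k' j' \<longleftrightarrow> i = i' \<and> k = k' \<and> j = j'"
proof
  assume eq: "entry_pos ns i k j = entry_pos ns i' k' j'"
  let ?l = "sum_list (take k ns) + j" and ?l' = "sum_list (take k' ns) + j'"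
  have l: "?l < sum_list ns" "?l' < sum_list ns" using assms by (auto intro: sum_list_take_less)
  have "i * sum_list ns + ?l = i' * sum_list ns + ?l'" using eq by (simp add: entry_pos_def)
  then have "i = i'" "?l = ?l'" using block_index_inj[OF l] by blast+
  then show "i = i' \<and> k = k' \<and> j = j'" using take_sum_inj[OF assms] by simp
qed simp

text \<open>The choice inverts \<open>entry_pos\<close>, which is injective on valid triples by
  \<open>entry_pos_inj\<close>; so a vector can be defined by term, factor and entry.\<close>

definition triple_vec :: "nat list \<Rightarrow> nat \<Rightarrow> (nat \<Rightarrow> nat \<Rightarrow> nat \<Rightarrow> 'a) \<Rightarrow> 'a vec" where
  "triple_vec ns r F = vec (r * sum_list ns)
     (\<lambda>q. case (SOME (i, k, j). k < length ns \<and> j < ns ! k \<and> q = entry_pos ns i k j) of (i, k, j) \<Rightarrow> F i k j)"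

lemma triple_vec_carrier [simp]: "triple_vec ns r F \<in> carrier_vec (r * sum_list ns)"
  by (simp add: triple_vec_def)

lemma triple_vec_entry:
  assumes "i < r" "k < length ns" "j < ns ! k"
  shows "triple_vec ns r F $ entry_pos ns i k j = F i k j"
proof -
  have "(SOME (i', k', j'). k' < length ns \<and> j' < ns ! k' \<and> entry_pos ns i k j = entry_pos ns i' k' j') = (i, k, j)"
    by (rule some_equality) (use assms in \<open>auto simp: entry_pos_inj\<close>)
  then show ?thesis using entry_pos_less[OF assms] by (simp add: triple_vec_def)
qed

lemma sum_take_sum:
  "(\<Sum>l<sum_list (ns :: nat list). h l) = (\<Sum>k<length ns. \<Sum>j<ns ! k. h (sum_list (take k ns) + j) :: 'a::comm_monoid_add)"
proof (induction ns arbitrary: h)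
  case (Cons n ns)
  have "(\<Sum>l<n + t. h l) = (\<Sum>l<n. h l) + (\<Sum>l<t. h (n + l))" for t
    by (induction t) (auto simp: add.assoc)
  then show ?case by (simp add: Cons.IH sum.lessThan_Suc_shift add.assoc del: sum.lessThan_Suc)
qed simp

lemma sum_blocks: "(\<Sum>q<r * (s :: nat). h q) = (\<Sum>i<r. \<Sum>l<s. h (i * s + l) :: 'a::comm_monoid_add)"
proof (induction r)
  case (Suc r)
  have "(\<Sum>q<r * s + t. h q) = (\<Sum>q<r * s. h q) + (\<Sum>l<t. h (r * s + l))" for t
    by (induction t) (auto simp: add.assoc)
  from this[of s] show ?case using Suc by (simp add: add.commute)
qed simp

lemma sum_entry_pos:
  "(\<Sum>q<r * sum_list ns. h q) = (\<Sum>i<r. \<Sum>k<length ns. \<Sum>j<ns ! k. h (entry_pos ns i k j) :: 'a::comm_monoid_add)"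
  by (simp add: sum_blocks sum_take_sum entry_pos_def add.assoc)

lemma terracini_entry:
  fixes x :: "'a::comm_semiring_1 vec"
  assumes i: "i < r" and k: "k < length ns" and c: "c < ns ! k" and j: "j < prod_list ns"
  shows "terracini ns r x $$ (j, entry_pos ns i k c) =
     (if digits ns j ! k = c then (\<Prod>l\<in>{..<length ns} - {k}. x $ entry_pos ns i l (digits ns j ! l)) else 0)"
proof -
  let ?bs = "unvecr ns r x"
  define F where "F = (\<lambda>b :: 'a vec list. concat (map (\<lambda>k. cols (terracini_block b k)) [0..<length b]))"
  let ?cs = "concat (map F ?bs)"
  have dimk: "dim_vec (?bs ! i' ! k') = ns ! k'" if "i' < r" "k' < length ns" for i' k'
    using that by (simp add: unvecr_def)
  have dc: "dim_col (terracini_block (?bs ! i') k') = ns ! k'" if "i' < r" "k' < length ns" for i' k'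
  \<comment> \<open>\<open>terracini_block_entry\<close> wants a valid row and column and is
    instantiated with 0 and 0. The second case is contradictory, because row j exists.\<close>
  proof (cases "ns ! k' > 0 \<and> prod_list ns > 0")
    case True
    then show ?thesis using terracini_block_entry(2)[of k' "?bs ! i'" 0 0] that by (simp add: unvecr_dims dimk)
  next
    case False
    have "prod_list ns > 0" using j by simp
    then have "ns ! k' > 0" using that
      by (metis gr0I nth_mem prod_list_zero_iff)
    then show ?thesis using False \<open>prod_list ns > 0\<close> by simp
  qed
  have l1: "map length (map (\<lambda>k. cols (terracini_block (?bs ! i') k)) [0..<length (?bs ! i')]) = ns" if "i' < r" for i'
    using that by (intro nth_equalityI) (auto simp: unvecr_dims dc)
  have lF: "length (F (?bs ! i')) = sum_list ns" if "i' < r" for i'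
    using l1[OF that] by (simp add: F_def length_concat)
  have l2: "map length (map F ?bs) = replicate r (sum_list ns)"
    by (intro nth_equalityI) (auto simp: unvecr_dims lF)
  have lc: "sum_list (take k ns) + c < sum_list ns" using k c by (rule sum_list_take_less)
  have len: "length ?cs = r * sum_list ns" unfolding length_concat l2 by (simp add: sum_list_replicate)
  have "?cs ! entry_pos ns i k c = F (?bs ! i) ! (sum_list (take k ns) + c)"
    using nth_concat_take[of i "map F ?bs" "sum_list (take k ns) + c"] i lc
    unfolding l2 by (simp add: unvecr_dims lF entry_pos_def sum_list_replicate add.assoc)
  also have "\<dots> = cols (terracini_block (?bs ! i) k) ! c"
    using nth_concat_take[of k "map (\<lambda>k. cols (terracini_block (?bs ! i) k)) [0..<length (?bs ! i)]" c] i k c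
    unfolding l1[OF i] by (simp add: F_def unvecr_dims dc)
  also have "\<dots> = col (terracini_block (?bs ! i) k) c" using dc[OF i k] c by simp
  finally have e: "?cs ! entry_pos ns i k c = col (terracini_block (?bs ! i) k) c" .
  have "terracini ns r x $$ (j, entry_pos ns i k c) = terracini_block (?bs ! i) k $$ (j, c)"
    using j entry_pos_less[OF i k c] len e terracini_block_entry(2,3)[of k "?bs ! i" c j] i k c
    by (simp add: terracini_def mat_of_cols_index flip: F_def) (simp add: unvecr_dims dimk)
  also have "\<dots> = (if digits ns j ! k = c then (\<Prod>l\<in>{..<length ns} - {k}. ?bs ! i ! l $ (digits ns j ! l)) else 0)"
    using terracini_block_entry(1)[of k "?bs ! i" c j] i k c j by (simp add: unvecr_dims dimk)
  also have "(\<Prod>l\<in>{..<length ns} - {k}. ?bs ! i ! l $ (digits ns j ! l)) = (\<Prod>l\<in>{..<length ns} - {k}. x $ entry_pos ns i l (digits ns j ! l))"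
    by (rule prod.cong) (use i j in \<open>auto simp: unvecr_nth digits_less\<close>)
  finally show ?thesis .
qed

lemma terracini_carrier:
  assumes "prod_list ns > 0"
  shows "terracini ns r (x :: 'a::comm_semiring_1 vec) \<in> carrier_mat (prod_list ns) (r * sum_list ns)"
proof -
  let ?bs = "unvecr ns r x"
  have "length (concat (map (\<lambda>k. cols (terracini_block (?bs ! i) k)) [0..<length (?bs ! i)])) = sum_list ns" if "i < r" for i
  proof -
    have "ns ! k > 0" if "k < length ns" for k using assms that by (metis gr0I nth_mem prod_list_zero_iff)
    then have "map length (map (\<lambda>k. cols (terracini_block (?bs ! i) k)) [0..<length (?bs ! i)]) = ns"
      using that assms terracini_block_entry(2)[of _ "?bs ! i" 0 0]
      by (intro nth_equalityI) (auto simp: unvecr_dims, simp add: unvecr_def)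
    then show ?thesis by (simp add: length_concat)
  qed
  then have "map length (map (\<lambda>b. concat (map (\<lambda>k. cols (terracini_block b k)) [0..<length b])) ?bs) = replicate r (sum_list ns)"
    by (intro nth_equalityI) (auto simp: unvecr_dims)
  then show ?thesis unfolding terracini_def
    by (intro carrier_matI) (auto simp: length_concat sum_list_replicate simp del: map_map)
qed

text \<open>The right-hand side is the Leibniz rule for the formula in \<open>cpd_map_entry\<close>.
  This is how Terracini's matrix is recognised as the Jacobian matrix of f.\<close>

lemma terracini_mult_entry:
  fixes x :: "'a::comm_semiring_1 vec"
  assumes "j < prod_list ns" and v: "v \<in> carrier_vec (r * sum_list ns)"
  shows "(terracini ns r x *\<^sub>v v) $ j =
    (\<Sum>i<r. \<Sum>k<length ns. (\<Prod>l\<in>{..<length ns} - {k}. x $ entry_pos ns i l (digits ns j ! l)) * v $ entry_pos ns i k (digits ns j ! k))"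
proof -
  have c: "terracini ns r x \<in> carrier_mat (prod_list ns) (r * sum_list ns)"
    by (rule terracini_carrier) (use assms in auto)
  have "(terracini ns r x *\<^sub>v v) $ j = (\<Sum>q<r * sum_list ns. terracini ns r x $$ (j, q) * v $ q)"
    using c v assms by (auto simp: scalar_prod_def lessThan_atLeast0)
  also have "\<dots> = (\<Sum>i<r. \<Sum>k<length ns. \<Sum>c<ns ! k. (if digits ns j ! k = c then
     (\<Prod>l\<in>{..<length ns} - {k}. x $ entry_pos ns i l (digits ns j ! l)) * v $ entry_pos ns i k c else 0))"
    unfolding sum_entry_pos by (intro sum.cong refl) (use assms in \<open>auto simp: terracini_entry\<close>)
  also have "\<dots> = (\<Sum>i<r. \<Sum>k<length ns. (\<Prod>l\<in>{..<length ns} - {k}. x $ entry_pos ns i l (digits ns j ! l)) * v $ entry_pos ns i k (digits ns j ! k))"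
    by (intro sum.cong refl) (use assms in \<open>auto simp: digits_less\<close>)
  finally show ?thesis .
qed

section \<open>The action of the symmetry group on decompositions\<close>

lemma diag_block_mat_carrier:
  assumes "list_all2 (\<lambda>M d. M \<in> carrier_mat d d) Ms ds"
  shows "diag_block_mat Ms \<in> carrier_mat (sum_list ds) (sum_list ds)"
proof -
  have "map dim_row Ms = ds" "map dim_col Ms = ds"
    using assms by (auto simp: list_all2_conv_all_nth intro!: nth_equalityI)
  then show ?thesis by (intro carrier_matI) (simp_all add: dim_diag_block_mat)
qed

lemma diag_block_mat_mult_entry:
  fixes x :: "'a::comm_semiring_1 vec"
  assumes "list_all2 (\<lambda>M d. M \<in> carrier_mat d d) Ms ds" "x \<in> carrier_vec (sum_list ds)"
    and "i < length ds" "l < ds ! i"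
  shows "(diag_block_mat Ms *\<^sub>v x) $ (sum_list (take i ds) + l)
    = (Ms ! i *\<^sub>v vec (ds ! i) (\<lambda>l. x $ (sum_list (take i ds) + l))) $ l"
  using assms
proof (induction arbitrary: x i rule: list_all2_induct)
  case (Cons M Ms d ds)
  let ?D = "diag_block_mat Ms"
  have D: "?D \<in> carrier_mat (sum_list ds) (sum_list ds)"
    by (rule diag_block_mat_carrier[OF Cons.hyps(2)])
  define y where "y = vec d (\<lambda>l. x $ l)"
  define z where "z = vec (sum_list ds) (\<lambda>l. x $ (d + l))"
  have x: "x = y @\<^sub>v z" using Cons.prems(1) by (intro eq_vecI) (auto simp: y_def z_def)
  have e: "diag_block_mat (M # Ms) *\<^sub>v x = (M *\<^sub>v y) @\<^sub>v (?D *\<^sub>v z)"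
  proof -
    have "y \<in> carrier_vec d" "z \<in> carrier_vec (sum_list ds)" by (simp_all add: y_def z_def)
    from mult_mat_vec_split[OF Cons.hyps(1) D this] Cons.hyps(1) D
    have "diag_block_mat (M # Ms) *\<^sub>v (y @\<^sub>v z) = (M *\<^sub>v y) @\<^sub>v (?D *\<^sub>v z)"
      by (simp add: Let_def)
    then show ?thesis by (simp only: x[symmetric])
  qed
  show ?case
  proof (cases i)
    case 0
    then show ?thesis using e Cons.prems Cons.hyps(1) D by (simp add: y_def)
  next
    case (Suc i')
    have "(?D *\<^sub>v z) $ (sum_list (take i' ds) + l) = (Ms ! i' *\<^sub>v vec (ds ! i') (\<lambda>l. z $ (sum_list (take i' ds) + l))) $ l"
      by (rule Cons.IH) (use Cons.prems Suc in \<open>auto simp: z_def\<close>)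
    moreover have "sum_list (take i' ds) + l < sum_list ds"
      by (rule sum_list_take_less) (use Cons.prems Suc in auto)
    moreover have "vec (ds ! i') (\<lambda>l. z $ (sum_list (take i' ds) + l)) = vec (ds ! i') (\<lambda>l. x $ (d + sum_list (take i' ds) + l))"
      by (rule eq_vecI) (use Cons.prems Suc sum_list_take_less[of i' ds] in \<open>auto simp: z_def add.assoc\<close>)
    ultimately show ?thesis using e Cons.hyps(1) D Suc by (simp add: add.assoc)
  qed
qed simp

text \<open>Takes all d scalars, the first included, so that the constraint built into
  \<open>scaling_mats\<close> becomes that their product is 1.\<close>

definition scaling_of :: "nat list \<Rightarrow> 'a::field list \<Rightarrow> 'a mat" where
  "scaling_of ns \<alpha>s = diag_block_mat (map2 (\<lambda>\<alpha> n. \<alpha> \<cdot>\<^sub>m 1\<^sub>m n) \<alpha>s ns)"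

lemma scaling_of_carrier:
  "length \<alpha>s = length ns \<Longrightarrow> scaling_of ns \<alpha>s \<in> carrier_mat (sum_list ns) (sum_list ns)"
  unfolding scaling_of_def by (rule diag_block_mat_carrier) (auto simp: list_all2_conv_all_nth)

lemma scaling_of_entry:
  assumes "length \<alpha>s = length ns" "y \<in> carrier_vec (sum_list ns)" "k < length ns" "c < ns ! k"
  shows "(scaling_of ns \<alpha>s *\<^sub>v y) $ (sum_list (take k ns) + c) = \<alpha>s ! k * y $ (sum_list (take k ns) + c)"
proof -
  have e: "(a \<cdot>\<^sub>m 1\<^sub>m n) *\<^sub>v v = a \<cdot>\<^sub>v v" if "v \<in> carrier_vec n" for a :: 'a and n v
  proof (rule eq_vecI)
    fix i assume "i < dim_vec (a \<cdot>\<^sub>v v)"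
    then have i: "i < n" using that by simp
    have "((a \<cdot>\<^sub>m 1\<^sub>m n) *\<^sub>v v) $ i = (\<Sum>j = 0..<n. a * (if j = i then 1 else 0) * v $ j)"
      using i that by (simp add: scalar_prod_def)
    also have "\<dots> = (\<Sum>j = 0..<n. if j = i then a * v $ j else 0)"
      by (rule sum.cong) auto
    finally show "((a \<cdot>\<^sub>m 1\<^sub>m n) *\<^sub>v v) $ i = (a \<cdot>\<^sub>v v) $ i" using i that by simp
  qed (use that in simp)
  have "list_all2 (\<lambda>M d. M \<in> carrier_mat d d) (map2 (\<lambda>\<alpha> n. \<alpha> \<cdot>\<^sub>m 1\<^sub>m n) \<alpha>s ns) ns"
    using assms(1) by (auto simp: list_all2_conv_all_nth)
  from diag_block_mat_mult_entry[OF this assms(2-4)] show ?thesis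
    using assms by (simp add: scaling_of_def e)
qed

text \<open>A symmetry moves term i to position \<open>\<pi> i\<close> and scales its factors by
  numbers with product 1. This entrywise form spares the invariance of f any matrix
  computation.\<close>

lemma symmetries_action:
  fixes T :: "'a::field mat"
  assumes T: "T \<in> symmetries ns r" and d: "length ns \<ge> 1"
  obtains \<pi> \<alpha> where "\<pi> permutes {..<r}" "\<And>i. i < r \<Longrightarrow> (\<Prod>k<length ns. \<alpha> i k) = 1"
    "T \<in> carrier_mat (r * sum_list ns) (r * sum_list ns)"
    "\<And>x i k c. x \<in> carrier_vec (r * sum_list ns) \<Longrightarrow> i < r \<Longrightarrow> k < length ns \<Longrightarrow> c < ns ! k \<Longrightarrow>
       (T *\<^sub>v x) $ entry_pos ns (\<pi> i) k c = \<alpha> i k * x $ entry_pos ns i k c"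
proof -
  let ?s = "sum_list ns" and ?n = "r * sum_list ns"
  obtain \<pi> Ds where \<pi>: "\<pi> permutes {..<r}" and Ds: "length Ds = r" "set Ds \<subseteq> scaling_mats ns"
    and T_eq: "T = kron (mat r r (\<lambda>(i, j). if i = \<pi> j then 1 else 0)) (1\<^sub>m ?s) * diag_block_mat Ds"
    using T by (auto simp: symmetries_def block_perm_mats_def block_scaling_mats_def)
  have "\<exists>\<alpha>s. length \<alpha>s = length ns \<and> prod_list \<alpha>s = 1 \<and> Ds ! i = scaling_of ns \<alpha>s" if "i < r" for i
  proof -
    have "Ds ! i \<in> scaling_mats ns" using that Ds by auto
    then obtain \<alpha>s where "length \<alpha>s = length ns - 1" "0 \<notin> set \<alpha>s"
      "Ds ! i = scaling_of ns (inverse (prod_list \<alpha>s) # \<alpha>s)"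
      unfolding scaling_mats_def scaling_of_def by blast
    then show ?thesis using d
      by (intro exI[of _ "inverse (prod_list \<alpha>s) # \<alpha>s"]) (auto simp: prod_list_zero_iff)
  qed
  then obtain \<beta> where \<beta>: "\<And>i. i < r \<Longrightarrow> length (\<beta> i) = length ns" "\<And>i. i < r \<Longrightarrow> prod_list (\<beta> i) = 1"
    "\<And>i. i < r \<Longrightarrow> Ds ! i = scaling_of ns (\<beta> i)" by metis
  define P :: "'a mat" where "P = kron (mat r r (\<lambda>(i, j). if i = \<pi> j then 1 else 0)) (1\<^sub>m ?s)"
  have P: "P \<in> carrier_mat ?n ?n" by (simp add: P_def kron_def)
  have la: "list_all2 (\<lambda>M d. M \<in> carrier_mat d d) Ds (replicate r ?s)"
    using Ds(1) \<beta> by (simp add: list_all2_conv_all_nth scaling_of_carrier)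
  have D: "diag_block_mat Ds \<in> carrier_mat ?n ?n"
    using diag_block_mat_carrier[OF la] by (simp add: sum_list_replicate)
  have \<pi>_less: "\<pi> i < r" if "i < r" for i using permutes_in_image[OF \<pi>] that by auto
  have \<pi>_eq: "\<pi> i = \<pi> j \<longleftrightarrow> i = j" for i j using permutes_inj[OF \<pi>] by (auto dest: injD)
  \<comment> \<open>In block \<open>\<pi> i\<close>, row l of the permutation matrix has its single
    1 in column l of block i.\<close>
  have Pe: "(P *\<^sub>v y) $ (\<pi> i * ?s + l) = y $ (i * ?s + l)"
    if y: "y \<in> carrier_vec ?n" and i: "i < r" and l: "l < ?s" for y i l
  proof -
    have less: "j * ?s + m < ?n" if "j < r" "m < ?s" for j m
    proof -
      have "j * ?s + m < Suc j * ?s" using that by simp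
      also have "\<dots> \<le> ?n" using that by (intro mult_le_mono1) simp
      finally show ?thesis .
    qed
    have dm: "(j * ?s + m) div ?s = j" "(j * ?s + m) mod ?s = m" if "m < ?s" for j m
      using block_div_mod[OF that] by blast+
    have ent: "P $$ (\<pi> i * ?s + l, j * ?s + m) = (if j = i then if m = l then 1 else 0 else 0)" if "j < r" "m < ?s" for j m
      using less[OF \<pi>_less[OF i] l] less[OF that] l that \<pi>_less[OF i] by (simp add: P_def kron_def \<pi>_eq dm)
    have "(P *\<^sub>v y) $ (\<pi> i * ?s + l) = (\<Sum>q<?n. P $$ (\<pi> i * ?s + l, q) * y $ q)"
      using P y less[OF \<pi>_less[OF i] l] by (auto simp: scalar_prod_def lessThan_atLeast0)
    also have "\<dots> = (\<Sum>j<r. \<Sum>m<?s. if j = i then if m = l then y $ (j * ?s + m) else 0 else 0)"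
      unfolding sum_blocks by (intro sum.cong refl) (auto simp: ent)
    also have "\<dots> = (\<Sum>j<r. if j = i then y $ (j * ?s + l) else 0)"
      by (intro sum.cong refl) (use l in auto)
    also have "\<dots> = y $ (i * ?s + l)" using i by simp
    finally show ?thesis .
  qed
  have TP: "T = P * diag_block_mat Ds" by (simp add: T_eq P_def)
  show thesis
  proof
    show "\<pi> permutes {..<r}" by (rule \<pi>)
    show "T \<in> carrier_mat ?n ?n" using TP P D by simp
    show "(\<Prod>k<length ns. \<beta> i ! k) = 1" if "i < r" for i
      using \<beta>[OF that] by (metis prod.list_conv_set_nth lessThan_atLeast0)
    fix x :: "'a vec" and i k c assume x: "x \<in> carrier_vec ?n" and i: "i < r" and k: "k < length ns" and c: "c < ns ! k"
    let ?l = "sum_list (take k ns) + c"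
    have l: "?l < ?s" using k c by (rule sum_list_take_less)
    have "(T *\<^sub>v x) $ entry_pos ns (\<pi> i) k c = (P *\<^sub>v (diag_block_mat Ds *\<^sub>v x)) $ (\<pi> i * ?s + ?l)"
      using assoc_mult_mat_vec[OF P D x] by (simp add: TP entry_pos_def add.assoc)
    also have "\<dots> = (diag_block_mat Ds *\<^sub>v x) $ (i * ?s + ?l)"
      by (rule Pe) (use D x i l in auto)
    also have "\<dots> = (Ds ! i *\<^sub>v vec ?s (\<lambda>l. x $ (i * ?s + l))) $ ?l"
      using diag_block_mat_mult_entry[OF la, of x i ?l] x i l by (simp add: sum_list_replicate)
    also have "\<dots> = \<beta> i ! k * vec ?s (\<lambda>l. x $ (i * ?s + l)) $ ?l"
      unfolding \<beta>(3)[OF i] by (rule scaling_of_entry) (use \<beta>(1)[OF i] k c in auto)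
    also have "\<dots> = \<beta> i ! k * x $ entry_pos ns i k c" using l by (simp add: entry_pos_def add.assoc)
    finally show "(T *\<^sub>v x) $ entry_pos ns (\<pi> i) k c = \<beta> i ! k * x $ entry_pos ns i k c" .
  qed
qed

text \<open>The permutation reorders the sum over the terms, and within each term the scalars
  multiply to 1.\<close>

lemma cpd_map_symmetries:
  fixes x :: "'a::field vec"
  assumes T: "T \<in> symmetries ns r" and d: "length ns \<ge> 1" and x: "x \<in> carrier_vec (r * sum_list ns)"
  shows "cpd_map ns r (T *\<^sub>v x) = cpd_map ns r x" "T *\<^sub>v x \<in> carrier_vec (r * sum_list ns)"
proof -
  from symmetries_action[OF T d] obtain \<pi> \<alpha> where \<pi>: "\<pi> permutes {..<r}"
    and \<alpha>: "\<And>i. i < r \<Longrightarrow> (\<Prod>k<length ns. \<alpha> i k) = 1"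
    and Tc: "T \<in> carrier_mat (r * sum_list ns) (r * sum_list ns)"
    and act: "\<And>x i k c. x \<in> carrier_vec (r * sum_list ns) \<Longrightarrow> i < r \<Longrightarrow> k < length ns \<Longrightarrow> c < ns ! k \<Longrightarrow>
       (T *\<^sub>v x) $ entry_pos ns (\<pi> i) k c = \<alpha> i k * x $ entry_pos ns i k c" by blast
  show "T *\<^sub>v x \<in> carrier_vec (r * sum_list ns)" using Tc x by auto
  show "cpd_map ns r (T *\<^sub>v x) = cpd_map ns r x"
  proof (rule eq_vecI)
    fix j assume "j < dim_vec (cpd_map ns r x)"
    then have j: "j < prod_list ns" by simp
    have "cpd_map ns r (T *\<^sub>v x) $ j = (\<Sum>i<r. \<Prod>k<length ns. (T *\<^sub>v x) $ entry_pos ns (\<pi> i) k (digits ns j ! k))"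
      unfolding cpd_map_entry[OF j] by (rule sum.permute[OF \<pi>, unfolded o_def])
    also have "\<dots> = (\<Sum>i<r. \<Prod>k<length ns. \<alpha> i k * x $ entry_pos ns i k (digits ns j ! k))"
      by (intro sum.cong prod.cong refl) (use act x j in \<open>auto simp: digits_less\<close>)
    also have "\<dots> = cpd_map ns r x $ j"
      unfolding cpd_map_entry[OF j] by (intro sum.cong refl) (simp add: prod.distrib \<alpha>)
    finally show "cpd_map ns r (T *\<^sub>v x) $ j = cpd_map ns r x $ j" .
  qed simp
qed

text \<open>Makes the infimum in \<open>cpd_dist\<close> range over a nonempty set and gives
  reflexivity of \<open>cpd_equiv\<close>.\<close>

lemma one_in_symmetries:
  assumes d: "length ns \<ge> 1"
  shows "(1\<^sub>m (r * sum_list ns) :: 'a::field mat) \<in> symmetries ns r"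
proof -
  let ?s = "sum_list ns" and ?n = "r * sum_list ns"
  have sc: "(1\<^sub>m ?s :: 'a mat) \<in> scaling_mats ns"
  proof -
    have "map2 (\<lambda>\<alpha> n. \<alpha> \<cdot>\<^sub>m (1\<^sub>m n :: 'a mat)) (inverse (prod_list (replicate (length ns - 1) 1)) # replicate (length ns - 1) 1) ns
        = map (\<lambda>A. 1\<^sub>m (dim_row A)) (map (\<lambda>n. 1\<^sub>m n :: 'a mat) ns)"
      using d by (intro nth_equalityI) (auto simp: nth_Cons' intro!: eq_matI)
    from arg_cong[OF this, of diag_block_mat]
    have "1\<^sub>m ?s = diag_block_mat (map2 (\<lambda>\<alpha> n. \<alpha> \<cdot>\<^sub>m (1\<^sub>m n :: 'a mat)) (inverse (prod_list (replicate (length ns - 1) 1)) # replicate (length ns - 1) 1) ns)"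
      by (simp only: diag_block_one_mat) (simp add: o_def)
    then show ?thesis unfolding scaling_mats_def
      by (intro CollectI exI[of _ "replicate (length ns - 1) 1"]) auto
  qed
  have "diag_block_mat (replicate r (1\<^sub>m ?s :: 'a mat)) = 1\<^sub>m ?n"
    using diag_block_one_mat[of "replicate r (1\<^sub>m ?s :: 'a mat)"] by (simp add: sum_list_replicate)
  from this[symmetric] have B: "(1\<^sub>m ?n :: 'a mat) \<in> block_scaling_mats ns r" unfolding block_scaling_mats_def
    by (intro CollectI exI[of _ "replicate r (1\<^sub>m ?s)"]) (auto simp: sc)
  have "kron (mat r r (\<lambda>(i, j). if i = id j then 1 else 0)) (1\<^sub>m ?s) = (1\<^sub>m ?n :: 'a mat)"
  proof (rule eq_matI)
    fix i j assume "i < dim_row (1\<^sub>m ?n :: 'a mat)" "j < dim_col (1\<^sub>m ?n :: 'a mat)"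
    then have ij: "i < ?n" "j < ?n" by auto
    then have "?s > 0" by (auto intro: Nat.gr0I)
    then have "i div ?s < r" "j div ?s < r" "i mod ?s < ?s" "j mod ?s < ?s"
      using ij by (auto simp: less_mult_imp_div_less)
    moreover have "i = j \<longleftrightarrow> i div ?s = j div ?s \<and> i mod ?s = j mod ?s"
      by (metis div_mult_mod_eq)
    ultimately show "kron (mat r r (\<lambda>(i, j). if i = id j then 1 else 0)) (1\<^sub>m ?s) $$ (i, j) = (1\<^sub>m ?n :: 'a mat) $$ (i, j)"
      using ij by (auto simp: kron_def)
  qed (auto simp: kron_def)
  then have "(1\<^sub>m ?n :: 'a mat) \<in> block_perm_mats ns r" unfolding block_perm_mats_def
    by (intro CollectI exI[of _ id]) (auto simp: permutes_id)
  then show ?thesis using B unfolding symmetries_def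
    by (intro CollectI exI[of _ "1\<^sub>m ?n"] conjI) simp_all
qed

lemma sum_list_eq_Sigma_dim: "\<forall>n\<in>set ns. n \<ge> 1 \<Longrightarrow> sum_list ns = Sigma_dim ns + length ns"
  by (induction ns) (auto simp: Sigma_dim_def)

section \<open>Strict differentiability and invariance of domain\<close>

lemma vdist_nonneg [simp]: "0 \<le> vdist n x y"
  by (simp add: vdist_def)

lemma vdist_commute: "vdist n x y = vdist n y x"
  by (simp add: vdist_def norm_minus_commute)

lemma vdist_triangle:
  "x \<in> carrier_vec n \<Longrightarrow> y \<in> carrier_vec n \<Longrightarrow> z \<in> carrier_vec n \<Longrightarrow> vdist n x z \<le> vdist n x y + vdist n y z"
  by (rule Metric_space.triangle[OF Metric_space_vdist])

lemma vdist_eq_0: "x \<in> carrier_vec n \<Longrightarrow> y \<in> carrier_vec n \<Longrightarrow> vdist n x y = 0 \<longleftrightarrow> x = y"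
  by (rule Metric_space.zero[OF Metric_space_vdist])

lemma vdist_self [simp]: "vdist n x x = 0"
  by (simp add: vdist_def L2_set_def)

lemma norm_coord_diff_le: "i < n \<Longrightarrow> norm (x $ i - y $ i) \<le> vdist n x y"
  unfolding vdist_def by (rule member_le_L2_set) auto

lemma vdist_le_sum: "vdist n x y \<le> (\<Sum>i<n. norm (x $ i - y $ i))"
  unfolding vdist_def by (rule L2_set_le_sum) auto

lemma vdist_leI:
  assumes "\<And>i. i < n \<Longrightarrow> norm (x $ i - y $ i) \<le> e"
  shows "vdist n x y \<le> real n * e"
proof -
  have "vdist n x y \<le> (\<Sum>i<n. e)" by (rule order_trans[OF vdist_le_sum sum_mono]) (use assms in auto)
  then show ?thesis by simp
qed

text \<open>Strict differentiability: x and y both move near a, where ordinary differentiability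
  would fix y = a. It turns injectivity of the derivative into local injectivity and compares two
  points of one fibre. The first clause, boundedness of \<open>L\<close>, yields the Lipschitz
  estimates.\<close>

definition strictly_diff :: "nat \<Rightarrow> ('a::real_normed_field vec \<Rightarrow> 'a) \<Rightarrow> 'a vec \<Rightarrow> ('a vec \<Rightarrow> 'a) \<Rightarrow> bool" where
  "strictly_diff n h a L \<longleftrightarrow>
     (\<exists>C\<ge>0. \<forall>x\<in>carrier_vec n. \<forall>y\<in>carrier_vec n. norm (L (x - y)) \<le> C * vdist n x y) \<and>
     (\<forall>\<epsilon>>0. \<exists>\<delta>>0. \<forall>x\<in>carrier_vec n. \<forall>y\<in>carrier_vec n. vdist n a x < \<delta> \<longrightarrow> vdist n a y < \<delta> \<longrightarrow>
        norm (h x - h y - L (x - y)) \<le> \<epsilon> * vdist n x y)"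

lemma strictly_diffD:
  assumes "strictly_diff n h a L" "\<epsilon> > 0"
  obtains \<delta> where "\<delta> > 0" "\<And>x y. x \<in> carrier_vec n \<Longrightarrow> y \<in> carrier_vec n \<Longrightarrow> vdist n a x < \<delta> \<Longrightarrow> vdist n a y < \<delta> \<Longrightarrow>
        norm (h x - h y - L (x - y)) \<le> \<epsilon> * vdist n x y"
  using assms unfolding strictly_diff_def by metis

lemma strictly_diff_bound:
  assumes "strictly_diff n h a L"
  obtains C where "C \<ge> 0" "\<And>x y. x \<in> carrier_vec n \<Longrightarrow> y \<in> carrier_vec n \<Longrightarrow> norm (L (x - y)) \<le> C * vdist n x y"
  using assms unfolding strictly_diff_def by metis

lemma strictly_diff_lipschitz:
  assumes "strictly_diff n h a L"
  obtains C \<delta> where "C \<ge> 0" "\<delta> > 0" "\<And>x y. x \<in> carrier_vec n \<Longrightarrow> y \<in> carrier_vec n \<Longrightarrow> vdist n a x < \<delta> \<Longrightarrow> vdist n a y < \<delta> \<Longrightarrow>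
        norm (h x - h y) \<le> C * vdist n x y"
proof -
  obtain C where C: "C \<ge> 0" "\<And>x y. x \<in> carrier_vec n \<Longrightarrow> y \<in> carrier_vec n \<Longrightarrow> norm (L (x - y)) \<le> C * vdist n x y"
    using strictly_diff_bound[OF assms] by blast
  obtain \<delta> where \<delta>: "\<delta> > 0" "\<And>x y. x \<in> carrier_vec n \<Longrightarrow> y \<in> carrier_vec n \<Longrightarrow> vdist n a x < \<delta> \<Longrightarrow> vdist n a y < \<delta> \<Longrightarrow>
        norm (h x - h y - L (x - y)) \<le> 1 * vdist n x y" by (rule strictly_diffD[OF assms, of 1]) (simp, blast)
  show thesis
  proof (rule that[of "C + 1" \<delta>])
    fix x y assume xy: "x \<in> carrier_vec n" "y \<in> carrier_vec n" "vdist n a x < \<delta>" "vdist n a y < \<delta>"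
    have "norm (h x - h y) \<le> norm (h x - h y - L (x - y)) + norm (L (x - y))"
      by (metis norm_triangle_sub add.commute)
    also have "\<dots> \<le> (C + 1) * vdist n x y" using C(2)[OF xy(1,2)] \<delta>(2)[OF xy] by (simp add: algebra_simps)
    finally show "norm (h x - h y) \<le> (C + 1) * vdist n x y" .
  qed (use C \<delta> in auto)
qed

lemma strictly_diff_const: "strictly_diff n (\<lambda>x. c) a (\<lambda>v. 0)"
  unfolding strictly_diff_def by (auto intro: exI[of _ 0] exI[of _ 1])

lemma strictly_diff_coord: "i < n \<Longrightarrow> strictly_diff n (\<lambda>x. x $ i) a (\<lambda>v. v $ i)"
  unfolding strictly_diff_def by (auto intro!: exI[of _ 1] norm_coord_diff_le)

lemma strictly_diff_cong:
  assumes "strictly_diff n h a L" "\<And>x. x \<in> carrier_vec n \<Longrightarrow> h x = h' x" "\<And>v. v \<in> carrier_vec n \<Longrightarrow> L v = L' v"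
  shows "strictly_diff n h' a L'"
  using assms unfolding strictly_diff_def by (metis minus_carrier_vec)

lemma strictly_diff_add:
  assumes h: "strictly_diff n h a L" and k: "strictly_diff n k a M"
  shows "strictly_diff n (\<lambda>x. h x + k x) a (\<lambda>v. L v + M v)"
  unfolding strictly_diff_def
proof (intro conjI allI impI)
  obtain C where C: "C \<ge> 0" "\<And>x y. x \<in> carrier_vec n \<Longrightarrow> y \<in> carrier_vec n \<Longrightarrow> norm (L (x - y)) \<le> C * vdist n x y"
    using strictly_diff_bound[OF h] by blast
  obtain D where D: "D \<ge> 0" "\<And>x y. x \<in> carrier_vec n \<Longrightarrow> y \<in> carrier_vec n \<Longrightarrow> norm (M (x - y)) \<le> D * vdist n x y"
    using strictly_diff_bound[OF k] by blast
  show "\<exists>C\<ge>0. \<forall>x\<in>carrier_vec n. \<forall>y\<in>carrier_vec n. norm (L (x - y) + M (x - y)) \<le> C * vdist n x y"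
    using C D by (intro exI[of _ "C + D"]) (auto simp: distrib_right intro!: norm_triangle_le add_mono)
  fix \<epsilon> :: real assume \<epsilon>: "\<epsilon> > 0"
  obtain \<delta> where \<delta>: "\<delta> > 0" "\<And>x y. x \<in> carrier_vec n \<Longrightarrow> y \<in> carrier_vec n \<Longrightarrow> vdist n a x < \<delta> \<Longrightarrow> vdist n a y < \<delta> \<Longrightarrow>
        norm (h x - h y - L (x - y)) \<le> \<epsilon> / 2 * vdist n x y" using strictly_diffD[OF h half_gt_zero[OF \<epsilon>]] by blast
  obtain \<delta>' where \<delta>': "\<delta>' > 0" "\<And>x y. x \<in> carrier_vec n \<Longrightarrow> y \<in> carrier_vec n \<Longrightarrow> vdist n a x < \<delta>' \<Longrightarrow> vdist n a y < \<delta>' \<Longrightarrow>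
        norm (k x - k y - M (x - y)) \<le> \<epsilon> / 2 * vdist n x y" using strictly_diffD[OF k half_gt_zero[OF \<epsilon>]] by blast
  show "\<exists>\<delta>>0. \<forall>x\<in>carrier_vec n. \<forall>y\<in>carrier_vec n. vdist n a x < \<delta> \<longrightarrow> vdist n a y < \<delta> \<longrightarrow>
        norm (h x + k x - (h y + k y) - (L (x - y) + M (x - y))) \<le> \<epsilon> * vdist n x y"
  proof (intro exI[of _ "min \<delta> \<delta>'"] conjI ballI impI)
    fix x y :: "'a vec" assume xy: "x \<in> carrier_vec n" "y \<in> carrier_vec n" "vdist n a x < min \<delta> \<delta>'" "vdist n a y < min \<delta> \<delta>'"
    have "h x + k x - (h y + k y) - (L (x - y) + M (x - y)) = (h x - h y - L (x - y)) + (k x - k y - M (x - y))"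
      by simp
    also have "norm \<dots> \<le> \<epsilon> / 2 * vdist n x y + \<epsilon> / 2 * vdist n x y"
      using \<delta>(2)[of x y] \<delta>'(2)[of x y] xy by (intro norm_triangle_le add_mono) auto
    finally show "norm (h x + k x - (h y + k y) - (L (x - y) + M (x - y))) \<le> \<epsilon> * vdist n x y" by simp
  qed (use \<delta> \<delta>' in auto)
qed

lemma strictly_diff_mult:
  assumes a: "a \<in> carrier_vec n" and h: "strictly_diff n h a L" and k: "strictly_diff n k a M"
  shows "strictly_diff n (\<lambda>x. h x * k x) a (\<lambda>v. h a * M v + L v * k a)"
  unfolding strictly_diff_def
proof (intro conjI allI impI)
  obtain C where C: "C \<ge> 0" "\<And>x y. x \<in> carrier_vec n \<Longrightarrow> y \<in> carrier_vec n \<Longrightarrow> norm (L (x - y)) \<le> C * vdist n x y"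
    using strictly_diff_bound[OF h] by blast
  obtain D where D: "D \<ge> 0" "\<And>x y. x \<in> carrier_vec n \<Longrightarrow> y \<in> carrier_vec n \<Longrightarrow> norm (M (x - y)) \<le> D * vdist n x y"
    using strictly_diff_bound[OF k] by blast
  show "\<exists>C\<ge>0. \<forall>x\<in>carrier_vec n. \<forall>y\<in>carrier_vec n. norm (h a * M (x - y) + L (x - y) * k a) \<le> C * vdist n x y"
  proof (intro exI[of _ "norm (h a) * D + C * norm (k a)"] conjI ballI)
    fix x y :: "'a vec" assume xy: "x \<in> carrier_vec n" "y \<in> carrier_vec n"
    have "norm (h a * M (x - y) + L (x - y) * k a) \<le> norm (h a) * (D * vdist n x y) + (C * vdist n x y) * norm (k a)"
      by (intro norm_triangle_le add_mono) (auto simp: norm_mult intro!: mult_left_mono mult_right_mono C D xy)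
    then show "norm (h a * M (x - y) + L (x - y) * k a) \<le> (norm (h a) * D + C * norm (k a)) * vdist n x y"
      by (simp add: algebra_simps)
  qed (use C D in auto)
  fix \<epsilon> :: real assume \<epsilon>: "\<epsilon> > 0"
  \<comment> \<open>\<open>K\<close> collects the four coefficients of \<open>e\<close> in the final
    estimate. Besides \<open>e * K \<le> \<epsilon>\<close>, the bound \<open>e \<le> 1\<close>
    keeps the norms of \<open>h x\<close> and \<open>k y\<close> at most 1 above those at a.\<close>
  define K where "K = norm (h a) + 1 + D + norm (k a) + 1 + C"
  have K: "K \<ge> 2" using C D by (simp add: K_def)
  define e where "e = min 1 (\<epsilon> / K)"
  have e: "e > 0" "e \<le> 1" "e * K \<le> \<epsilon>" using \<epsilon> K by (auto simp: e_def min_def field_simps)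
  obtain \<delta>1 where \<delta>1: "\<delta>1 > 0" "\<And>x y. x \<in> carrier_vec n \<Longrightarrow> y \<in> carrier_vec n \<Longrightarrow> vdist n a x < \<delta>1 \<Longrightarrow> vdist n a y < \<delta>1 \<Longrightarrow>
        norm (h x - h y - L (x - y)) \<le> e * vdist n x y" using strictly_diffD[OF h e(1)] by blast
  obtain \<delta>2 where \<delta>2: "\<delta>2 > 0" "\<And>x y. x \<in> carrier_vec n \<Longrightarrow> y \<in> carrier_vec n \<Longrightarrow> vdist n a x < \<delta>2 \<Longrightarrow> vdist n a y < \<delta>2 \<Longrightarrow>
        norm (k x - k y - M (x - y)) \<le> e * vdist n x y" using strictly_diffD[OF k e(1)] by blast
  have lip: "\<exists>\<delta>>0. \<forall>x\<in>carrier_vec n. vdist n a x < \<delta> \<longrightarrow> norm (f x - f a) \<le> e" if f: "strictly_diff n f a F" for f F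
  proof -
    obtain B \<delta> where B: "B \<ge> 0" "\<delta> > 0" "\<And>x y. x \<in> carrier_vec n \<Longrightarrow> y \<in> carrier_vec n \<Longrightarrow> vdist n a x < \<delta> \<Longrightarrow> vdist n a y < \<delta> \<Longrightarrow>
        norm (f x - f y) \<le> B * vdist n x y" using strictly_diff_lipschitz[OF f] by blast
    show ?thesis
    proof (intro exI[of _ "min \<delta> (e / (B + 1))"] conjI ballI impI)
      fix x :: "'a vec" assume x: "x \<in> carrier_vec n" "vdist n a x < min \<delta> (e / (B + 1))"
      have "norm (f x - f a) \<le> B * vdist n x a" by (rule B(3)) (use x a B in auto)
      also have "\<dots> \<le> B * (e / (B + 1))" using x B by (intro mult_left_mono) (auto simp: vdist_commute)
      also have "\<dots> \<le> e" using B e by (simp add: field_simps)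
      finally show "norm (f x - f a) \<le> e" .
    qed (use B e in auto)
  qed
  obtain \<delta>3 where \<delta>3: "\<delta>3 > 0" "\<And>x. x\<in>carrier_vec n \<Longrightarrow> vdist n a x < \<delta>3 \<Longrightarrow> norm (h x - h a) \<le> e" using lip[OF h] by blast
  obtain \<delta>4 where \<delta>4: "\<delta>4 > 0" "\<And>x. x\<in>carrier_vec n \<Longrightarrow> vdist n a x < \<delta>4 \<Longrightarrow> norm (k x - k a) \<le> e" using lip[OF k] by blast
  show "\<exists>\<delta>>0. \<forall>x\<in>carrier_vec n. \<forall>y\<in>carrier_vec n. vdist n a x < \<delta> \<longrightarrow> vdist n a y < \<delta> \<longrightarrow>
        norm (h x * k x - h y * k y - (h a * M (x - y) + L (x - y) * k a)) \<le> \<epsilon> * vdist n x y"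
  proof (intro exI[of _ "min (min \<delta>1 \<delta>2) (min \<delta>3 \<delta>4)"] conjI ballI impI)
    fix x y :: "'a vec" assume xy: "x \<in> carrier_vec n" "y \<in> carrier_vec n"
      "vdist n a x < min (min \<delta>1 \<delta>2) (min \<delta>3 \<delta>4)" "vdist n a y < min (min \<delta>1 \<delta>2) (min \<delta>3 \<delta>4)"
    let ?v = "vdist n x y"
    have nh: "norm (h x) \<le> norm (h a) + 1" and nk: "norm (k y) \<le> norm (k a) + 1"
      using \<delta>3(2)[of x] \<delta>4(2)[of y] xy e norm_triangle_sub[of "h x" "h a"] norm_triangle_sub[of "k y" "k a"] by auto
    \<comment> \<open>Every summand has a small factor: either one of the strict remainders, or the
      increment of h or k from a, multiplied by a derivative.\<close>
    have "h x * k x - h y * k y - (h a * M (x - y) + L (x - y) * k a)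
      = h x * (k x - k y - M (x - y)) + (h x - h a) * M (x - y) + k y * (h x - h y - L (x - y)) + (k y - k a) * L (x - y)"
      by (simp add: algebra_simps)
    also have "norm \<dots> \<le> (norm (h a) + 1) * (e * ?v) + e * (D * ?v) + (norm (k a) + 1) * (e * ?v) + e * (C * ?v)"
      using xy e C(1) D(1)
      by (intro norm_triangle_le add_mono) (auto simp: norm_mult intro!: mult_mono nh nk \<delta>1(2) \<delta>2(2) \<delta>3(2) \<delta>4(2) C(2) D(2))
    also have "\<dots> = e * K * ?v" by (simp add: K_def algebra_simps)
    also have "\<dots> \<le> \<epsilon> * ?v" using e by (intro mult_right_mono) auto
    finally show "norm (h x * k x - h y * k y - (h a * M (x - y) + L (x - y) * k a)) \<le> \<epsilon> * vdist n x y" .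
  qed (use \<delta>1 \<delta>2 \<delta>3 \<delta>4 in auto)
qed

lemma strictly_diff_sum:
  assumes "finite I" "\<And>i. i \<in> I \<Longrightarrow> strictly_diff n (h i) a (L i)"
  shows "strictly_diff n (\<lambda>x. \<Sum>i\<in>I. h i x) a (\<lambda>v. \<Sum>i\<in>I. L i v)"
  using assms by (induction I rule: finite_induct) (auto intro: strictly_diff_const strictly_diff_add)

lemma strictly_diff_prod:
  assumes "finite K" "a \<in> carrier_vec n" "\<And>i. i \<in> K \<Longrightarrow> strictly_diff n (h i) a (L i)"
  shows "strictly_diff n (\<lambda>x. \<Prod>i\<in>K. h i x) a (\<lambda>v. \<Sum>i\<in>K. (\<Prod>l\<in>K - {i}. h l a) * L i v)"
  using assms
proof (induction K rule: finite_induct)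
  case empty
  then show ?case by (simp add: strictly_diff_const)
next
  case (insert k K)
  have "strictly_diff n (\<lambda>x. h k x * (\<Prod>i\<in>K. h i x)) a
     (\<lambda>v. h k a * (\<Sum>i\<in>K. (\<Prod>l\<in>K - {i}. h l a) * L i v) + L k v * (\<Prod>i\<in>K. h i a))"
    using insert by (intro strictly_diff_mult) auto
  moreover have "h k a * (\<Sum>i\<in>K. (\<Prod>l\<in>K - {i}. h l a) * L i v) + L k v * (\<Prod>i\<in>K. h i a)
      = (\<Sum>i\<in>insert k K. (\<Prod>l\<in>insert k K - {i}. h l a) * L i v)" for v
  proof -
    have "(\<Prod>l\<in>insert k K - {i}. h l a) = h k a * (\<Prod>l\<in>K - {i}. h l a)" if "i \<in> K" for i
    proof -
      have "insert k K - {i} = insert k (K - {i})" using insert.hyps that by auto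
      then show ?thesis using insert.hyps by simp
    qed
    then have "h k a * (\<Sum>i\<in>K. (\<Prod>l\<in>K - {i}. h l a) * L i v) = (\<Sum>i\<in>K. (\<Prod>l\<in>insert k K - {i}. h l a) * L i v)"
      by (simp add: sum_distrib_left mult.assoc)
    then show ?thesis using insert.hyps by (simp add: mult.commute add.commute)
  qed
  ultimately show ?case using insert.hyps by simp
qed

section \<open>Derivatives of polynomials and of f\<close>

lemma poly_fun_strictly_diff:
  assumes "h \<in> poly_fun n" "a \<in> carrier_vec n"
  shows "\<exists>g. strictly_diff n h a (\<lambda>v. \<Sum>i<n. g i * v $ i :: 'a::real_normed_field)"
  using assms
proof (induction rule: poly_fun.induct)
  case (const c)
  then show ?case by (intro exI[of _ "\<lambda>_. 0"]) (simp add: strictly_diff_const)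
next
  case (coord i)
  have "(\<Sum>j<n. (if j = i then 1 else 0) * v $ j) = v $ i" for v :: "'a vec"
  proof -
    have "(\<Sum>j<n. (if j = i then 1 else 0) * v $ j) = (\<Sum>j<n. if j = i then v $ j else 0)"
      by (rule sum.cong) auto
    then show ?thesis using coord by simp
  qed
  then show ?case using strictly_diff_coord[OF coord(1), of a] by (intro exI[of _ "\<lambda>j. if j = i then 1 else 0"]) simp
next
  case (add f h)
  then obtain g1 g2 where "strictly_diff n f a (\<lambda>v. \<Sum>i<n. g1 i * v $ i)" "strictly_diff n h a (\<lambda>v. \<Sum>i<n. g2 i * v $ i)" by auto
  from strictly_diff_add[OF this] show ?case
    by (intro exI[of _ "\<lambda>i. g1 i + g2 i"]) (simp add: distrib_right sum.distrib)
next
  case (mult f h)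
  then obtain g1 g2 where "strictly_diff n f a (\<lambda>v. \<Sum>i<n. g1 i * v $ i)" "strictly_diff n h a (\<lambda>v. \<Sum>i<n. g2 i * v $ i)" by auto
  note d = strictly_diff_mult[OF mult.prems this]
  have "(\<lambda>v. f a * (\<Sum>i<n. g2 i * v $ i) + (\<Sum>i<n. g1 i * v $ i) * h a)
      = (\<lambda>v. \<Sum>i<n. (f a * g2 i + g1 i * h a) * v $ i)"
    by (simp add: fun_eq_iff sum.distrib sum_distrib_left sum_distrib_right algebra_simps)
  with d show ?case by (intro exI[of _ "\<lambda>i. f a * g2 i + g1 i * h a"]) (simp only:)
qed

lemma cpd_map_strictly_diff:
  fixes p :: "'a::real_normed_field vec"
  assumes p: "p \<in> carrier_vec (r * sum_list ns)" and j: "j < prod_list ns"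
  shows "strictly_diff (r * sum_list ns) (\<lambda>x. cpd_map ns r x $ j) p (\<lambda>v. (terracini ns r p *\<^sub>v v) $ j)"
proof (rule strictly_diff_cong)
  show "strictly_diff (r * sum_list ns) (\<lambda>x. \<Sum>i<r. \<Prod>k<length ns. x $ entry_pos ns i k (digits ns j ! k)) p
     (\<lambda>v. \<Sum>i<r. \<Sum>k<length ns. (\<Prod>l\<in>{..<length ns} - {k}. p $ entry_pos ns i l (digits ns j ! l)) * v $ entry_pos ns i k (digits ns j ! k))"
    by (intro strictly_diff_sum strictly_diff_prod strictly_diff_coord p) (auto intro!: entry_pos_less digits_less j)
qed (use j in \<open>simp_all add: cpd_map_entry terracini_mult_entry\<close>)

lemma cpd_map_strictly_differentiable:
  fixes p :: "'a::real_normed_field vec"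
  assumes p: "p \<in> carrier_vec (r * sum_list ns)" and pr: "prod_list ns > 0" and \<epsilon>: "\<epsilon> > 0"
  obtains \<delta> where "\<delta> > 0" "\<And>x y. x \<in> carrier_vec (r * sum_list ns) \<Longrightarrow> y \<in> carrier_vec (r * sum_list ns) \<Longrightarrow>
    vdist (r * sum_list ns) p x < \<delta> \<Longrightarrow> vdist (r * sum_list ns) p y < \<delta> \<Longrightarrow>
    vdist (prod_list ns) (cpd_map ns r x - cpd_map ns r y) (terracini ns r p *\<^sub>v (x - y)) \<le> \<epsilon> * vdist (r * sum_list ns) x y"
proof -
  let ?n = "r * sum_list ns" and ?m = "prod_list ns"
  \<comment> \<open>\<open>vdist_leI\<close> loses a factor \<open>?m\<close>, the number of
    coordinates.\<close>
  define e where "e = \<epsilon> / real ?m"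
  have e: "e > 0" using \<epsilon> pr by (simp add: e_def)
  have "\<exists>\<delta>>0. \<forall>x\<in>carrier_vec ?n. \<forall>y\<in>carrier_vec ?n. vdist ?n p x < \<delta> \<longrightarrow> vdist ?n p y < \<delta> \<longrightarrow>
     norm (cpd_map ns r x $ j - cpd_map ns r y $ j - (terracini ns r p *\<^sub>v (x - y)) $ j) \<le> e * vdist ?n x y" if "j < ?m" for j
    using strictly_diffD[OF cpd_map_strictly_diff[OF p that] e] by metis
  then obtain D where D: "\<And>j. j < ?m \<Longrightarrow> D j > 0" "\<And>j x y. j < ?m \<Longrightarrow> x\<in>carrier_vec ?n \<Longrightarrow> y\<in>carrier_vec ?n \<Longrightarrow> vdist ?n p x < D j \<Longrightarrow> vdist ?n p y < D j \<Longrightarrow>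
     norm (cpd_map ns r x $ j - cpd_map ns r y $ j - (terracini ns r p *\<^sub>v (x - y)) $ j) \<le> e * vdist ?n x y" by metis
  define \<delta> where "\<delta> = Min (D ` {..<?m})"
  have \<delta>: "\<delta> > 0" "\<And>j. j < ?m \<Longrightarrow> \<delta> \<le> D j"
  proof -
    have "D ` {..<?m} \<noteq> {}" using pr by blast
    then show "\<delta> > 0" using D(1) unfolding \<delta>_def by (subst Min_gr_iff) auto
  qed (auto simp: \<delta>_def)
  show thesis
  proof (rule that[OF \<delta>(1)])
    fix x y :: "'a vec" assume xy: "x \<in> carrier_vec ?n" "y \<in> carrier_vec ?n" "vdist ?n p x < \<delta>" "vdist ?n p y < \<delta>"
    have "vdist ?m (cpd_map ns r x - cpd_map ns r y) (terracini ns r p *\<^sub>v (x - y)) \<le> real ?m * (e * vdist ?n x y)"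
      by (rule vdist_leI) (use xy \<delta> in \<open>auto intro!: D(2) less_le_trans[OF _ \<delta>(2)] simp del: index_mult_mat_vec\<close>)
    then show "vdist ?m (cpd_map ns r x - cpd_map ns r y) (terracini ns r p *\<^sub>v (x - y)) \<le> \<epsilon> * vdist ?n x y"
      using pr by (metis e_def mult.assoc nonzero_mult_div_cancel_left of_nat_0_less_iff order_less_irrefl times_divide_eq_right)
  qed
qed

text \<open>F^N is identified with R^(N D), D being the real dimension of F, through the real
  coordinates \<open>\<Phi>\<close> and their inverse \<open>\<Psi>\<close>; the classical theorem
  makes the image of the transported ball open. The conclusion is put as a ball around the image of
  0, the form in which coverings are used later.\<close>

lemma invariance_of_domain_vec:
  fixes h :: "'a::{euclidean_space,real_normed_field} vec \<Rightarrow> 'a vec"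
  defines "B \<equiv> \<lambda>N \<rho>. {c \<in> carrier_vec N. vdist N (0\<^sub>v N) c < \<rho>}"
  assumes \<rho>: "\<rho> > 0" and hc: "\<And>c. c \<in> B N \<rho> \<Longrightarrow> h c \<in> carrier_vec N"
    and cont: "\<And>c e. c \<in> B N \<rho> \<Longrightarrow> e > 0 \<Longrightarrow> \<exists>d>0. \<forall>c'\<in>B N \<rho>. vdist N c c' < d \<longrightarrow> vdist N (h c) (h c') < e"
    and inj: "inj_on h (B N \<rho>)"
  shows "\<exists>\<eta>>0. \<forall>y\<in>carrier_vec N. vdist N (h (0\<^sub>v N)) y < \<eta> \<longrightarrow> (\<exists>c\<in>B N \<rho>. h c = y)"
proof -
  define D where "D = DIM('a)"
  have D: "D > 0" by (simp add: D_def)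
  obtain bs :: "'a list" where bs: "set bs = Basis" "distinct bs"
    using finite_distinct_list[OF finite_Basis] by blast
  have lbs: "length bs = D" using distinct_card[OF bs(2)] bs(1) by (simp add: D_def)
  have bsB: "bs ! m \<in> Basis" if "m < D" for m using that bs lbs nth_mem by fastforce
  have bsi: "bs ! m \<bullet> bs ! m' = (if m = m' then 1 else 0)" if "m < D" "m' < D" for m m'
    using inner_Basis[OF bsB[OF that(1)] bsB[OF that(2)]] bs(2) lbs that by (simp add: nth_eq_iff_index_eq)
  have exp: "(\<Sum>m<D. (z \<bullet> bs ! m) *\<^sub>R bs ! m) = z" for z :: 'a
  proof -
    have "(\<Sum>m<D. (z \<bullet> bs ! m) *\<^sub>R bs ! m) = (\<Sum>b\<in>Basis. (z \<bullet> b) *\<^sub>R b)"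
      by (rule sum.reindex_bij_betw) (use bij_betw_nth[OF bs(2), of "{..<D}" Basis] lbs bs in auto)
    then show ?thesis by (simp add: euclidean_representation)
  qed
  let ?M = "N * D"
  let ?E = "Euclidean_space ?M"
  define \<Phi> where "\<Phi> = (\<lambda>v :: 'a vec. \<lambda>q. if q < ?M then v $ (q div D) \<bullet> bs ! (q mod D) else 0)"
  define \<Psi> where "\<Psi> = (\<lambda>f :: nat \<Rightarrow> real. vec N (\<lambda>i. \<Sum>m<D. f (i * D + m) *\<^sub>R bs ! m))"
  have \<Psi>c: "\<Psi> f \<in> carrier_vec N" for f by (simp add: \<Psi>_def)
  have \<Phi>E: "\<Phi> v \<in> topspace ?E" for v by (auto simp: \<Phi>_def topspace_Euclidean_space)
  have less: "i * D + m < ?M" if "i < N" "m < D" for i m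
  proof -
    have "i * D + m < Suc i * D" using that by simp
    also have "\<dots> \<le> ?M" using that by (intro mult_le_mono1) simp
    finally show ?thesis .
  qed
  have \<Psi>\<Phi>: "\<Psi> (\<Phi> v) = v" if "v \<in> carrier_vec N" for v
  proof (rule eq_vecI)
    fix i assume "i < dim_vec v"
    then have i: "i < N" using that by simp
    have "\<Psi> (\<Phi> v) $ i = (\<Sum>m<D. (v $ i \<bullet> bs ! m) *\<^sub>R bs ! m)"
      using i less[OF i] by (simp add: \<Psi>_def \<Phi>_def block_div_mod)
    then show "\<Psi> (\<Phi> v) $ i = v $ i" by (simp only: exp)
  qed (use that in \<open>simp add: \<Psi>_def\<close>)
  have \<Phi>\<Psi>: "\<Phi> (\<Psi> f) = f" if "f \<in> topspace ?E" for f
  proof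
    fix q
    show "\<Phi> (\<Psi> f) q = f q"
    proof (cases "q < ?M")
      case True
      then have q: "q div D < N" "q mod D < D" using D by (auto simp: less_mult_imp_div_less)
      have "\<Phi> (\<Psi> f) q = (\<Sum>m<D. f (q div D * D + m) * (bs ! m \<bullet> bs ! (q mod D)))"
        using True q by (simp add: \<Phi>_def \<Psi>_def inner_sum_left)
      also have "\<dots> = (\<Sum>m<D. if m = q mod D then f (q div D * D + m) else 0)"
        by (rule sum.cong) (use q in \<open>auto simp: bsi\<close>)
      also have "\<dots> = f q" using q by simp
      finally show ?thesis .
    qed (use that in \<open>auto simp: \<Phi>_def topspace_Euclidean_space\<close>)
  qed
  have contd: "continuous_on S (\<lambda>f. vdist N v (\<Psi> f))" for v S
  proof -
    have e: "vdist N v (\<Psi> f) = sqrt (\<Sum>i<N. (norm (v $ i - (\<Sum>m<D. f (i * D + m) *\<^sub>R bs ! m)))\<^sup>2)" for f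
      by (simp add: vdist_def L2_set_def \<Psi>_def)
    show ?thesis unfolding e
      by (intro continuous_intros continuous_on_subset[OF continuous_on_product_coordinates]) auto
  qed
  define U where "U = {f \<in> topspace ?E. vdist N (0\<^sub>v N) (\<Psi> f) \<in> {..<\<rho>}}"
  have U: "openin ?E U"
    unfolding U_def
    by (rule openin_continuous_map_preimage[where Y = euclideanreal]) (auto simp: continuous_map_Euclidean_space_iff contd)
  have UB: "\<Psi> f \<in> B N \<rho>" if "f \<in> U" for f using that by (simp add: U_def B_def \<Psi>c)
  define F where "F = (\<lambda>f. \<Phi> (h (\<Psi> f)))"
  have topU: "topspace (subtopology ?E U) = U" using openin_subset[OF U] by auto
  have "continuous_on U F"
    unfolding F_def \<Phi>_def
  proof (rule continuous_on_coordinatewise_then_product)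
    fix q
    show "continuous_on U (\<lambda>f. if q < ?M then h (\<Psi> f) $ (q div D) \<bullet> bs ! (q mod D) else 0)"
    proof (cases "q < ?M")
      case True
      then have q: "q div D < N" using D by (auto simp: less_mult_imp_div_less)
      have "continuous_on U (\<lambda>f. h (\<Psi> f) $ (q div D))"
        unfolding continuous_on_def tendsto_iff
      proof (intro ballI allI impI)
        fix f0 and e :: real assume f0: "f0 \<in> U" and e: "e > 0"
        obtain d where d: "d > 0" "\<forall>c'\<in>B N \<rho>. vdist N (\<Psi> f0) c' < d \<longrightarrow> vdist N (h (\<Psi> f0)) (h c') < e"
          using cont[OF UB[OF f0] e] by blast
        have "((\<lambda>f. vdist N (\<Psi> f0) (\<Psi> f)) \<longlongrightarrow> vdist N (\<Psi> f0) (\<Psi> f0)) (at f0 within U)"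
          using contd[of U "\<Psi> f0"] f0 unfolding continuous_on_def by blast
        then have "\<forall>\<^sub>F f in at f0 within U. vdist N (\<Psi> f0) (\<Psi> f) < d"
          using d(1) by (intro order_tendstoD(2)) auto
        moreover have "\<forall>\<^sub>F f in at f0 within U. f \<in> U" by (simp add: eventually_at_filter)
        ultimately show "\<forall>\<^sub>F f in at f0 within U. dist (h (\<Psi> f) $ (q div D)) (h (\<Psi> f0) $ (q div D)) < e"
        proof eventually_elim
          case (elim f)
          then have "vdist N (h (\<Psi> f0)) (h (\<Psi> f)) < e" using d(2) UB by blast
          moreover have "norm (h (\<Psi> f0) $ (q div D) - h (\<Psi> f) $ (q div D)) \<le> vdist N (h (\<Psi> f0)) (h (\<Psi> f))"
            by (rule norm_coord_diff_le[OF q])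
          ultimately show ?case by (simp add: dist_norm norm_minus_commute)
        qed
      qed
      then show ?thesis using True by (auto intro!: continuous_intros)
    qed simp
  qed
  then have "continuous_map (subtopology ?E U) ?E F"
    unfolding cm_Euclidean_space_iff_continuous_on topU using \<Phi>E by (auto simp: F_def)
  moreover have "inj_on F U"
  proof (rule inj_onI)
    fix f g assume fg: "f \<in> U" "g \<in> U" "F f = F g"
    then have "\<Psi> (\<Phi> (h (\<Psi> f))) = \<Psi> (\<Phi> (h (\<Psi> g)))" by (simp add: F_def)
    then have "h (\<Psi> f) = h (\<Psi> g)" using hc[OF UB] fg by (simp add: \<Psi>\<Phi>)
    then have "\<Psi> f = \<Psi> g" using inj UB fg by (auto dest: inj_onD)
    then have "\<Phi> (\<Psi> f) = \<Phi> (\<Psi> g)" by simp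
    then show "f = g" using fg by (simp add: \<Phi>\<Psi> U_def)
  qed
  ultimately have "openin ?E (F ` U)" by (rule invariance_of_domain_Euclidean_space[OF U])
  then obtain W where W: "openin (powertop_real UNIV) W" "F ` U = W \<inter> {x. \<forall>i\<ge>?M. x i = 0}"
    by (auto simp: Euclidean_space_def openin_subtopology)
  have zB: "0\<^sub>v N \<in> B N \<rho>" using \<rho> by (simp add: B_def)
  then have h0: "h (0\<^sub>v N) \<in> carrier_vec N" by (rule hc)
  have "\<Phi> (0\<^sub>v N) \<in> U" using \<Phi>E \<rho> by (simp add: U_def \<Psi>\<Phi>)
  then have "F (\<Phi> (0\<^sub>v N)) \<in> W" using W by blast
  then have W0: "\<Phi> (h (0\<^sub>v N)) \<in> W" by (simp add: F_def \<Psi>\<Phi>)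
  show ?thesis
  \<comment> \<open>Otherwise points \<open>Y j\<close> outside the image converge to
    \<open>h (0\<^sub>v N)\<close>. Their real coordinates converge, so they eventually enter the
    open set \<open>W\<close>, which within the Euclidean space is the image.\<close>
  proof (rule ccontr)
    assume neg: "\<not> ?thesis"
    have "\<exists>y\<in>carrier_vec N. vdist N (h (0\<^sub>v N)) y < 1 / real (Suc j) \<and> \<not> (\<exists>c\<in>B N \<rho>. h c = y)" for j
      using neg[simplified, rule_format, of "1 / real (Suc j)"] by auto
    then obtain Y where Y: "\<And>j. Y j \<in> carrier_vec N" "\<And>j. vdist N (h (0\<^sub>v N)) (Y j) < 1 / real (Suc j)"
      "\<And>j. \<not> (\<exists>c\<in>B N \<rho>. h c = Y j)" by metis
    have "(\<lambda>j. Y j $ i) \<longlonglongrightarrow> h (0\<^sub>v N) $ i" if "i < N" for i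
    proof (rule metric_LIMSEQ_I)
      fix e :: real assume "e > 0"
      then obtain k where k: "1 / real (Suc k) < e" using nat_approx_posE by blast
      have "dist (Y j $ i) (h (0\<^sub>v N) $ i) < e" if "j \<ge> k" for j
      proof -
        have "dist (Y j $ i) (h (0\<^sub>v N) $ i) \<le> vdist N (h (0\<^sub>v N)) (Y j)"
          using norm_coord_diff_le[OF \<open>i < N\<close>, of "h (0\<^sub>v N)" "Y j"] by (simp add: dist_norm norm_minus_commute)
        also have "\<dots> < 1 / real (Suc j)" by (rule Y)
        also have "\<dots> \<le> 1 / real (Suc k)" using that by (simp add: field_simps)
        finally show ?thesis using k by simp
      qed
      then show "\<exists>no. \<forall>n\<ge>no. dist (Y n $ i) (h (0\<^sub>v N) $ i) < e" by blast
    qed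
    then have "(\<lambda>j. \<Phi> (Y j) q) \<longlonglongrightarrow> \<Phi> (h (0\<^sub>v N)) q" for q
      using D by (cases "q < ?M") (auto simp: \<Phi>_def less_mult_imp_div_less intro!: tendsto_intros)
    then have "limitin (powertop_real UNIV) (\<lambda>j. \<Phi> (Y j)) (\<Phi> (h (0\<^sub>v N))) sequentially"
      by (simp add: limitin_componentwise)
    then have "\<forall>\<^sub>F j in sequentially. \<Phi> (Y j) \<in> W" using W(1) W0 unfolding limitin_def by blast
    then obtain j where "\<Phi> (Y j) \<in> W" by (auto simp: eventually_sequentially)
    then have "\<Phi> (Y j) \<in> F ` U" using \<Phi>E[of "Y j"] W(2) by (auto simp: topspace_Euclidean_space)
    then obtain f where f: "f \<in> U" "\<Phi> (Y j) = \<Phi> (h (\<Psi> f))" by (auto simp: F_def)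
    then have "Y j = h (\<Psi> f)" by (metis \<Psi>\<Phi> Y(1) hc UB)
    then show False using Y(3) UB f(1) by metis
  qed
qed

section \<open>Algebraic dependence and Krull dimension\<close>

text \<open>\<open>poly_eval gs s c\<close> is the polynomial of degree at most \<open>s\<close> in each variable with coefficients \<open>c\<close>,
  indexed by exponent lists, applied to the functions \<open>gs\<close>.\<close>

primrec poly_eval :: "('b \<Rightarrow> 'a::comm_ring_1) list \<Rightarrow> nat \<Rightarrow> (nat list \<Rightarrow> 'a) \<Rightarrow> 'b \<Rightarrow> 'a" where
  "poly_eval [] s c x = c []"
| "poly_eval (g # gs) s c x = (\<Sum>a\<le>s. g x ^ a * poly_eval gs s (\<lambda>e. c (a # e)) x)"

definition exponents :: "nat \<Rightarrow> nat \<Rightarrow> nat list set" where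
  "exponents s k = {e. set e \<subseteq> {..s} \<and> length e = k}"

lemma finite_exponents [simp]: "finite (exponents s k)"
  unfolding exponents_def by (rule finite_lists_length_eq) simp

lemma card_exponents: "card (exponents s k) = (s + 1) ^ k"
  unfolding exponents_def by (subst card_lists_length_eq) auto

lemma exponents_0 [simp]: "exponents s 0 = {[]}"
  by (auto simp: exponents_def)

lemma exponents_Suc: "exponents s (Suc k) = (\<lambda>(a, e). a # e) ` ({..s} \<times> exponents s k)"
  by (auto simp: exponents_def image_iff length_Suc_conv)

lemma sum_exponents_Suc: "(\<Sum>e\<in>exponents s (Suc k). F e) = (\<Sum>a\<le>s. \<Sum>e\<in>exponents s k. F (a # e))"
proof -
  have "inj_on (\<lambda>(a :: nat, e). a # e) ({..s} \<times> exponents s k)" by (auto simp: inj_on_def)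
  then have "(\<Sum>e\<in>exponents s (Suc k). F e) = (\<Sum>(a, e)\<in>{..s} \<times> exponents s k. F (a # e))"
    unfolding exponents_Suc by (subst sum.reindex) (auto simp: case_prod_beta)
  then show ?thesis by (simp add: sum.cartesian_product)
qed

lemma poly_eval_expand: "poly_eval gs s c x = (\<Sum>e\<in>exponents s (length gs). c e * (\<Prod>i<length gs. (gs ! i) x ^ (e ! i)))"
  by (induction gs arbitrary: c)
    (simp_all add: sum_exponents_Suc prod.lessThan_Suc_shift sum_distrib_left mult_ac del: prod.lessThan_Suc)

lemma poly_eval_eq_0: "(\<And>e. e \<in> exponents s (length gs) \<Longrightarrow> c e = 0) \<Longrightarrow> poly_eval gs s c x = 0"
  by (simp add: poly_eval_expand)

text \<open>The span of monomials in the \<xi>, as functions on X. The degree is bounded in each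
  variable separately: then there are \<open>(D + 1) ^ card C\<close> monomials, and the bounds add
  under products.\<close>

definition mono_span :: "'b set \<Rightarrow> 'c set \<Rightarrow> ('c \<Rightarrow> 'b \<Rightarrow> 'a::comm_ring_1) \<Rightarrow> nat \<Rightarrow> ('b \<Rightarrow> 'a) set" where
  "mono_span X C \<xi> D = {h. \<exists>c. \<forall>x\<in>X. h x = (\<Sum>m\<in>PiE C (\<lambda>_. {..D}). c m * (\<Prod>j\<in>C. \<xi> j x ^ m j))}"

context
  fixes X :: "'b set" and C :: "'c set" and \<xi> :: "'c \<Rightarrow> 'b \<Rightarrow> 'a::field"
  assumes C: "finite C"
begin

lemma mono_span_monomial:
  assumes "\<And>j. j \<in> C \<Longrightarrow> m j \<le> D"
  shows "(\<lambda>x. \<Prod>j\<in>C. \<xi> j x ^ m j) \<in> mono_span X C \<xi> D"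
proof -
  have fin: "finite (PiE C (\<lambda>_. {..D}))" using C by (simp add: finite_PiE)
  have mem: "restrict m C \<in> PiE C (\<lambda>_. {..D})" using assms by auto
  have "(\<Sum>m'\<in>PiE C (\<lambda>_. {..D}). (if m' = restrict m C then 1 else 0) * (\<Prod>j\<in>C. \<xi> j x ^ m' j)) = (\<Prod>j\<in>C. \<xi> j x ^ m j)" for x
  proof -
    have "(\<Sum>m'\<in>PiE C (\<lambda>_. {..D}). (if m' = restrict m C then 1 else 0) * (\<Prod>j\<in>C. \<xi> j x ^ m' j))
       = (\<Sum>m'\<in>PiE C (\<lambda>_. {..D}). if m' = restrict m C then (\<Prod>j\<in>C. \<xi> j x ^ m' j) else 0)"
      by (rule sum.cong) auto
    also have "\<dots> = (\<Prod>j\<in>C. \<xi> j x ^ restrict m C j)" using fin mem by simp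
    finally show ?thesis by simp
  qed
  then show ?thesis unfolding mono_span_def
    by (intro CollectI exI[of _ "\<lambda>m'. if m' = restrict m C then 1 else 0"]) auto
qed

lemma mono_span_scale: "h \<in> mono_span X C \<xi> D \<Longrightarrow> (\<lambda>x. a * h x) \<in> mono_span X C \<xi> D"
proof -
  assume "h \<in> mono_span X C \<xi> D"
  then obtain c where "\<forall>x\<in>X. h x = (\<Sum>m\<in>PiE C (\<lambda>_. {..D}). c m * (\<Prod>j\<in>C. \<xi> j x ^ m j))" by (auto simp: mono_span_def)
  then show ?thesis unfolding mono_span_def
    by (intro CollectI exI[of _ "\<lambda>m. a * c m"]) (simp add: sum_distrib_left mult.assoc)
qed

lemma mono_span_add: "h \<in> mono_span X C \<xi> D \<Longrightarrow> k \<in> mono_span X C \<xi> D \<Longrightarrow> (\<lambda>x. h x + k x) \<in> mono_span X C \<xi> D"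
proof -
  assume "h \<in> mono_span X C \<xi> D" "k \<in> mono_span X C \<xi> D"
  then obtain c c' where "\<forall>x\<in>X. h x = (\<Sum>m\<in>PiE C (\<lambda>_. {..D}). c m * (\<Prod>j\<in>C. \<xi> j x ^ m j))"
    "\<forall>x\<in>X. k x = (\<Sum>m\<in>PiE C (\<lambda>_. {..D}). c' m * (\<Prod>j\<in>C. \<xi> j x ^ m j))" by (auto simp: mono_span_def)
  then show ?thesis unfolding mono_span_def
    by (intro CollectI exI[of _ "\<lambda>m. c m + c' m"]) (simp add: sum.distrib distrib_right)
qed

lemma mono_span_cong: "h \<in> mono_span X C \<xi> D \<Longrightarrow> (\<And>x. x \<in> X \<Longrightarrow> h x = k x) \<Longrightarrow> k \<in> mono_span X C \<xi> D"
  unfolding mono_span_def by auto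

lemma mono_span_zero: "(\<lambda>x. 0) \<in> mono_span X C \<xi> D"
  unfolding mono_span_def by (auto intro: exI[of _ "\<lambda>_. 0"])

lemma mono_span_sum: "finite I \<Longrightarrow> (\<And>i. i \<in> I \<Longrightarrow> h i \<in> mono_span X C \<xi> D) \<Longrightarrow> (\<lambda>x. \<Sum>i\<in>I. h i x) \<in> mono_span X C \<xi> D"
  by (induction I rule: finite_induct) (auto intro: mono_span_zero mono_span_add)

lemma mono_span_mono: "D \<le> E \<Longrightarrow> h \<in> mono_span X C \<xi> D \<Longrightarrow> h \<in> mono_span X C \<xi> E"
proof -
  assume DE: "D \<le> E" and "h \<in> mono_span X C \<xi> D"
  then obtain c where c: "\<forall>x\<in>X. h x = (\<Sum>m\<in>PiE C (\<lambda>_. {..D}). c m * (\<Prod>j\<in>C. \<xi> j x ^ m j))" by (auto simp: mono_span_def)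
  have "(\<lambda>x. \<Sum>m\<in>PiE C (\<lambda>_. {..D}). c m * (\<Prod>j\<in>C. \<xi> j x ^ m j)) \<in> mono_span X C \<xi> E"
    by (intro mono_span_sum mono_span_scale mono_span_monomial) (use C DE in \<open>force simp: finite_PiE PiE_iff\<close>)+
  then show ?thesis by (rule mono_span_cong) (use c in auto)
qed

lemma mono_span_mult: "h \<in> mono_span X C \<xi> D \<Longrightarrow> k \<in> mono_span X C \<xi> E \<Longrightarrow> (\<lambda>x. h x * k x) \<in> mono_span X C \<xi> (D + E)"
proof -
  assume "h \<in> mono_span X C \<xi> D" "k \<in> mono_span X C \<xi> E"
  then obtain c c' where c: "\<forall>x\<in>X. h x = (\<Sum>m\<in>PiE C (\<lambda>_. {..D}). c m * (\<Prod>j\<in>C. \<xi> j x ^ m j))"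
    "\<forall>x\<in>X. k x = (\<Sum>m\<in>PiE C (\<lambda>_. {..E}). c' m * (\<Prod>j\<in>C. \<xi> j x ^ m j))" by (auto simp: mono_span_def)
  have "(\<lambda>x. \<Sum>m\<in>PiE C (\<lambda>_. {..D}). \<Sum>m'\<in>PiE C (\<lambda>_. {..E}). (c m * c' m') * (\<Prod>j\<in>C. \<xi> j x ^ (m j + m' j))) \<in> mono_span X C \<xi> (D + E)"
    by (intro mono_span_sum mono_span_scale mono_span_monomial) (use C in \<open>auto simp: finite_PiE PiE_iff intro!: add_mono\<close>)
  then show ?thesis
  proof (rule mono_span_cong)
    fix x assume x: "x \<in> X"
    have "h x * k x = (\<Sum>m\<in>PiE C (\<lambda>_. {..D}). \<Sum>m'\<in>PiE C (\<lambda>_. {..E}).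
        (c m * (\<Prod>j\<in>C. \<xi> j x ^ m j)) * (c' m' * (\<Prod>j\<in>C. \<xi> j x ^ m' j)))"
      using c x by (simp only: sum_product)
    also have "\<dots> = (\<Sum>m\<in>PiE C (\<lambda>_. {..D}). \<Sum>m'\<in>PiE C (\<lambda>_. {..E}). (c m * c' m') * (\<Prod>j\<in>C. \<xi> j x ^ (m j + m' j)))"
      by (intro sum.cong refl) (simp add: power_add prod.distrib mult_ac)
    finally show "(\<Sum>m\<in>PiE C (\<lambda>_. {..D}). \<Sum>m'\<in>PiE C (\<lambda>_. {..E}). (c m * c' m') * (\<Prod>j\<in>C. \<xi> j x ^ (m j + m' j))) = h x * k x" ..
  qed
qed

lemma mono_span_const: "(\<lambda>x. a) \<in> mono_span X C \<xi> D"
proof -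
  have "(\<lambda>x. \<Prod>j\<in>C. \<xi> j x ^ 0) \<in> mono_span X C \<xi> D" by (rule mono_span_monomial) simp
  from mono_span_scale[OF this, of a] show ?thesis by simp
qed

lemma mono_span_coord: "j \<in> C \<Longrightarrow> \<xi> j \<in> mono_span X C \<xi> 1"
proof -
  assume j: "j \<in> C"
  have "(\<lambda>x. \<Prod>i\<in>C. \<xi> i x ^ (if i = j then 1 else 0)) \<in> mono_span X C \<xi> 1" by (rule mono_span_monomial) simp
  moreover have "(\<Prod>i\<in>C. \<xi> i x ^ (if i = j then 1 else 0)) = \<xi> j x" for x
  proof -
    have "(\<Prod>i\<in>C. \<xi> i x ^ (if i = j then 1 else 0)) = (\<Prod>i\<in>C. if i = j then \<xi> i x else 1)" by (rule prod.cong) auto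
    then show ?thesis using j C by simp
  qed
  ultimately show ?thesis by simp
qed

lemma mono_span_power: "h \<in> mono_span X C \<xi> D \<Longrightarrow> (\<lambda>x. h x ^ a) \<in> mono_span X C \<xi> (a * D)"
  by (induction a) (auto intro: mono_span_const mono_span_mult)

lemma mono_span_prod:
  assumes "finite I" "\<And>i. i \<in> I \<Longrightarrow> h i \<in> mono_span X C \<xi> D"
  shows "(\<lambda>x. \<Prod>i\<in>I. h i x) \<in> mono_span X C \<xi> (card I * D)"
  using assms by (induction I rule: finite_induct) (auto intro: mono_span_const mono_span_mult)

text \<open>A count. Let k functions lie in the span of monomials in N functions \<xi>. Their
  \<open>(s + 1) ^ k\<close> products of powers up to s lie in the span of
  \<open>(k * s * D + 1) ^ N\<close> monomials. As k > N, the products outnumber the monomials for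
  large s, and an underdetermined linear system provides a relation.\<close>

lemma algebraically_dependent:
  assumes gs: "\<And>g. g \<in> set gs \<Longrightarrow> g \<in> mono_span X C \<xi> D" and len: "card C < length gs"
  shows "\<exists>s c. (\<exists>e\<in>exponents s (length gs). c e \<noteq> 0) \<and> (\<forall>x\<in>X. poly_eval gs s c x = 0)"
proof -
  define k N where "k = length gs" and "N = card C"
  \<comment> \<open>These choices give \<open>k * s * D + 1 \<le> K * (s + 1)\<close>, whose Nth
    power is at most \<open>s * (s + 1) ^ N\<close>, which is less than
    \<open>(s + 1) ^ (N + 1)\<close>.\<close>
  define K where "K = k * D + 1"
  define s where "s = K ^ N"
  define M where "M = PiE C (\<lambda>_. {..k * (s * D)})"
  have "card M = (k * (s * D) + 1) ^ N" using C by (simp add: M_def card_PiE N_def)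
  also have "\<dots> \<le> (K * (s + 1)) ^ N" by (intro power_mono) (auto simp: K_def algebra_simps)
  also have "\<dots> = s * (s + 1) ^ N" unfolding power_mult_distrib by (simp only: s_def)
  also have "\<dots> < (s + 1) ^ Suc N" by simp
  also have "\<dots> \<le> (s + 1) ^ k" using len by (intro power_increasing) (auto simp: k_def N_def)
  also have "\<dots> = card (exponents s k)" by (simp add: card_exponents)
  finally have card: "card M < card (exponents s k)" .
  have "(\<lambda>x. \<Prod>i<k. (gs ! i) x ^ (e ! i)) \<in> mono_span X C \<xi> (k * (s * D))" if e: "e \<in> exponents s k" for e
  proof -
    have "(\<lambda>x. \<Prod>i\<in>{..<k}. (gs ! i) x ^ (e ! i)) \<in> mono_span X C \<xi> (card {..<k} * (s * D))"
    proof (rule mono_span_prod)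
      fix i assume i: "i \<in> {..<k}"
      have "e ! i \<in> set e" using e i by (simp add: exponents_def)
      then have "e ! i \<le> s" using e by (auto simp: exponents_def)
      then show "(\<lambda>x. (gs ! i) x ^ (e ! i)) \<in> mono_span X C \<xi> (s * D)"
        by (intro mono_span_mono[OF _ mono_span_power[OF gs]]) (use i in \<open>auto simp: k_def\<close>)
    qed simp
    then show ?thesis by simp
  qed
  then have "\<forall>e\<in>exponents s k. \<exists>c. \<forall>x\<in>X. (\<Prod>i<k. (gs ! i) x ^ (e ! i)) = (\<Sum>m\<in>M. c m * (\<Prod>j\<in>C. \<xi> j x ^ m j))"
    by (auto simp: mono_span_def M_def)
  from bchoice[OF this] obtain A where "\<forall>e\<in>exponents s k. \<forall>x\<in>X.
      (\<Prod>i<k. (gs ! i) x ^ (e ! i)) = (\<Sum>m\<in>M. A e m * (\<Prod>j\<in>C. \<xi> j x ^ m j))" by blast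
  then have A: "\<And>e x. e \<in> exponents s k \<Longrightarrow> x \<in> X \<Longrightarrow>
      (\<Prod>i<k. (gs ! i) x ^ (e ! i)) = (\<Sum>m\<in>M. A e m * (\<Prod>j\<in>C. \<xi> j x ^ m j))" by blast
  have "finite M" using C by (simp add: M_def finite_PiE)
  from underdetermined_system[OF this _ card, of A] obtain c where
    c: "\<exists>e\<in>exponents s k. c e \<noteq> 0" "\<And>m. m \<in> M \<Longrightarrow> (\<Sum>e\<in>exponents s k. c e * A e m) = 0" by auto
  have "poly_eval gs s c x = 0" if "x \<in> X" for x
  proof -
    have "poly_eval gs s c x = (\<Sum>e\<in>exponents s k. \<Sum>m\<in>M. c e * A e m * (\<Prod>j\<in>C. \<xi> j x ^ m j))"
      using A that by (simp add: poly_eval_expand sum_distrib_left mult.assoc flip: k_def)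
    also have "\<dots> = (\<Sum>m\<in>M. (\<Sum>e\<in>exponents s k. c e * A e m) * (\<Prod>j\<in>C. \<xi> j x ^ m j))"
      by (subst sum.swap) (simp add: sum_distrib_right)
    finally show ?thesis by (simp add: c(2))
  qed
  then show ?thesis using c(1) by (auto simp: k_def)
qed

end

section \<open>Polynomials on the set of tensors of rank at most r\<close>

lemma poly_fun_sum: "finite I \<Longrightarrow> (\<And>i. i \<in> I \<Longrightarrow> h i \<in> poly_fun n) \<Longrightarrow> (\<lambda>x. \<Sum>i\<in>I. h i x) \<in> poly_fun n"
  by (induction I rule: finite_induct) (auto intro: poly_fun.intros)

lemma poly_fun_prod: "finite I \<Longrightarrow> (\<And>i. i \<in> I \<Longrightarrow> h i \<in> poly_fun n) \<Longrightarrow> (\<lambda>x. \<Prod>i\<in>I. h i x) \<in> poly_fun n"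
  by (induction I rule: finite_induct) (auto intro: poly_fun.intros)

lemma poly_fun_power: "h \<in> poly_fun n \<Longrightarrow> (\<lambda>x. h x ^ a) \<in> poly_fun n"
  by (induction a) (auto intro: poly_fun.intros)

lemma poly_fun_poly_eval:
  fixes gs :: "('a::comm_ring_1 vec \<Rightarrow> 'a) list"
  shows "set gs \<subseteq> poly_fun n \<Longrightarrow> poly_eval gs s c \<in> poly_fun n"
proof (induction gs arbitrary: c)
  case Nil
  have "poly_eval [] s c = (\<lambda>x :: 'a vec. c [])" by auto
  then show ?case by (simp only: poly_fun.const)
next
  case (Cons g gs)
  have "poly_eval (g # gs) s c = (\<lambda>x. \<Sum>a\<le>s. g x ^ a * poly_eval gs s (\<lambda>e. c (a # e)) x)" by auto
  moreover have "(\<lambda>x. \<Sum>a\<le>s. g x ^ a * poly_eval gs s (\<lambda>e. c (a # e)) x) \<in> poly_fun n"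
    using Cons by (intro poly_fun_sum poly_fun.mult poly_fun_power) auto
  ultimately show ?case by simp
qed

lemma poly_eval_comp: "poly_eval (map (\<lambda>g x. g (f x)) gs) s c x = poly_eval gs s c (f x)"
  by (induction gs arbitrary: c) auto

lemma poly_fun_cpd_map:
  assumes "h \<in> poly_fun (prod_list ns)"
  shows "(\<lambda>x. h (cpd_map ns r x)) \<in> poly_fun (r * sum_list ns)"
  using assms
proof (induction rule: poly_fun.induct)
  case (coord j)
  have "(\<lambda>x. \<Sum>i<r. \<Prod>k<length ns. x $ entry_pos ns i k (digits ns j ! k)) \<in> poly_fun (r * sum_list ns)"
    by (intro poly_fun_sum poly_fun_prod poly_fun.coord entry_pos_less digits_less coord) auto
  then show ?case by (simp add: cpd_map_entry[OF coord])
qed (auto intro: poly_fun.intros)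

text \<open>The coordinates with index in \<open>slice_indices\<close> can be normalised to \<open>1\<close> by rescaling the factors.\<close>

definition slice_indices :: "nat list \<Rightarrow> nat \<Rightarrow> nat set" where
  "slice_indices ns r = (\<lambda>(i, k). entry_pos ns i k 0) ` ({..<r} \<times> {1..<length ns})"

text \<open>The origin of N: of the r(\<Sigma> + d) entries, r(d - 1) are normalised.\<close>

lemma card_slice_complement:
  assumes "length ns \<ge> 1" "\<forall>n\<in>set ns. n \<ge> 1"
  shows "card ({..<r * sum_list ns} - slice_indices ns r) = r * (Sigma_dim ns + 1)"
proof -
  have ns: "ns ! k > 0" if "k < length ns" for k using assms(2) that by (metis nth_mem less_eq_Suc_le One_nat_def)
  have "inj_on (\<lambda>(i, k). entry_pos ns i k 0) ({..<r} \<times> {1..<length ns})"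
    by (auto simp: inj_on_def entry_pos_inj ns)
  then have "card (slice_indices ns r) = r * (length ns - 1)"
    unfolding slice_indices_def by (subst card_image) auto
  moreover have "slice_indices ns r \<subseteq> {..<r * sum_list ns}"
    by (auto simp: slice_indices_def intro!: entry_pos_less ns)
  moreover have "r * sum_list ns = r * (Sigma_dim ns + 1) + r * (length ns - 1)"
    using assms by (cases "length ns") (simp_all add: sum_list_eq_Sigma_dim algebra_simps)
  ultimately show ?thesis by (subst card_Diff_subset) (auto intro: finite_subset)
qed

text \<open>Each factor but the first is divided by its leading entry, and the first is multiplied
  by the product of these entries, which leaves every rank-one term unchanged.\<close>

lemma cpd_map_normalise:
  fixes x :: "'a::field vec"
  assumes d: "length ns \<ge> 1" and ns: "\<forall>n\<in>set ns. n \<ge> 1"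
    and nz: "\<And>q. q \<in> slice_indices ns r \<Longrightarrow> x $ q \<noteq> 0"
  shows "\<exists>y\<in>carrier_vec (r * sum_list ns). (\<forall>q\<in>slice_indices ns r. y $ q = 1) \<and> cpd_map ns r y = cpd_map ns r x"
proof -
  have ns': "ns ! k > 0" if "k < length ns" for k using ns that by (metis nth_mem less_eq_Suc_le One_nat_def)
  define a where "a = (\<lambda>i k. x $ entry_pos ns i k 0)"
  have a: "a i k \<noteq> 0" if "i < r" "k \<in> {1..<length ns}" for i k
    using nz that unfolding a_def slice_indices_def by force
  define y where "y = triple_vec ns r (\<lambda>i k c. if k = 0 then (\<Prod>l\<in>{1..<length ns}. a i l) * x $ entry_pos ns i k c else x $ entry_pos ns i k c / a i k)"
  have "cpd_map ns r y = cpd_map ns r x"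
  proof (rule eq_vecI)
    fix j assume "j < dim_vec (cpd_map ns r x)"
    then have j: "j < prod_list ns" by simp
    have "(\<Prod>k<length ns. y $ entry_pos ns i k (digits ns j ! k)) = (\<Prod>k<length ns. x $ entry_pos ns i k (digits ns j ! k))" if i: "i < r" for i
    proof -
      have s: "{..<length ns} = insert 0 {1..<length ns}" using d by auto
      have "(\<Prod>k<length ns. y $ entry_pos ns i k (digits ns j ! k)) =
        y $ entry_pos ns i 0 (digits ns j ! 0) * (\<Prod>k\<in>{1..<length ns}. y $ entry_pos ns i k (digits ns j ! k))"
        unfolding s by simp
      also have "y $ entry_pos ns i 0 (digits ns j ! 0) = (\<Prod>l\<in>{1..<length ns}. a i l) * x $ entry_pos ns i 0 (digits ns j ! 0)"
      proof -
        have "0 < length ns" using d by linarith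
        then show ?thesis using i digits_less[OF j, of 0] unfolding y_def by (subst triple_vec_entry) simp_all
      qed
      also have "(\<Prod>k\<in>{1..<length ns}. y $ entry_pos ns i k (digits ns j ! k)) = (\<Prod>k\<in>{1..<length ns}. x $ entry_pos ns i k (digits ns j ! k) / a i k)"
        by (rule prod.cong) (use i j in \<open>auto simp: y_def triple_vec_entry digits_less\<close>)
      also have "\<dots> = (\<Prod>k\<in>{1..<length ns}. x $ entry_pos ns i k (digits ns j ! k)) / (\<Prod>l\<in>{1..<length ns}. a i l)"
        by (rule prod_dividef)
      also have "(\<Prod>l\<in>{1..<length ns}. a i l) * x $ entry_pos ns i 0 (digits ns j ! 0) *
          ((\<Prod>k\<in>{1..<length ns}. x $ entry_pos ns i k (digits ns j ! k)) / (\<Prod>l\<in>{1..<length ns}. a i l))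
        = x $ entry_pos ns i 0 (digits ns j ! 0) * (\<Prod>k\<in>{1..<length ns}. x $ entry_pos ns i k (digits ns j ! k))"
        using a[OF i] by simp
      also have "\<dots> = (\<Prod>k<length ns. x $ entry_pos ns i k (digits ns j ! k))" unfolding s by simp
      finally show ?thesis .
    qed
    then show "cpd_map ns r y $ j = cpd_map ns r x $ j" by (simp add: cpd_map_entry[OF j])
  qed simp
  moreover have "y $ q = 1" if "q \<in> slice_indices ns r" for q
    using that a ns' by (auto simp: slice_indices_def y_def triple_vec_entry a_def)
  ultimately show ?thesis by (intro bexI[of _ y]) (auto simp: y_def)
qed

text \<open>Points without zero coordinates are dense: replacing the zeros of x by a small t gives
  one near x, and h is continuous.\<close>

lemma poly_fun_zero_dense:
  fixes h :: "'a::real_normed_field vec \<Rightarrow> 'a"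
  assumes h: "h \<in> poly_fun n" and z: "\<And>x. x \<in> carrier_vec n \<Longrightarrow> (\<And>q. q < n \<Longrightarrow> x $ q \<noteq> 0) \<Longrightarrow> h x = 0"
    and x: "x \<in> carrier_vec n"
  shows "h x = 0"
proof -
  obtain g where g: "strictly_diff n h x (\<lambda>v. \<Sum>i<n. g i * v $ i)" using poly_fun_strictly_diff[OF h x] by blast
  obtain C \<delta> where C: "C \<ge> 0" "\<delta> > 0" "\<And>y z. y \<in> carrier_vec n \<Longrightarrow> z \<in> carrier_vec n \<Longrightarrow> vdist n x y < \<delta> \<Longrightarrow> vdist n x z < \<delta> \<Longrightarrow>
        norm (h y - h z) \<le> C * vdist n y z" using strictly_diff_lipschitz[OF g] by blast
  have "norm (h x) \<le> 0 + e" if e: "e > 0" for e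
  proof -
    define t where "t = min (e / (C + 1)) (\<delta> / 2) / (real n + 1)"
    have t: "t > 0" using e C by (simp add: t_def)
    define y where "y = vec n (\<lambda>q. if x $ q = 0 then of_real t else x $ q)"
    have yc: "y \<in> carrier_vec n" by (simp add: y_def)
    have "vdist n x y \<le> real n * t"
      by (rule vdist_leI) (use t in \<open>auto simp: y_def\<close>)
    also have "\<dots> \<le> min (e / (C + 1)) (\<delta> / 2)"
    proof -
      have "real n * t \<le> (real n + 1) * t" using t by simp
      also have "\<dots> = min (e / (C + 1)) (\<delta> / 2)" by (simp add: t_def)
      finally show ?thesis .
    qed
    finally have d: "vdist n x y \<le> e / (C + 1)" "vdist n x y < \<delta>" using C by auto
    have "h y = 0" by (rule z[OF yc]) (use t in \<open>auto simp: y_def\<close>)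
    then have "norm (h x) \<le> C * vdist n x y" using C(3)[of x y] x yc d C(2) by simp
    also have "\<dots> \<le> C * (e / (C + 1))" using d C by (intro mult_left_mono) auto
    also have "\<dots> \<le> e" using C e by (simp add: field_simps)
    finally show ?thesis by simp
  qed
  then have "norm (h x) \<le> 0" by (rule field_le_epsilon)
  then show ?thesis by simp
qed

text \<open>On the normalised decompositions \<open>X\<close> every entry is 1 or one of N free
  coordinates, so the functions in \<open>gs\<close> composed with f are polynomials in N variables,
  and more than N of them are dependent. The relation passes to all decompositions without zero
  entries, since these can be normalised, and to the remaining ones by density.\<close>

lemma sigma_algebraically_dependent:
  fixes gs :: "('a::real_normed_field vec \<Rightarrow> 'a) list"
  assumes d: "length ns \<ge> 1" and ns: "\<forall>n\<in>set ns. n \<ge> 1"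
    and gs: "set gs \<subseteq> poly_fun (prod_list ns)" and len: "r * (Sigma_dim ns + 1) < length gs"
  shows "\<exists>s c. (\<exists>e\<in>exponents s (length gs). c e \<noteq> 0) \<and> (\<forall>A\<in>sigma ns r. poly_eval gs s c A = 0)"
proof -
  let ?n = "r * sum_list ns"
  define Z where "Z = slice_indices ns r"
  define C where "C = {..<?n} - Z"
  define X where "X = {x \<in> carrier_vec ?n. \<forall>q\<in>Z. (x :: 'a vec) $ q = 1}"
  define \<xi> where "\<xi> = (\<lambda>j x. (x :: 'a vec) $ j)"
  have fC: "finite C" by (simp add: C_def)
  have cC: "card C = r * (Sigma_dim ns + 1)" unfolding C_def Z_def by (rule card_slice_complement[OF d ns])
  have coord: "(\<lambda>x. x $ q) \<in> mono_span X C \<xi> 1" if "q < ?n" for q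
  proof (cases "q \<in> C")
    case True
    then show ?thesis using mono_span_coord[OF fC, of q \<xi> X] by (simp add: \<xi>_def)
  next
    case False
    then have "q \<in> Z" using that by (simp add: C_def)
    then show ?thesis by (intro mono_span_cong[OF fC mono_span_const[OF fC, of 1]]) (auto simp: X_def)
  qed
  have "\<exists>D. (\<lambda>x. h (cpd_map ns r x)) \<in> mono_span X C \<xi> D" if "h \<in> poly_fun (prod_list ns)" for h
    using that
  proof (induction rule: poly_fun.induct)
    case (const c)
    then show ?case using mono_span_const[OF fC] by blast
  next
    case (coord j)
    have "(\<lambda>x. \<Sum>i\<in>{..<r}. \<Prod>k\<in>{..<length ns}. x $ entry_pos ns i k (digits ns j ! k)) \<in> mono_span X C \<xi> (card {..<length ns} * 1)"
      by (intro mono_span_sum mono_span_prod fC \<open>\<And>q. q < ?n \<Longrightarrow> (\<lambda>x. x $ q) \<in> mono_span X C \<xi> 1\<close> entry_pos_less digits_less coord) auto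
    then show ?case by (auto simp: cpd_map_entry[OF coord])
  next
    case (add f g)
    then obtain D E where "(\<lambda>x. f (cpd_map ns r x)) \<in> mono_span X C \<xi> D" "(\<lambda>x. g (cpd_map ns r x)) \<in> mono_span X C \<xi> E" by auto
    then have "(\<lambda>x. f (cpd_map ns r x) + g (cpd_map ns r x)) \<in> mono_span X C \<xi> (max D E)"
      by (intro mono_span_add fC; elim mono_span_mono[OF fC, rotated]; simp)
    then show ?case by blast
  next
    case (mult f g)
    then show ?case using mono_span_mult[OF fC] by blast
  qed
  then have "\<forall>g\<in>set gs. \<exists>D. (\<lambda>x. g (cpd_map ns r x)) \<in> mono_span X C \<xi> D" using gs by blast
  then obtain D where D: "\<And>g. g \<in> set gs \<Longrightarrow> (\<lambda>x. g (cpd_map ns r x)) \<in> mono_span X C \<xi> (D g)" by metis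
  define gs' where "gs' = map (\<lambda>g x. g (cpd_map ns r x)) gs"
  have "g' \<in> mono_span X C \<xi> (\<Sum>g\<in>set gs. D g)" if g': "g' \<in> set gs'" for g'
  proof -
    obtain g where g: "g \<in> set gs" "g' = (\<lambda>x. g (cpd_map ns r x))" using g' by (auto simp: gs'_def)
    show ?thesis unfolding g(2) by (rule mono_span_mono[OF fC _ D[OF g(1)]]) (use g in \<open>auto intro: member_le_sum\<close>)
  qed
  then have "\<exists>s c. (\<exists>e\<in>exponents s (length gs'). c e \<noteq> 0) \<and> (\<forall>x\<in>X. poly_eval gs' s c x = 0)"
    by (rule algebraically_dependent[OF fC]) (use len in \<open>auto simp: cC gs'_def\<close>)
  then obtain s c where sc: "\<exists>e\<in>exponents s (length gs). c e \<noteq> 0" "\<And>x. x \<in> X \<Longrightarrow> poly_eval gs s c (cpd_map ns r x) = 0"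
    by (auto simp: gs'_def poly_eval_comp)
  have "poly_eval gs s c (cpd_map ns r x) = 0" if x: "x \<in> carrier_vec ?n" for x
  proof (rule poly_fun_zero_dense[OF _ _ x])
    show "(\<lambda>x. poly_eval gs s c (cpd_map ns r x)) \<in> poly_fun ?n" by (intro poly_fun_cpd_map poly_fun_poly_eval gs)
    fix y :: "'a vec" assume y: "y \<in> carrier_vec ?n" "\<And>q. q < ?n \<Longrightarrow> y $ q \<noteq> 0"
    have ns': "ns ! k > 0" if "k < length ns" for k using ns that by (metis nth_mem less_eq_Suc_le One_nat_def)
    have "\<exists>z\<in>carrier_vec ?n. (\<forall>q\<in>slice_indices ns r. z $ q = 1) \<and> cpd_map ns r z = cpd_map ns r y"
      by (rule cpd_map_normalise[OF d ns]) (auto simp: slice_indices_def intro!: y entry_pos_less ns')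
    then obtain z where "z \<in> X" "cpd_map ns r z = cpd_map ns r y" by (auto simp: X_def Z_def)
    then show "poly_eval gs s c (cpd_map ns r y) = 0" using sc(2)[of z] by simp
  qed
  then show ?thesis using sc(1) by (auto simp: sigma_def)
qed

section \<open>Chains of irreducible algebraic sets\<close>

lemma irreducible_prime:
  assumes V: "irreducible_set n V" and f: "f \<in> poly_fun n" and g: "g \<in> poly_fun n"
    and fg: "\<And>x. x \<in> V \<Longrightarrow> f x * g x = 0"
  shows "(\<forall>x\<in>V. f x = 0) \<or> (\<forall>x\<in>V. g x = 0)"
proof -
  obtain F where F: "F \<subseteq> poly_fun n" "V = {x \<in> carrier_vec n. \<forall>f\<in>F. f x = 0}"
    using V by (auto simp: irreducible_set_def algebraic_set_def)
  have alg: "algebraic_set n {x \<in> V. h x = 0}" if "h \<in> poly_fun n" for h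
    unfolding algebraic_set_def using F that by (intro exI[of _ "insert h F"]) auto
  have "V = {x \<in> V. f x = 0} \<union> {x \<in> V. g x = 0}" using fg by auto
  then have "V = {x \<in> V. f x = 0} \<or> V = {x \<in> V. g x = 0}"
    using V alg[OF f] alg[OF g] unfolding irreducible_set_def by blast
  then show ?thesis by auto
qed

text \<open>A relation on the largest set is expanded in powers of the last function, which
  \<open>rev\<close> makes the outermost variable of \<open>poly_eval\<close>. The lowest remaining
  power is cancelled, because the set is irreducible and the function does not vanish on it. On the
  next smaller set the function is 0, so the lowest coefficient vanishes there, and the induction
  hypothesis applies to it.\<close>

lemma chain_algebraically_independent:
  assumes C: "\<And>i. i \<le> k \<Longrightarrow> irreducible_set n (C i)" and sub: "\<And>i. i < k \<Longrightarrow> C i \<subset> C (Suc i)"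
    and G: "\<And>i. i < k \<Longrightarrow> G i \<in> poly_fun n" "\<And>i x. i < k \<Longrightarrow> x \<in> C i \<Longrightarrow> G i x = 0"
      "\<And>i. i < k \<Longrightarrow> \<exists>x\<in>C (Suc i). G i x \<noteq> 0"
    and z: "\<And>x. x \<in> C k \<Longrightarrow> poly_eval (map G (rev [0..<k])) s c x = 0"
    and e: "e \<in> exponents s k"
  shows "c e = 0"
  using assms
proof (induction k arbitrary: c e)
  case 0
  then show ?case by (auto simp: irreducible_set_def)
next
  case (Suc k)
  let ?gs = "map G (rev [0..<k])"
  define m where "m = (\<lambda>a. poly_eval ?gs s (\<lambda>e. c (a # e)))"
  have m: "m a \<in> poly_fun n" for a
    unfolding m_def using Suc.prems(3) by (intro poly_fun_poly_eval) auto
  have c0: "\<forall>e\<in>exponents s k. c (a # e) = 0" if "a \<le> s" for a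
    using that
  proof (induction a rule: less_induct)
    case (less a)
    have m0: "m b x = 0" if "b < a" for b x
      unfolding m_def by (rule poly_eval_eq_0) (use less that in auto)
    \<comment> \<open>The relation divided by \<open>G k ^ a\<close>; the coefficients below a are
      already known to be zero.\<close>
    define R where "R = (\<lambda>x. \<Sum>b\<in>{a..s}. G k x ^ (b - a) * m b x)"
    have R: "R \<in> poly_fun n" unfolding R_def
      using Suc.prems(3) by (intro poly_fun_sum poly_fun.mult poly_fun_power m) auto
    have "G k x ^ a * R x = 0" if x: "x \<in> C (Suc k)" for x
    proof -
      have "0 = poly_eval (map G (rev [0..<Suc k])) s c x" using Suc.prems(6) x by simp
      also have "\<dots> = (\<Sum>b\<le>s. G k x ^ b * m b x)" by (simp add: m_def)
      also have "\<dots> = (\<Sum>b\<in>{a..s}. G k x ^ b * m b x)"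
        by (rule sum.mono_neutral_right) (auto simp: m0)
      also have "\<dots> = (\<Sum>b\<in>{a..s}. G k x ^ a * (G k x ^ (b - a) * m b x))"
        by (rule sum.cong) (simp_all flip: power_add mult.assoc)
      finally show ?thesis by (simp add: R_def sum_distrib_left)
    qed
    then have "(\<forall>x\<in>C (Suc k). G k x ^ a = 0) \<or> (\<forall>x\<in>C (Suc k). R x = 0)"
      using Suc.prems(3)[of k] by (intro irreducible_prime[OF Suc.prems(1)] poly_fun_power R) auto
    moreover have "\<not> (\<forall>x\<in>C (Suc k). G k x ^ a = 0)" using Suc.prems(5)[of k] by auto
    ultimately have R0: "R x = 0" if "x \<in> C (Suc k)" for x using that by blast
    have "m a x = 0" if x: "x \<in> C k" for x
    proof -
      have "R x = (\<Sum>b\<in>{a..s}. if b = a then m a x else 0)"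
        unfolding R_def using Suc.prems(4)[of k x] x by (intro sum.cong) (auto simp: power_0_left)
      also have "\<dots> = m a x" using less.prems by simp
      finally show ?thesis using R0 Suc.prems(2)[of k] x by auto
    qed
    then have "c (a # e) = 0" if "e \<in> exponents s k" for e
      by (intro Suc.IH[where c = "\<lambda>e. c (a # e)"]) (use Suc.prems that in \<open>auto simp: m_def less_Suc_eq\<close>)
    then show ?case by blast
  qed
  then show ?case using Suc.prems(7) by (auto simp: exponents_Suc)
qed

text \<open>A chain of length k > N would yield k polynomials that are algebraically independent on
  its largest member. But they satisfy a relation on \<open>sigma\<close>, whose zero set is
  algebraic and so contains the Zariski closure.\<close>

lemma variety_dim_zariski_closure_sigma:
  assumes d: "length ns \<ge> 1" and ns: "\<forall>n\<in>set ns. n \<ge> 1"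
  shows "variety_dim (prod_list ns) (zariski_closure (prod_list ns) (sigma ns r)) \<le> enat (r * (Sigma_dim ns + 1))"
  unfolding variety_dim_def
proof (rule SUP_least)
  let ?n = "prod_list ns" and ?N = "r * (Sigma_dim ns + 1)"
  let ?V = "zariski_closure ?n (sigma ns r)"
  fix k assume "k \<in> {k. \<exists>C. (\<forall>i\<le>k. irreducible_set ?n (C i) \<and> C i \<subseteq> ?V) \<and> (\<forall>i<k. C i \<subset> C (Suc i))}"
  then obtain C where C: "\<And>i. i \<le> k \<Longrightarrow> irreducible_set ?n (C i)" "\<And>i. i \<le> k \<Longrightarrow> C i \<subseteq> ?V"
    "\<And>i. i < k \<Longrightarrow> C i \<subset> C (Suc i)" by auto
  show "enat k \<le> enat ?N"
  proof (rule ccontr)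
    assume "\<not> enat k \<le> enat ?N"
    then have k: "?N < k" by simp
    have "\<exists>g\<in>poly_fun ?n. (\<forall>x\<in>C i. g x = 0) \<and> (\<exists>x\<in>C (Suc i). g x \<noteq> 0)" if i: "i < k" for i
    proof -
      obtain F where F: "F \<subseteq> poly_fun ?n" "C i = {x \<in> carrier_vec ?n. \<forall>f\<in>F. f x = 0}"
        using C(1)[of i] i by (auto simp: irreducible_set_def algebraic_set_def)
      obtain y where y: "y \<in> C (Suc i)" "y \<notin> C i" using C(3)[OF i] by blast
      have "y \<in> carrier_vec ?n" using C(1)[of "Suc i"] i y by (auto simp: irreducible_set_def algebraic_set_def)
      then obtain f where "f \<in> F" "f y \<noteq> 0" using F(2) y(2) by auto
      then show ?thesis using F y by (intro bexI[of _ f]) auto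
    qed
    then obtain G where G: "\<And>i. i < k \<Longrightarrow> G i \<in> poly_fun ?n" "\<And>i x. i < k \<Longrightarrow> x \<in> C i \<Longrightarrow> G i x = 0"
      "\<And>i. i < k \<Longrightarrow> \<exists>x\<in>C (Suc i). G i x \<noteq> 0" by metis
    let ?gs = "map G (rev [0..<k])"
    have gs: "set ?gs \<subseteq> poly_fun ?n" using G(1) by auto
    have "\<exists>s c. (\<exists>e\<in>exponents s (length ?gs). c e \<noteq> 0) \<and> (\<forall>A\<in>sigma ns r. poly_eval ?gs s c A = 0)"
      by (rule sigma_algebraically_dependent[OF d ns gs]) (use k in auto)
    then obtain s c where sc: "\<exists>e\<in>exponents s k. c e \<noteq> 0" "\<forall>A\<in>sigma ns r. poly_eval ?gs s c A = 0" by auto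
    define V' where "V' = {x \<in> carrier_vec ?n. \<forall>f\<in>{poly_eval ?gs s c}. f x = 0}"
    have "algebraic_set ?n V'" unfolding algebraic_set_def V'_def
      using poly_fun_poly_eval[OF gs] by blast
    moreover have "sigma ns r \<subseteq> V'" using sc(2) by (auto simp: V'_def sigma_def)
    ultimately have "?V \<subseteq> V'" unfolding zariski_closure_def by blast
    then have "poly_eval ?gs s c x = 0" if "x \<in> C k" for x using C(2)[of k] that by (auto simp: V'_def)
    then have "c e = 0" if "e \<in> exponents s k" for e
      by (intro chain_algebraically_independent[of k ?n C G s c e] C G that)
    then show False using sc(1) by auto
  qed
qed

section \<open>Regular points\<close>

text \<open>The common outcome of regularity over both fields: the part of S near A is injected
  continuously into F^N. The function \<open>h\<close> is total, and its conditions concern only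
  points of S near A.\<close>

definition locally_embeds :: "nat \<Rightarrow> 'a::real_normed_field vec set \<Rightarrow> 'a vec \<Rightarrow> nat \<Rightarrow> bool" where
  "locally_embeds n S A N \<longleftrightarrow> (\<exists>\<delta>>0. \<exists>h :: 'a vec \<Rightarrow> 'a vec.
     (\<forall>x\<in>S. vdist n A x < \<delta> \<longrightarrow> h x \<in> carrier_vec N) \<and>
     (\<forall>x\<in>S. \<forall>y\<in>S. vdist n A x < \<delta> \<longrightarrow> vdist n A y < \<delta> \<longrightarrow> h x = h y \<longrightarrow> x = y) \<and>
     (\<forall>x\<in>S. vdist n A x < \<delta> \<longrightarrow> (\<forall>e>0. \<exists>d>0. \<forall>y\<in>S. vdist n A y < \<delta> \<longrightarrow> vdist n x y < d \<longrightarrow> vdist N (h x) (h y) < e)))"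

text \<open>Links the gradient of a polynomial to derivatives along lines, by which
  \<open>zariski_tangent\<close> is defined.\<close>

lemma strictly_diff_has_field_derivative:
  assumes h: "strictly_diff n h a L" and a: "a \<in> carrier_vec n" and v: "v \<in> carrier_vec n"
    and L: "\<And>t. L (t \<cdot>\<^sub>v v) = t * L v"
  shows "((\<lambda>t. h (a + t \<cdot>\<^sub>v v)) has_field_derivative L v) (at (0 :: 'a::real_normed_field))"
  unfolding has_field_derivative_iff
proof (rule LIM_I)
  fix e :: real assume e: "e > 0"
  \<comment> \<open>Adding 1 keeps \<open>B\<close> positive also for v = 0.\<close>
  define B where "B = vnorm v + 1"
  have B: "B > 0" using vnorm_nonneg[of v] by (simp add: B_def add_nonneg_pos del: vnorm_nonneg)
  obtain \<delta> where \<delta>: "\<delta> > 0" "\<And>x y. x \<in> carrier_vec n \<Longrightarrow> y \<in> carrier_vec n \<Longrightarrow> vdist n a x < \<delta> \<Longrightarrow> vdist n a y < \<delta> \<Longrightarrow>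
        norm (h x - h y - L (x - y)) \<le> e / (2 * B) * vdist n x y"
    using strictly_diffD[OF h, of "e / (2 * B)"] e B by (metis divide_pos_pos mult_pos_pos zero_less_numeral)
  show "\<exists>s>0. \<forall>x. x \<noteq> 0 \<and> norm (x - 0) < s \<longrightarrow>
      norm ((h (a + x \<cdot>\<^sub>v v) - h (a + 0 \<cdot>\<^sub>v v)) / (x - 0) - L v) < e"
  proof (intro exI[of _ "\<delta> / B"] conjI allI impI)
    fix t :: 'a assume t: "t \<noteq> 0 \<and> norm (t - 0) < \<delta> / B"
    have dist: "vdist n a (a + t \<cdot>\<^sub>v v) = norm t * vnorm v"
      using a v by (simp add: vdist_def vnorm_def norm_mult L2_set_right_distrib cong: L2_set_cong_simp)
    have "norm t * vnorm v \<le> norm t * B" by (intro mult_left_mono) (auto simp: B_def)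
    also have "\<dots> < \<delta>" using t B by (simp add: field_simps)
    finally have d: "vdist n a (a + t \<cdot>\<^sub>v v) < \<delta>" using dist by simp
    have "norm (h (a + t \<cdot>\<^sub>v v) - h a - L ((a + t \<cdot>\<^sub>v v) - a)) \<le> e / (2 * B) * vdist n (a + t \<cdot>\<^sub>v v) a"
      by (rule \<delta>(2)) (use a v d \<delta>(1) in auto)
    moreover have "(a + t \<cdot>\<^sub>v v) - a = t \<cdot>\<^sub>v v" using a v by (intro eq_vecI) auto
    ultimately have *: "norm (h (a + t \<cdot>\<^sub>v v) - h a - t * L v) \<le> e / (2 * B) * (norm t * vnorm v)"
      using dist by (simp add: L vdist_commute)
    have a0: "a + 0 \<cdot>\<^sub>v v = a" using a v by (intro eq_vecI) auto
    have "norm ((h (a + t \<cdot>\<^sub>v v) - h a) / t - L v) = norm (h (a + t \<cdot>\<^sub>v v) - h a - t * L v) / norm t"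
      using t by (simp add: norm_divide[symmetric] diff_divide_distrib)
    also have "\<dots> \<le> e / (2 * B) * vnorm v"
      using * t by (simp add: divide_le_eq mult_ac)
    also have "\<dots> \<le> e / (2 * B) * B" using e B by (intro mult_left_mono) (auto simp: B_def)
    also have "\<dots> < e" using e B by simp
    finally show "norm ((h (a + t \<cdot>\<^sub>v v) - h (a + 0 \<cdot>\<^sub>v v)) / (t - 0) - L v) < e" using a0 by simp
  qed (use \<delta> B in auto)
qed

section \<open>Regular points of complex varieties\<close>

lemma subspace_spanning_set:
  assumes W: "W \<subseteq> carrier_vec n" and z: "0\<^sub>v n \<in> W"
    and add: "\<And>v w. v \<in> W \<Longrightarrow> w \<in> W \<Longrightarrow> v + w \<in> W" and smult: "\<And>c v. v \<in> W \<Longrightarrow> c \<cdot>\<^sub>v v \<in> W"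
  shows "\<exists>B. finite B \<and> card B = subspace_dim n W \<and> B \<subseteq> W \<and> (\<forall>v\<in>W. \<exists>a. \<forall>i<n. v $ i = (\<Sum>b\<in>B. a b * b $ i))"
proof -
  interpret vec_space "TYPE(complex)" n .
  have sub: "subspace class_ring W V"
    unfolding subspace_def submodule_def
    using W z add smult by (auto simp: module_vec_simps vectorspace_axioms module_axioms)
  then have sm: "submodule class_ring W V" by (simp add: subspace_def)
  interpret W: vectorspace class_ring "vs W" by (rule subspace_is_vs[OF sub])
  have cV: "carrier V = carrier_vec n" unfolding module_vec_def by simp
  have li: "W.lin_indpt A \<longleftrightarrow> lin_indpt A" if "A \<subseteq> W" for A
    using span_li_not_depend(2)[OF that sm] by simp
  \<comment> \<open>The ambient dimension bounds the independent subsets of W; so a maximal one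
    exists, and it is a basis of W.\<close>
  have "finite A \<and> card A \<le> dim" if "A \<subseteq> W \<and> W.lin_indpt A" for A
  proof -
    have AW: "A \<subseteq> W" and "W.lin_indpt A" using that by blast+
    then have lA: "lin_indpt A" using li[OF AW] by blast
    have "A \<subseteq> carrier_vec n" using AW W by (rule subset_trans)
    from li_le_dim[OF fin_dim this lA] show ?thesis by (rule conjI)
  qed
  moreover have "{} \<subseteq> W \<and> W.lin_indpt {}" by (auto simp: W.lin_dep_def)
  ultimately have "\<exists>B. finite B \<and> maximal B (\<lambda>S. S \<subseteq> W \<and> W.lin_indpt S)"
    by (rule maximal_exists)
  then obtain B where B: "finite B" "maximal B (\<lambda>S. S \<subseteq> W \<and> W.lin_indpt S)"
    by (elim exE conjE)
  then have basis: "W.basis B" using W.max_li_is_basis[of B] by simp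
  then have BW: "B \<subseteq> W" and gen: "W.span B = W" by (auto simp: W.basis_def)
  have dimB: "subspace_dim n W = card B"
    unfolding subspace_dim_def using W.dim_basis[OF B(1) basis] by simp
  have sp: "span B = W" using gen span_li_not_depend(1)[OF BW sm] by simp
  have "\<exists>a. \<forall>i<n. v $ i = (\<Sum>b\<in>B. a b * b $ i)" if v: "v \<in> W" for v
  proof -
    have Bc: "B \<subseteq> carrier_vec n" using BW W by blast

    have "v \<in> span B" using v sp by blast
    from finite_in_span[OF B(1) Bc this] obtain a where a: "lincomb a B = v" by (elim exE conjE)
    have "v $ i = (\<Sum>b\<in>B. a b * b $ i)" if "i < n" for i
      using lincomb_index[OF that Bc, of a] unfolding a .
    then show ?thesis by (intro exI[of _ a] allI impI)
  qed
  with B(1) dimB BW show ?thesis by (intro exI[of _ B] conjI ballI) (simp_all only:)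
qed

text \<open>Otherwise pairs of distinct points of S tend to A while having equal inner products with
  B. Their normalised differences accumulate at a unit vector v. Each f in I vanishes at both points
  of a pair, so by strict differentiability its derivative along v is 0; and v is orthogonal to B.
  Then \<open>tangent\<close> forces v = 0.\<close>

lemma locally_injective_of_tangent:
  fixes S :: "'a::rc_field vec set"
  assumes S: "S \<subseteq> carrier_vec n" and A: "A \<in> S"
    and I: "I \<subseteq> poly_fun n" "\<And>f x. f \<in> I \<Longrightarrow> x \<in> S \<Longrightarrow> f x = 0"
    and g: "\<And>f. f \<in> I \<Longrightarrow> strictly_diff n f A (\<lambda>v. \<Sum>i<n. g f i * v $ i)"
    and B: "finite B" "B \<subseteq> carrier_vec n"
    and tangent: "\<And>v. v \<in> carrier_vec n \<Longrightarrow> (\<And>f. f \<in> I \<Longrightarrow> (\<Sum>i<n. g f i * v $ i) = 0) \<Longrightarrow>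
       (\<And>b. b \<in> B \<Longrightarrow> cinner n b v = 0) \<Longrightarrow> v = 0\<^sub>v n"
  shows "\<exists>\<delta>>0. \<forall>x\<in>S. \<forall>y\<in>S. vdist n A x < \<delta> \<longrightarrow> vdist n A y < \<delta> \<longrightarrow> (\<forall>b\<in>B. cinner n b x = cinner n b y) \<longrightarrow> x = y"
proof (rule ccontr)
  assume neg: "\<not> ?thesis"
  have "\<exists>x y. x \<in> S \<and> y \<in> S \<and> vdist n A x < 1 / real (Suc j) \<and> vdist n A y < 1 / real (Suc j) \<and>
      (\<forall>b\<in>B. cinner n b x = cinner n b y) \<and> x \<noteq> y" for j
    using neg[simplified, rule_format, of "1 / real (Suc j)"] by auto
  then obtain X Y where XY: "\<And>j. X j \<in> S" "\<And>j. Y j \<in> S" "\<And>j. vdist n A (X j) < 1 / real (Suc j)"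
    "\<And>j. vdist n A (Y j) < 1 / real (Suc j)" "\<And>j b. b \<in> B \<Longrightarrow> cinner n b (X j) = cinner n b (Y j)" "\<And>j. X j \<noteq> Y j" by metis
  define t where "t = (\<lambda>j. vdist n (X j) (Y j))"
  have c: "X j \<in> carrier_vec n" "Y j \<in> carrier_vec n" for j using XY S by auto
  have t: "t j > 0" for j using vdist_eq_0[OF c, of j j] XY(6)[of j] vdist_nonneg[of n "X j" "Y j"]
    by (simp add: t_def less_le)
  define E where "E = (\<lambda>j i. (X j $ i - Y j $ i) / of_real (t j))"
  have "norm (E j i) \<le> 1" if "i < n" for i j
    using norm_coord_diff_le[OF that, of "X j" "Y j"] t[of j] by (simp add: E_def norm_divide t_def)
  then have "bounded (range (\<lambda>j. E j i))" if "i < n" for i using that by (auto simp: bounded_iff)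
  then obtain r l where r: "strict_mono (r :: nat \<Rightarrow> nat)" and l: "\<And>i. i < n \<Longrightarrow> (\<lambda>j. E (r j) i) \<longlonglongrightarrow> l i"
    using bounded_coordinates_subsequence[of n E] by blast
  define v where "v = vec n l"
  have vc: "v \<in> carrier_vec n" by (simp add: v_def)
  have lin: "(\<lambda>j. \<Sum>i<n. a i * E (r j) i) \<longlonglongrightarrow> (\<Sum>i<n. a i * v $ i)" for a
    by (intro tendsto_intros) (use l in \<open>auto simp: v_def\<close>)
  have v0: "v = 0\<^sub>v n"
  proof (rule tangent[OF vc])
    fix b assume b: "b \<in> B"
    have "(\<Sum>i<n. conjugate (b $ i) * E (r j) i) = (cinner n b (X (r j)) - cinner n b (Y (r j))) / of_real (t (r j))" for j
      by (simp add: cinner_def E_def algebra_simps sum_subtractf diff_divide_distrib sum_divide_distrib)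
    then have "(\<Sum>i<n. conjugate (b $ i) * E (r j) i) = 0" for j using XY(5)[OF b] by simp
    then show "cinner n b v = 0" using lin[of "\<lambda>i. conjugate (b $ i)"] by (simp add: LIMSEQ_const_iff cinner_def)
  next
    fix f assume f: "f \<in> I"
    have "(\<lambda>j. \<Sum>i<n. g f i * E (r j) i) \<longlonglongrightarrow> 0"
    proof (rule LIMSEQ_I)
      fix e :: real assume e: "e > 0"
      then obtain \<delta> where \<delta>: "\<delta> > 0" "\<And>x y. x \<in> carrier_vec n \<Longrightarrow> y \<in> carrier_vec n \<Longrightarrow> vdist n A x < \<delta> \<Longrightarrow> vdist n A y < \<delta> \<Longrightarrow>
        norm (f x - f y - (\<Sum>i<n. g f i * (x - y) $ i)) \<le> e / 2 * vdist n x y"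
        using strictly_diffD[OF g[OF f] half_gt_zero[OF e]] by blast
      obtain k where k: "1 / real (Suc k) < \<delta>" using nat_approx_posE[OF \<delta>(1)] by blast
      have "norm ((\<Sum>i<n. g f i * E (r j) i) - 0) < e" if j: "j \<ge> k" for j
      proof -
        have "1 / real (Suc (r j)) \<le> 1 / real (Suc k)"
          using seq_suble[OF r, of j] j by (intro divide_left_mono) auto
        then have d: "vdist n A (X (r j)) < \<delta>" "vdist n A (Y (r j)) < \<delta>"
          using XY(3)[of "r j"] XY(4)[of "r j"] k by auto
        have "norm (f (X (r j)) - f (Y (r j)) - (\<Sum>i<n. g f i * (X (r j) - Y (r j)) $ i)) \<le> e / 2 * t (r j)"
          unfolding t_def by (rule \<delta>(2)[OF c d])
        then have "norm (\<Sum>i<n. g f i * (X (r j) - Y (r j)) $ i) \<le> e / 2 * t (r j)"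
          using I(2)[OF f XY(1)] I(2)[OF f XY(2)] by simp
        moreover have "(\<Sum>i<n. g f i * (X (r j) - Y (r j)) $ i) = of_real (t (r j)) * (\<Sum>i<n. g f i * E (r j) i)"
          unfolding sum_distrib_left by (intro sum.cong refl) (use t[of "r j"] c[of "r j"] in \<open>simp add: E_def\<close>)
        ultimately have "norm (\<Sum>i<n. g f i * E (r j) i) * t (r j) \<le> e / 2 * t (r j)"
          using t[of "r j"] by (simp add: norm_mult mult.commute)
        then have "norm (\<Sum>i<n. g f i * E (r j) i) \<le> e / 2" using t[of "r j"] by (simp only: mult_le_cancel_right_pos)
        then show ?thesis using e by simp
      qed
      then show "\<exists>no. \<forall>j\<ge>no. norm ((\<Sum>i<n. g f i * E (r j) i) - 0) < e" by blast
    qed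
    then show "(\<Sum>i<n. g f i * v $ i) = 0" using lin[of "g f"] LIMSEQ_unique by blast
  qed
  have "(\<Sum>i<n. (norm (E (r j) i))\<^sup>2) = 1" for j
  proof -
    have "(\<Sum>i<n. (norm (E (r j) i))\<^sup>2) = (\<Sum>i<n. (norm (X (r j) $ i - Y (r j) $ i))\<^sup>2) / (t (r j))\<^sup>2"
      using t[of "r j"] by (simp add: E_def norm_divide power_divide sum_divide_distrib)
    also have "(\<Sum>i<n. (norm (X (r j) $ i - Y (r j) $ i))\<^sup>2) = (t (r j))\<^sup>2"
      by (simp add: t_def vdist_def L2_set_def sum_nonneg)
    finally show ?thesis using t[of "r j"] by simp
  qed
  moreover have "(\<lambda>j. \<Sum>i<n. (norm (E (r j) i))\<^sup>2) \<longlonglongrightarrow> (\<Sum>i<n. (norm (l i))\<^sup>2)"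
    by (intro tendsto_intros) (use l in auto)
  ultimately have "(\<Sum>i<n. (norm (l i))\<^sup>2) = 1" by (simp add: LIMSEQ_const_iff)
  moreover have "l i = 0" if "i < n" for i using v0 that by (metis index_vec index_zero_vec(1) v_def)
  ultimately show False by simp
qed

lemma cinner_lipschitz: "norm (cinner n b x - cinner n b y) \<le> (\<Sum>i<n. norm (b $ i)) * vdist n x (y :: 'a::rc_field vec)"
proof -
  have "cinner n b x - cinner n b y = (\<Sum>i<n. conjugate (b $ i) * (x $ i - y $ i))"
    by (simp add: cinner_def algebra_simps sum_subtractf)
  also have "norm \<dots> \<le> (\<Sum>i<n. norm (b $ i) * vdist n x y)"
    by (rule sum_norm_le) (auto simp: norm_mult intro!: mult_left_mono norm_coord_diff_le)
  finally show ?thesis by (simp add: sum_distrib_right)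
qed

text \<open>At a regular point the Zariski tangent space \<open>W\<close> has dimension at most N.
  Inner products with a spanning set of \<open>W\<close> separate the points of \<open>sigma\<close>
  near A, because a vector of \<open>W\<close> orthogonal to \<open>W\<close> is 0; padded with
  zeros they form a Lipschitz map to C^N.\<close>

lemma complex_regular_locally_embeds:
  assumes d: "length ns \<ge> 1" and ns: "\<forall>n\<in>set ns. n \<ge> 1"
    and A: "A \<in> complex_regular (prod_list ns) (sigma ns r)"
  shows "locally_embeds (prod_list ns) (sigma ns r) A (r * (Sigma_dim ns + 1))"
proof -
  let ?n = "prod_list ns" and ?N = "r * (Sigma_dim ns + 1)" and ?S = "sigma ns r :: complex vec set"
  let ?V = "zariski_closure ?n ?S"
  define W where "W = zariski_tangent ?n ?V A"
  define I where "I = {f \<in> poly_fun ?n. \<forall>y\<in>?V. f y = 0}"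
  have S: "?S \<subseteq> carrier_vec ?n" by (auto simp: sigma_def)
  have SV: "?S \<subseteq> ?V" by (auto simp: zariski_closure_def)
  have AS: "A \<in> ?S" using A by (simp add: complex_regular_def)
  then have Ac: "A \<in> carrier_vec ?n" using S by auto
  have "enat (subspace_dim ?n W) = variety_dim ?n ?V" using A by (simp add: complex_regular_def W_def)
  then have dimW: "subspace_dim ?n W \<le> ?N"
    using variety_dim_zariski_closure_sigma[OF d ns, of r] by (metis enat_ord_simps(1))
  have "\<forall>f\<in>I. \<exists>g. strictly_diff ?n f A (\<lambda>v. \<Sum>i<?n. g i * v $ i)" using poly_fun_strictly_diff[OF _ Ac] by (auto simp: I_def)
  then obtain g where g: "\<And>f. f \<in> I \<Longrightarrow> strictly_diff ?n f A (\<lambda>v. \<Sum>i<?n. g f i * v $ i)" by metis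
  have W_eq: "W = {v \<in> carrier_vec ?n. \<forall>f\<in>I. (\<Sum>i<?n. g f i * v $ i) = 0}"
  proof -
    have "((\<lambda>t. f (A + t \<cdot>\<^sub>v v)) has_field_derivative 0) (at 0) \<longleftrightarrow> (\<Sum>i<?n. g f i * v $ i) = 0"
      if f: "f \<in> I" and v: "v \<in> carrier_vec ?n" for f v
    proof -
      have "((\<lambda>t. f (A + t \<cdot>\<^sub>v v)) has_field_derivative (\<Sum>i<?n. g f i * v $ i)) (at 0)"
        by (rule strictly_diff_has_field_derivative[OF g[OF f] Ac v]) (use v in \<open>simp add: sum_distrib_left mult_ac\<close>)
      then show ?thesis using DERIV_unique by fastforce
    qed
    then show ?thesis unfolding W_def zariski_tangent_def by (auto simp: I_def)
  qed
  have "\<exists>B. finite B \<and> card B = subspace_dim ?n W \<and> B \<subseteq> W \<and> (\<forall>v\<in>W. \<exists>a. \<forall>i<?n. v $ i = (\<Sum>b\<in>B. a b * b $ i))"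
    by (rule subspace_spanning_set) (auto simp: W_eq sum.distrib distrib_left mult.left_commute simp flip: sum_distrib_left)
  then obtain B where B: "finite B" "card B = subspace_dim ?n W" "B \<subseteq> W"
    "\<And>v. v \<in> W \<Longrightarrow> \<exists>a. \<forall>i<?n. v $ i = (\<Sum>b\<in>B. a b * b $ i)" by blast
  have "\<exists>\<delta>>0. \<forall>x\<in>?S. \<forall>y\<in>?S. vdist ?n A x < \<delta> \<longrightarrow> vdist ?n A y < \<delta> \<longrightarrow> (\<forall>b\<in>B. cinner ?n b x = cinner ?n b y) \<longrightarrow> x = y"
  proof (rule locally_injective_of_tangent[OF S AS, where I = I and g = g])
    fix v assume v: "v \<in> carrier_vec ?n" "\<And>f. f \<in> I \<Longrightarrow> (\<Sum>i<?n. g f i * v $ i) = 0" "\<And>b. b \<in> B \<Longrightarrow> cinner ?n b v = 0"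
    then have "v \<in> W" by (simp add: W_eq)
    then obtain a where a: "\<And>i. i < ?n \<Longrightarrow> v $ i = (\<Sum>b\<in>B. a b * b $ i)" using B(4) by blast
    \<comment> \<open>v lies in the span of \<open>B\<close> and is orthogonal to \<open>B\<close>,
      so its inner product with itself is 0.\<close>
    have "cinner ?n v v = (\<Sum>i<?n. \<Sum>b\<in>B. conjugate (a b) * (conjugate (b $ i) * v $ i))"
      unfolding cinner_def
    proof (intro sum.cong refl)
      fix i assume "i \<in> {..<?n}"
      then have "conjugate (v $ i) = (\<Sum>b\<in>B. conjugate (a b) * conjugate (b $ i))"
        using a[of i] by (simp add: sum_conjugate[OF B(1)] conjugate_dist_mul)
      then show "conjugate (v $ i) * v $ i = (\<Sum>b\<in>B. conjugate (a b) * (conjugate (b $ i) * v $ i))"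
        by (simp add: sum_distrib_right mult.assoc)
    qed
    also have "\<dots> = (\<Sum>b\<in>B. conjugate (a b) * cinner ?n b v)" by (subst sum.swap) (simp add: cinner_def sum_distrib_left)
    also have "\<dots> = 0" using v(3) by simp
    finally show "v = 0\<^sub>v ?n" using sqnorm_eq_0[OF v(1)] by (simp add: cinner_self)
  qed (use SV B g in \<open>auto simp: I_def W_eq\<close>)
  then obtain \<delta> where \<delta>: "\<delta> > 0" "\<And>x y. x \<in> ?S \<Longrightarrow> y \<in> ?S \<Longrightarrow> vdist ?n A x < \<delta> \<Longrightarrow> vdist ?n A y < \<delta> \<Longrightarrow>
      (\<And>b. b \<in> B \<Longrightarrow> cinner ?n b x = cinner ?n b y) \<Longrightarrow> x = y" by blast
  obtain bs where bs: "set bs = B" "length bs = card B" using finite_distinct_list[OF B(1)] distinct_card by metis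
  define h where "h = (\<lambda>x. vec ?N (\<lambda>i. if i < length bs then cinner ?n (bs ! i) x else 0))"
  define K where "K = (\<Sum>b\<in>B. \<Sum>i<?n. norm (b $ i))"
  have K: "K \<ge> 0" by (simp add: K_def sum_nonneg)
  have lip: "vdist ?N (h x) (h y) \<le> real ?N * (K * vdist ?n x y)" for x y
  proof (rule vdist_leI)
    fix i assume i: "i < ?N"
    show "norm (h x $ i - h y $ i) \<le> K * vdist ?n x y"
    proof (cases "i < length bs")
      case True
      then have b: "bs ! i \<in> B" using bs by auto
      have "(\<Sum>q<?n. norm (bs ! i $ q)) \<le> K"
        unfolding K_def using member_le_sum[of "bs ! i" B "\<lambda>b. \<Sum>q<?n. norm (b $ q)"] b B(1) by (simp add: sum_nonneg)
      then show ?thesis using i True cinner_lipschitz[of ?n "bs ! i" x y]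
        by (simp add: h_def) (meson mult_right_mono order_trans vdist_nonneg)
    qed (use i K in \<open>simp add: h_def\<close>)
  qed
  show ?thesis unfolding locally_embeds_def
  proof (rule exI[of _ \<delta>], intro exI[of _ h] conjI ballI impI allI)
    fix x y assume xy: "x \<in> ?S" "y \<in> ?S" "vdist ?n A x < \<delta>" "vdist ?n A y < \<delta>" "h x = h y"
    show "x = y"
    proof (rule \<delta>(2)[OF xy(1-4)])
      fix b assume "b \<in> B"
      then obtain i where i: "i < length bs" "b = bs ! i" using bs(1) by (metis in_set_conv_nth)
      then have "i < ?N" using bs(2) B(2) dimW by simp
      then have "h x $ i = cinner ?n b x" "h y $ i = cinner ?n b y" using i by (auto simp: h_def)
      then show "cinner ?n b x = cinner ?n b y" using xy(5) by simp
    qed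
  next
    fix x and e :: real assume e: "e > 0"
    show "\<exists>d>0. \<forall>y\<in>?S. vdist ?n A y < \<delta> \<longrightarrow> vdist ?n x y < d \<longrightarrow> vdist ?N (h x) (h y) < e"
    proof (intro exI[of _ "e / (real ?N * K + 1)"] conjI ballI impI)
      have p: "real ?N * K + 1 > 0" using K by (simp add: add_nonneg_pos)
      then show "e / (real ?N * K + 1) > 0" using e by simp
      fix y assume y: "vdist ?n x y < e / (real ?N * K + 1)"
      have "vdist ?N (h x) (h y) \<le> (real ?N * K) * vdist ?n x y" using lip[of x y] by (simp only: mult.assoc)
      also have "\<dots> \<le> (real ?N * K + 1) * vdist ?n x y" by (intro mult_right_mono) auto
      also have "\<dots> < e" using y p by (simp add: field_simps)
      finally show "vdist ?N (h x) (h y) < e" .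
    qed
  qed (use \<delta> in \<open>auto simp: h_def\<close>)
qed

section \<open>Regular points of real semialgebraic sets\<close>

lemma poly_eval_cong: "(\<And>g. g \<in> set gs \<Longrightarrow> F g x = G g y) \<Longrightarrow> poly_eval (map F gs) s c x = poly_eval (map G gs) s c y"
  by (induction gs arbitrary: c) auto

text \<open>With the other variables fixed in the box, the polynomial in the first variable has
  infinitely many zeros, so its coefficients vanish; these are polynomials in the remaining
  variables on the same box.\<close>

lemma poly_eval_zero_on_box:
  fixes a :: "nat \<Rightarrow> real"
  assumes "distinct js" "\<eta> > 0" and "\<And>y. (\<And>i. \<bar>y i - a i\<bar> < \<eta>) \<Longrightarrow> poly_eval (map (\<lambda>i y. y i) js) s c y = 0"
    and "e \<in> exponents s (length js)"
  shows "c e = 0"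
  using assms
proof (induction js arbitrary: c e)
  case Nil
  have "poly_eval (map (\<lambda>i y. y i) []) s c a = 0" using Nil.prems(3)[of a] Nil.prems(2) by simp
  then show ?case using Nil.prems(4) by simp
next
  case (Cons i js)
  have c0: "poly_eval (map (\<lambda>i y. y i) js) s (\<lambda>e. c (b # e)) y = 0" if b: "b \<le> s" and y: "\<And>i. \<bar>y i - a i\<bar> < \<eta>" for b y
  proof -
    define k where "k = (\<lambda>b. poly_eval (map (\<lambda>i y. y i) js) s (\<lambda>e. c (b # e)) y)"
    have "(\<Sum>b\<le>s. k b * t ^ b) = 0" if t: "t \<in> {a i - \<eta><..<a i + \<eta>}" for t
    proof -
      have "poly_eval (map (\<lambda>i y. y i) (i # js)) s c (y(i := t)) = 0"
        using t y by (intro Cons.prems(3)) (auto simp: abs_less_iff)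
      moreover have "poly_eval (map (\<lambda>i y. y i) js) s c' (y(i := t)) = poly_eval (map (\<lambda>i y. y i) js) s c' y" for c'
        by (rule poly_eval_cong) (use Cons.prems(1) in auto)
      ultimately show ?thesis by (simp add: k_def mult.commute)
    qed
    then have "{a i - \<eta><..<a i + \<eta>} \<subseteq> {z. (\<Sum>b\<le>s. k b * z ^ b) = 0}" by blast
    moreover have "infinite {a i - \<eta><..<a i + \<eta>}" using Cons.prems(2) by (simp add: infinite_Ioo)
    ultimately have "infinite {z. (\<Sum>b\<le>s. k b * z ^ b) = 0}" using infinite_super by blast
    then have "k b = 0" using b polyfun_finite_roots[of k s] by auto
    then show ?thesis by (simp add: k_def)
  qed
  obtain b e' where e: "e = b # e'" "b \<le> s" "e' \<in> exponents s (length js)"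
    using Cons.prems(4) by (auto simp: exponents_Suc)
  show ?case unfolding e(1)
    by (rule Cons.IH[where c = "\<lambda>e. c (b # e)", OF _ Cons.prems(2) _ e(3)]) (use Cons.prems(1) c0[OF e(2)] in auto)
qed

lemma openin_vec_topology:
  "openin (vec_topology n) U \<longleftrightarrow> U \<subseteq> carrier_vec n \<and> (\<forall>x\<in>U. \<exists>r>0. \<forall>y\<in>carrier_vec n. vdist n x y < r \<longrightarrow> y \<in> U)"
proof -
  interpret Metric_space "carrier_vec n" "vdist n :: 'a vec \<Rightarrow> 'a vec \<Rightarrow> real" by (rule Metric_space_vdist)
  have eq: "mball x r \<subseteq> U \<longleftrightarrow> (\<forall>y\<in>carrier_vec n. vdist n x y < r \<longrightarrow> y \<in> U)" if "x \<in> carrier_vec n" for x r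
    using that by auto
  show ?thesis
  proof (cases "U \<subseteq> carrier_vec n")
    case True
    have "(\<forall>x. x \<in> U \<longrightarrow> (\<exists>r>0. mball x r \<subseteq> U)) \<longleftrightarrow> (\<forall>x\<in>U. \<exists>r>0. \<forall>y\<in>carrier_vec n. vdist n x y < r \<longrightarrow> y \<in> U)"
      unfolding Ball_def[of U] by (intro all_cong1 imp_cong refl) (simp only: eq[OF subsetD[OF True]])
    then show ?thesis unfolding vec_topology_def openin_mtopology by simp
  qed (simp add: vec_topology_def openin_mtopology)
qed

lemma topspace_vec_topology [simp]: "topspace (vec_topology n) = carrier_vec n"
proof -
  interpret Metric_space "carrier_vec n" "vdist n :: 'a vec \<Rightarrow> 'a vec \<Rightarrow> real" by (rule Metric_space_vdist)
  show ?thesis unfolding vec_topology_def by simp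
qed

lemma continuous_map_vec_topologyD:
  assumes cm: "continuous_map (subtopology (vec_topology n) U) euclideanreal g"
    and U: "openin (vec_topology n) U" and x: "x \<in> U" and e: "e > 0"
  shows "\<exists>d>0. \<forall>y\<in>carrier_vec n. vdist n x y < d \<longrightarrow> y \<in> U \<and> \<bar>g y - g x\<bar> < e"
proof -
  have Uc: "U \<subseteq> carrier_vec n" using U by (simp add: openin_vec_topology)
  then have ts: "topspace (subtopology (vec_topology n) U) = U" by auto
  have "openin (subtopology (vec_topology n) U) {y \<in> U. g y \<in> ball (g x) e}"
    using openin_continuous_map_preimage[OF cm, of "ball (g x) e"] unfolding ts by simp
  then have "openin (vec_topology n) {y \<in> U. g y \<in> ball (g x) e}" using U by (rule openin_trans_full)
  moreover have "x \<in> {y \<in> U. g y \<in> ball (g x) e}" using x e by simp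
  ultimately obtain r where "r > 0" "\<forall>y\<in>carrier_vec n. vdist n x y < r \<longrightarrow> y \<in> {y \<in> U. g y \<in> ball (g x) e}"
    unfolding openin_vec_topology by blast
  then show ?thesis by (intro exI[of _ r]) (auto simp: dist_real_def abs_minus_commute)
qed

text \<open>On each edge of a path parallel to the axes the mean value theorem yields a partial
  derivative at a point near a; by continuity it is within \<open>e\<close> of its value at
  a.\<close>

lemma Ck_imp_strictly_diff:
  assumes g: "Ck n (Suc k) U g" and U: "openin (vec_topology n) U" and a: "a \<in> U"
  shows "\<exists>D. strictly_diff n g a (\<lambda>v. \<Sum>i<n. D i * v $ i)"
proof -
  obtain D where D: "\<And>i. i < n \<Longrightarrow> Ck n k U (D i)"
    "\<And>i x. i < n \<Longrightarrow> x \<in> U \<Longrightarrow> ((\<lambda>t. g (x + t \<cdot>\<^sub>v unit_vec n i)) has_real_derivative D i x) (at 0)"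
    using g by auto
  have Dc: "continuous_map (subtopology (vec_topology n) U) euclideanreal (D i)" if "i < n" for i
    using D(1)[OF that] by (cases k) auto
  have ac: "a \<in> carrier_vec n" using U a by (auto simp: openin_vec_topology)
  have "strictly_diff n g a (\<lambda>v. \<Sum>i<n. D i a * v $ i)"
    unfolding strictly_diff_def
  proof (intro conjI allI impI)
    show "\<exists>C\<ge>0. \<forall>x\<in>carrier_vec n. \<forall>y\<in>carrier_vec n. norm (\<Sum>i<n. D i a * (x - y) $ i) \<le> C * vdist n x y"
    proof (intro exI[of _ "\<Sum>i<n. \<bar>D i a\<bar>"] conjI ballI)
      fix x y :: "real vec" assume xy: "x \<in> carrier_vec n" "y \<in> carrier_vec n"
      have "norm (\<Sum>i<n. D i a * (x - y) $ i) \<le> (\<Sum>i<n. \<bar>D i a\<bar> * vdist n x y)"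
        by (rule sum_norm_le) (use xy norm_coord_diff_le[of _ n x y] in \<open>auto simp: abs_mult intro!: mult_left_mono\<close>)
      then show "norm (\<Sum>i<n. D i a * (x - y) $ i) \<le> (\<Sum>i<n. \<bar>D i a\<bar>) * vdist n x y" by (simp add: sum_distrib_right)
    qed (simp add: sum_nonneg)
    fix \<epsilon> :: real assume \<epsilon>: "\<epsilon> > 0"
    \<comment> \<open>Each of the n edges contributes an error of at most
      \<open>e * vdist n x y\<close>.\<close>
    define e where "e = \<epsilon> / (real n + 1)"
    have e: "e > 0" using \<epsilon> by (simp add: e_def)
    have "\<exists>d>0. \<forall>y\<in>carrier_vec n. vdist n a y < d \<longrightarrow> y \<in> U \<and> \<bar>D i y - D i a\<bar> < e" if "i < n" for i
      using continuous_map_vec_topologyD[OF Dc[OF that] U a e] .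
    then obtain d where d: "\<And>i. i < n \<Longrightarrow> d i > 0" "\<And>i y. i < n \<Longrightarrow> y \<in> carrier_vec n \<Longrightarrow> vdist n a y < d i \<Longrightarrow> y \<in> U \<and> \<bar>D i y - D i a\<bar> < e"
      by metis
    define \<rho> where "\<rho> = Min (insert 1 (d ` {..<n}))"
    have \<rho>: "\<rho> > 0" "\<And>i. i < n \<Longrightarrow> \<rho> \<le> d i" using d(1) by (auto simp: \<rho>_def Min_gr_iff)
    show "\<exists>\<delta>>0. \<forall>x\<in>carrier_vec n. \<forall>y\<in>carrier_vec n. vdist n a x < \<delta> \<longrightarrow> vdist n a y < \<delta> \<longrightarrow>
        norm (g x - g y - (\<Sum>i<n. D i a * (x - y) $ i)) \<le> \<epsilon> * vdist n x y"
    \<comment> \<open>Each coordinate of a point on the path lies between those of x and y, hence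
      within \<open>\<rho> / (real n + 1)\<close> of that of a; summed over n coordinates this stays
      below \<open>\<rho>\<close>.\<close>
    proof (intro exI[of _ "\<rho> / (real n + 1)"] conjI ballI impI)
      fix x y :: "real vec" assume xy: "x \<in> carrier_vec n" "y \<in> carrier_vec n" "vdist n a x < \<rho> / (real n + 1)" "vdist n a y < \<rho> / (real n + 1)"
      txt \<open>Walk from \<open>y\<close> to \<open>x\<close> along the coordinate axes.\<close>
      define w where "w = (\<lambda>k \<tau>. vec n (\<lambda>q. if q < k then x $ q else if q = k then y $ q + \<tau> * (x $ q - y $ q) else y $ q))"
      define z where "z = (\<lambda>k. vec n (\<lambda>q. if q < k then x $ q else y $ q))"
      have wc: "w k \<tau> \<in> carrier_vec n" for k \<tau> by (simp add: w_def)
      have near: "vdist n a (w k \<tau>) < \<rho>" if \<tau>: "0 \<le> \<tau>" "\<tau> \<le> 1" for k \<tau>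
      proof -
        define R where "R = \<rho> / (real n + 1)"
        have "norm (a $ q - w k \<tau> $ q) \<le> R" if q: "q < n" for q
        proof -
          have b: "\<bar>a $ q - x $ q\<bar> \<le> R" "\<bar>a $ q - y $ q\<bar> \<le> R"
            using norm_coord_diff_le[OF q, of a x] norm_coord_diff_le[OF q, of a y] xy by (auto simp: R_def)
          have "a $ q - (y $ q + \<tau> * (x $ q - y $ q)) = (1 - \<tau>) * (a $ q - y $ q) + \<tau> * (a $ q - x $ q)"
            by (simp add: algebra_simps)
          also have "\<bar>\<dots>\<bar> \<le> (1 - \<tau>) * (R) + \<tau> * (R)"
            using \<tau> b by (intro order_trans[OF abs_triangle_ineq] add_mono) (simp_all add: abs_mult mult_left_mono)
          finally have "\<bar>a $ q - (y $ q + \<tau> * (x $ q - y $ q))\<bar> \<le> R" by (simp add: algebra_simps)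
          then show ?thesis using b q by (cases "q = k") (auto simp: w_def)
        qed
        then have "vdist n a (w k \<tau>) \<le> real n * (\<rho> / (real n + 1))" unfolding R_def by (rule vdist_leI)
        also have "\<dots> < \<rho>" using \<rho>(1) by (simp add: field_simps)
        finally show ?thesis .
      qed
      have step: "\<bar>g (z (Suc k)) - g (z k) - D k a * (x $ k - y $ k)\<bar> \<le> e * vdist n x y" if k: "k < n" for k
      proof -
        have z: "z k = w k 0" "z (Suc k) = w k 1" using k by (auto simp: z_def w_def less_Suc_eq intro!: eq_vecI)
        have wU: "w k \<tau> \<in> U" "\<bar>D k (w k \<tau>) - D k a\<bar> < e" if "0 \<le> \<tau>" "\<tau> \<le> 1" for \<tau>
          using d(2)[OF k wc] near[OF that, of k] \<rho>(2)[OF k] by force+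
        have deriv: "((\<lambda>\<tau>. g (w k \<tau>)) has_real_derivative D k (w k \<tau>) * (x $ k - y $ k)) (at \<tau>)" if \<tau>: "0 \<le> \<tau>" "\<tau> \<le> 1" for \<tau>
        proof -
          have eq: "w k \<tau>' = w k \<tau> + ((\<tau>' - \<tau>) * (x $ k - y $ k)) \<cdot>\<^sub>v unit_vec n k" for \<tau>'
            using k by (intro eq_vecI) (auto simp: w_def algebra_simps)
          have "((\<lambda>t. g (w k \<tau> + t \<cdot>\<^sub>v unit_vec n k)) has_real_derivative D k (w k \<tau>)) (at ((\<tau> - \<tau>) * (x $ k - y $ k)))"
            using D(2)[OF k wU(1)[OF \<tau>]] by simp
          moreover have "((\<lambda>\<tau>'. (\<tau>' - \<tau>) * (x $ k - y $ k)) has_real_derivative (x $ k - y $ k)) (at \<tau>)"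
            by (auto intro!: derivative_eq_intros)
          ultimately have "((\<lambda>\<tau>'. g (w k \<tau> + ((\<tau>' - \<tau>) * (x $ k - y $ k)) \<cdot>\<^sub>v unit_vec n k)) has_real_derivative D k (w k \<tau>) * (x $ k - y $ k)) (at \<tau>)"
            by (rule DERIV_chain2)
          then show ?thesis by (simp only: eq[symmetric])
        qed
        obtain \<tau> where \<tau>: "0 < \<tau>" "\<tau> < 1" "g (w k 1) - g (w k 0) = (1 - 0) * (D k (w k \<tau>) * (x $ k - y $ k))"
          using MVT2[of 0 1 "\<lambda>\<tau>. g (w k \<tau>)" "\<lambda>\<tau>. D k (w k \<tau>) * (x $ k - y $ k)"] deriv by auto
        then have "g (z (Suc k)) - g (z k) - D k a * (x $ k - y $ k) = (D k (w k \<tau>) - D k a) * (x $ k - y $ k)"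
          by (simp add: z algebra_simps)
        also have "\<bar>\<dots>\<bar> \<le> e * vdist n x y"
          unfolding abs_mult using wU(2)[of \<tau>] \<tau> norm_coord_diff_le[OF k, of x y] e by (intro mult_mono) auto
        finally show ?thesis .
      qed
      have z0: "z 0 = y" "z n = x" using xy by (auto simp: z_def intro!: eq_vecI)
      have "g x - g y - (\<Sum>i<n. D i a * (x - y) $ i) = (\<Sum>k<n. g (z (Suc k)) - g (z k) - D k a * (x $ k - y $ k))"
      proof -
        have "(\<Sum>k<n. g (z (Suc k)) - g (z k)) = g x - g y" using sum_lessThan_telescope[of "\<lambda>k. g (z k)" n] z0 by simp
        then show ?thesis using xy by (simp add: sum_subtractf)
      qed
      also have "norm \<dots> \<le> (\<Sum>k<n. e * vdist n x y)" by (rule sum_norm_le) (use step in auto)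
      also have "\<dots> = real n * e * vdist n x y" by simp
      also have "\<dots> \<le> \<epsilon> * vdist n x y" using \<epsilon> by (intro mult_right_mono) (auto simp: e_def field_simps)
      finally show "norm (g x - g y - (\<Sum>i<n. D i a * (x - y) $ i)) \<le> \<epsilon> * vdist n x y" .
    qed (use \<rho> in auto)
  qed
  then show ?thesis by (rule exI[of _ "\<lambda>i. D i a"])
qed

lemma mult_divide_add_one_less: "0 < e \<Longrightarrow> real N * (e / (real N + 1)) < e"
  by (simp add: field_simps)

lemma strictly_diff_lipschitz_ex:
  assumes "strictly_diff n h a L"
  shows "\<exists>C \<delta>. C \<ge> 0 \<and> \<delta> > 0 \<and> (\<forall>x\<in>carrier_vec n. \<forall>y\<in>carrier_vec n. vdist n a x < \<delta> \<longrightarrow> vdist n a y < \<delta> \<longrightarrow>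
        norm (h x - h y) \<le> C * vdist n x y)"
proof -
  obtain C \<delta> where "C \<ge> 0" "\<delta> > 0" "\<And>x y. x \<in> carrier_vec n \<Longrightarrow> y \<in> carrier_vec n \<Longrightarrow> vdist n a x < \<delta> \<Longrightarrow> vdist n a y < \<delta> \<Longrightarrow>
        norm (h x - h y) \<le> C * vdist n x y" using strictly_diff_lipschitz[OF assms] by blast
  then show ?thesis by (intro exI[of _ C] exI[of _ \<delta>] conjI ballI impI)
qed

lemma nash_map_component:
  assumes "nash_map n m U \<phi>" "i < m" "a \<in> U"
  shows "\<exists>D. strictly_diff n (\<lambda>x. \<phi> x $ i) a (\<lambda>v. \<Sum>q<n. D q * v $ q)"
    "continuous_map (subtopology (vec_topology n) U) euclideanreal (\<lambda>x. \<phi> x $ i)"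
proof -
  have ck: "Ck n k U (\<lambda>x. \<phi> x $ i)" for k using assms by (simp add: nash_map_def)
  show "\<exists>D. strictly_diff n (\<lambda>x. \<phi> x $ i) a (\<lambda>v. \<Sum>q<n. D q * v $ q)"
    by (rule Ck_imp_strictly_diff[OF ck[of "Suc 0"]]) (use assms in \<open>auto simp: nash_map_def\<close>)
  show "continuous_map (subtopology (vec_topology n) U) euclideanreal (\<lambda>x. \<phi> x $ i)"
    using ck[of 0] by simp
qed

text \<open>A chart of dimension larger than \<open>N\<close> would carry \<open>N + 1\<close> linear forms whose joint image has interior,
  so these forms could not be algebraically dependent.\<close>

lemma submanifold_dim_le:
  assumes chart: "nash_diffeo n U V \<phi>" "0\<^sub>v n \<in> U" and mn: "m \<le> n"
    and S: "\<And>y. y \<in> U \<Longrightarrow> (\<And>i. i \<in> {m..<n} \<Longrightarrow> y $ i = 0) \<Longrightarrow> \<phi> y \<in> S"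
    and dep: "\<And>gs :: (real vec \<Rightarrow> real) list. set gs \<subseteq> poly_fun n \<Longrightarrow> N < length gs \<Longrightarrow>
        \<exists>s c. (\<exists>e\<in>exponents s (length gs). c e \<noteq> 0) \<and> (\<forall>A\<in>S. poly_eval gs s c A = 0)"
  shows "m \<le> N"
proof (rule ccontr)
  assume "\<not> m \<le> N"
  \<comment> \<open>One more than N: this many chart coordinates already give a
    contradiction.\<close>
  define K where "K = Suc N"
  have K: "K \<le> m" "K \<le> n" using \<open>\<not> m \<le> N\<close> mn by (auto simp: K_def)
  have K0: "real K > 0" by (simp add: K_def)
  define \<psi> where "\<psi> = inv_into U \<phi>"
  have bij: "bij_betw \<phi> U V" and \<phi>: "nash_map n n U \<phi>" and \<psi>: "nash_map n n V \<psi>"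
    using chart by (auto simp: nash_diffeo_def \<psi>_def)
  have Uc: "U \<subseteq> carrier_vec n" and Uo: "openin (vec_topology n) U" using \<phi> by (auto simp: nash_map_def openin_vec_topology)
  have \<phi>c: "\<phi> x \<in> carrier_vec n" if "x \<in> U" for x using \<phi> that by (auto simp: nash_map_def)
  have \<psi>\<phi>: "\<psi> (\<phi> x) = x" if "x \<in> U" for x using bij that by (simp add: \<psi>_def bij_betw_def inv_into_f_f)
  have V0: "\<phi> (0\<^sub>v n) \<in> V" using bij chart(2) by (auto simp: bij_betw_def)
  let ?a = "\<phi> (0\<^sub>v n)"
  have "\<exists>C \<delta>. C \<ge> 0 \<and> \<delta> > 0 \<and> (\<forall>x\<in>carrier_vec n. \<forall>y\<in>carrier_vec n. vdist n (0\<^sub>v n) x < \<delta> \<longrightarrow> vdist n (0\<^sub>v n) y < \<delta> \<longrightarrow>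
      norm (\<phi> x $ i - \<phi> y $ i) \<le> C * vdist n x y)" if i: "i < n" for i
  proof -
    obtain D where "strictly_diff n (\<lambda>x. \<phi> x $ i) (0\<^sub>v n) (\<lambda>v. \<Sum>q<n. D q * v $ q)"
      using nash_map_component(1)[OF \<phi> i chart(2)] by blast
    from strictly_diff_lipschitz_ex[OF this] show ?thesis .
  qed
  then obtain C \<delta> where C: "\<And>i. i < n \<Longrightarrow> C i \<ge> 0" "\<And>i. i < n \<Longrightarrow> \<delta> i > (0::real)"
    "\<And>i x y. i < n \<Longrightarrow> x \<in> carrier_vec n \<Longrightarrow> y \<in> carrier_vec n \<Longrightarrow> vdist n (0\<^sub>v n) x < \<delta> i \<Longrightarrow> vdist n (0\<^sub>v n) y < \<delta> i \<Longrightarrow>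
      norm (\<phi> x $ i - \<phi> y $ i) \<le> C i * vdist n x y" by metis
  define B where "B = (\<Sum>i<n. C i) + 1"
  have B: "B > 0" "\<And>i. i < n \<Longrightarrow> C i \<le> B"
  proof -
    show "B > 0" unfolding B_def by (intro add_nonneg_pos sum_nonneg) (use C(1) in auto)
    show "C i \<le> B" if "i < n" for i using member_le_sum[of i "{..<n}" C] that C(1) by (simp add: B_def)
  qed
  define \<rho>1 where "\<rho>1 = Min (insert 1 (\<delta> ` {..<n}))"
  have \<rho>1: "\<rho>1 > 0" "\<And>i. i < n \<Longrightarrow> \<rho>1 \<le> \<delta> i" using C(2) by (auto simp: \<rho>1_def Min_gr_iff)
  have lip: "vdist n (\<phi> x) (\<phi> y) \<le> real n * (B * vdist n x y)"
    if "x \<in> carrier_vec n" "y \<in> carrier_vec n" "vdist n (0\<^sub>v n) x < \<rho>1" "vdist n (0\<^sub>v n) y < \<rho>1" for x y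
  proof (rule vdist_leI)
    fix i assume i: "i < n"
    have "norm (\<phi> x $ i - \<phi> y $ i) \<le> C i * vdist n x y" using \<rho>1(2)[OF i] that by (intro C(3)[OF i]) auto
    also have "\<dots> \<le> B * vdist n x y" by (intro mult_right_mono B(2) i) simp
    finally show "norm (\<phi> x $ i - \<phi> y $ i) \<le> B * vdist n x y" .
  qed
  \<comment> \<open>Absorbs the Lipschitz factor \<open>real n * B\<close> of \<phi> and leaves the
    error \<open>1 / (2 * real K)\<close> in each coordinate of \<open>G\<close>.\<close>
  define \<epsilon> where "\<epsilon> = 1 / (2 * real K * (real n + 1) * B)"
  have \<epsilon>: "\<epsilon> > 0" using B(1) by (simp add: \<epsilon>_def K_def)
  have "\<forall>i. \<exists>D. i < n \<longrightarrow> strictly_diff n (\<lambda>x. \<psi> x $ i) ?a (\<lambda>v. \<Sum>q<n. D q * v $ q)"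
    using nash_map_component(1)[OF \<psi> _ V0] by blast
  then obtain D where D: "\<And>i. i < n \<Longrightarrow> strictly_diff n (\<lambda>x. \<psi> x $ i) ?a (\<lambda>v. \<Sum>q<n. D i q * v $ q)" by metis
  \<comment> \<open>The derivatives at \<open>?a\<close> of the coordinates of the inverse chart
    \<psi>; the first K of them are the linear forms.\<close>
  define L where "L = (\<lambda>i v. \<Sum>q<n. D i q * (v :: real vec) $ q)"
  have L_diff: "L i (x - y) = L i x - L i y" if "x \<in> carrier_vec n" "y \<in> carrier_vec n" for i x y
    using that by (simp add: L_def algebra_simps sum_subtractf)
  have "\<exists>\<delta>>0. \<forall>x\<in>carrier_vec n. \<forall>y\<in>carrier_vec n. vdist n ?a x < \<delta> \<longrightarrow> vdist n ?a y < \<delta> \<longrightarrow>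
        norm (\<psi> x $ i - \<psi> y $ i - L i (x - y)) \<le> \<epsilon> * vdist n x y" if "i < n" for i
    using D[OF that] \<epsilon> unfolding strictly_diff_def L_def by blast
  then obtain \<eta> where \<eta>: "\<And>i. i < n \<Longrightarrow> \<eta> i > 0" "\<And>i x y. i < n \<Longrightarrow> x\<in>carrier_vec n \<Longrightarrow> y\<in>carrier_vec n \<Longrightarrow> vdist n ?a x < \<eta> i \<Longrightarrow> vdist n ?a y < \<eta> i \<Longrightarrow>
        norm (\<psi> x $ i - \<psi> y $ i - L i (x - y)) \<le> \<epsilon> * vdist n x y" by metis
  define \<rho>2 where "\<rho>2 = Min (insert 1 (\<eta> ` {..<n}))"
  have \<rho>2: "\<rho>2 > 0" "\<And>i. i < n \<Longrightarrow> \<rho>2 \<le> \<eta> i" using \<eta>(1) by (auto simp: \<rho>2_def Min_gr_iff)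
  obtain \<rho>3 where \<rho>3: "\<rho>3 > 0" "\<And>y. y \<in> carrier_vec n \<Longrightarrow> vdist n (0\<^sub>v n) y < \<rho>3 \<Longrightarrow> y \<in> U"
    using Uo chart(2) unfolding openin_vec_topology by blast
  define \<rho> where "\<rho> = min (min \<rho>1 \<rho>3) (\<rho>2 / (real n * B + 1))"
  have nB: "real n * B + 1 > 0" using B(1) by (simp add: add_nonneg_pos)
  have \<rho>: "\<rho> > 0" using \<rho>1 \<rho>2 \<rho>3 nB by (simp add: \<rho>_def)
  define emb where "emb = (\<lambda>c. vec n (\<lambda>q. if q < K then (c :: real vec) $ q else 0))"
  have embc: "emb c \<in> carrier_vec n" for c by (simp add: emb_def)
  have emb_dist: "vdist n (emb c) (emb c') = vdist K c c'" for c c' :: "real vec"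
  proof -
    have "(\<Sum>i<n. (norm (emb c $ i - emb c' $ i))\<^sup>2) = (\<Sum>i<K. (norm (c $ i - c' $ i))\<^sup>2)"
      by (rule sum.mono_neutral_cong_right) (use K in \<open>auto simp: emb_def\<close>)
    then show ?thesis by (simp add: vdist_def L2_set_def)
  qed
  have emb0: "emb (0\<^sub>v K) = 0\<^sub>v n" by (intro eq_vecI) (auto simp: emb_def)
  define Bl where "Bl = {c \<in> carrier_vec K. vdist K (0\<^sub>v K) (c :: real vec) < \<rho>}"
  have near: "vdist n (0\<^sub>v n) (emb c) < \<rho>1" "emb c \<in> U" "vdist n ?a (\<phi> (emb c)) < \<rho>2" if "c \<in> Bl" for c
  proof -
    have e: "vdist n (0\<^sub>v n) (emb c) < \<rho>" using emb_dist[of "0\<^sub>v K" c] that emb0 by (simp add: Bl_def)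
    then show 1: "vdist n (0\<^sub>v n) (emb c) < \<rho>1" "emb c \<in> U" using \<rho>3(2)[OF embc] by (auto simp: \<rho>_def)
    have "vdist n ?a (\<phi> (emb c)) \<le> real n * (B * vdist n (0\<^sub>v n) (emb c))"
      by (rule lip) (use embc 1 \<rho>1 in auto)
    also have "\<dots> \<le> (real n * B + 1) * vdist n (0\<^sub>v n) (emb c)" by (simp add: algebra_simps)
    also have "\<dots> < (real n * B + 1) * (\<rho>2 / (real n * B + 1))"
      using e nB by (intro mult_strict_left_mono) (auto simp: \<rho>_def)
    also have "\<dots> = \<rho>2" using nB by simp
    finally show "vdist n ?a (\<phi> (emb c)) < \<rho>2" .
  qed
  \<comment> \<open>As \<psi> inverts \<phi>, \<open>G\<close> is the identity up to a map with
    Lipschitz constant at most 1/2, adding the error over K coordinates. So it is injective, and its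
    image contains a ball.\<close>
  define G where "G = (\<lambda>c. vec K (\<lambda>i. L i (\<phi> (emb c))))"
  have Gdiff: "norm ((c $ i - c' $ i) - (G c $ i - G c' $ i)) \<le> vdist K c c' / (2 * real K)"
    if c: "c \<in> Bl" "c' \<in> Bl" and i: "i < K" for c c' i
  proof -
    have i': "i < n" using i K by simp
    have "norm (\<psi> (\<phi> (emb c)) $ i - \<psi> (\<phi> (emb c')) $ i - L i (\<phi> (emb c) - \<phi> (emb c'))) \<le> \<epsilon> * vdist n (\<phi> (emb c)) (\<phi> (emb c'))"
      using near[OF c(1)] near[OF c(2)] \<rho>2(2)[OF i'] by (intro \<eta>(2)[OF i']) (auto intro: \<phi>c)
    also have "\<dots> \<le> \<epsilon> * (real n * (B * vdist n (emb c) (emb c')))"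
      using \<epsilon> near[OF c(1)] near[OF c(2)] embc by (intro mult_left_mono lip) auto
    also have "\<dots> \<le> \<epsilon> * ((real n + 1) * (B * vdist n (emb c) (emb c')))"
      using \<epsilon> B(1) by (intro mult_left_mono mult_right_mono) auto
    also have "\<dots> = vdist K c c' / (2 * real K)"
    proof -
      have "1 / (2 * k * X * B) * (X * (B * w)) = w / (2 * k)" if "X \<noteq> 0" for k X w :: real
        using that B(1) by simp
      from this[of "real n + 1" "real K" "vdist K c c'"] show ?thesis unfolding \<epsilon>_def emb_dist
        by linarith
    qed
    finally show ?thesis
      using near[OF c(1)] near[OF c(2)] i i'
      by (simp add: \<psi>\<phi> L_diff \<phi>c G_def) (simp add: emb_def)
  qed
  have "\<exists>\<eta>>0. \<forall>y\<in>carrier_vec K. vdist K (G (0\<^sub>v K)) y < \<eta> \<longrightarrow> (\<exists>c\<in>Bl. G c = y)"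
    unfolding Bl_def
  proof (rule invariance_of_domain_vec[OF \<rho>], fold Bl_def)
    fix c and e :: real assume c: "c \<in> Bl" and e: "e > 0"
    show "\<exists>d>0. \<forall>c'\<in>Bl. vdist K c c' < d \<longrightarrow> vdist K (G c) (G c') < e"
    proof (intro exI[of _ "e / (real K * 2)"] conjI ballI impI)
      fix c' assume c': "c' \<in> Bl" "vdist K c c' < e / (real K * 2)"
      have "vdist K (G c) (G c') \<le> real K * (2 * vdist K c c')"
      proof (rule vdist_leI)
        fix i assume i: "i < K"
        have "vdist K c c' / (2 * real K) \<le> vdist K c c'"
        proof -
          have "vdist K c c' * 1 \<le> vdist K c c' * (2 * real K)" by (intro mult_left_mono) (auto simp: K_def)
          then show ?thesis by (simp add: K_def divide_le_eq)
        qed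
        then show "norm (G c $ i - G c' $ i) \<le> 2 * vdist K c c'"
          using Gdiff[OF c c'(1) i] norm_coord_diff_le[OF i, of c c'] by (simp add: abs_le_iff)
      qed
      also have "\<dots> < e" using c'(2) by (simp add: K_def field_simps)
      finally show "vdist K (G c) (G c') < e" .
    qed (use e in \<open>simp add: K_def\<close>)
  next
    show "inj_on G Bl"
    proof (rule inj_onI)
      fix c c' assume c: "c \<in> Bl" "c' \<in> Bl" "G c = G c'"
      have "vdist K c c' \<le> real K * (vdist K c c' / (2 * real K))"
        by (rule vdist_leI) (use Gdiff[OF c(1,2)] c(3) in simp)
      also have "\<dots> = vdist K c c' / 2" using K0 by simp
      finally have "vdist K c c' = 0" using vdist_nonneg[of K c c'] by linarith
      then show "c = c'" using c vdist_eq_0[of c K c'] by (simp add: Bl_def)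
    qed
  qed (simp add: G_def)
  then obtain \<tau> where \<tau>: "\<tau> > 0" "\<And>y. y \<in> carrier_vec K \<Longrightarrow> vdist K (G (0\<^sub>v K)) y < \<tau> \<Longrightarrow> \<exists>c\<in>Bl. G c = y" by blast
  define gs where "gs = map L [0..<K]"
  have "L i \<in> poly_fun n" for i
    unfolding L_def by (intro poly_fun_sum poly_fun.mult poly_fun.const poly_fun.coord) auto
  then have "set gs \<subseteq> poly_fun n" by (auto simp: gs_def)
  then obtain s co where co: "\<exists>e\<in>exponents s K. co e \<noteq> 0" "\<forall>A\<in>S. poly_eval gs s co A = 0"
    using dep[of gs] by (auto simp: gs_def K_def)
  have "co e = 0" if "e \<in> exponents s K" for e
  proof (rule poly_eval_zero_on_box[where a = "\<lambda>i. G (0\<^sub>v K) $ i" and \<eta> = "\<tau> / (real K + 1)" and js = "[0..<K]" and s = s])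
    fix y :: "nat \<Rightarrow> real" assume y: "\<And>i. \<bar>y i - G (0\<^sub>v K) $ i\<bar> < \<tau> / (real K + 1)"
    have "vdist K (G (0\<^sub>v K)) (vec K y) \<le> real K * (\<tau> / (real K + 1))"
      by (rule vdist_leI) (use y in \<open>simp add: abs_minus_commute less_imp_le\<close>)
    also have "\<dots> < \<tau>" using \<tau>(1) by (simp add: field_simps)
    finally obtain c where c: "c \<in> Bl" "G c = vec K y" using \<tau>(2)[of "vec K y"] by auto
    have "\<phi> (emb c) \<in> S" by (rule S[OF near(2)[OF c(1)]]) (use K in \<open>auto simp: emb_def\<close>)
    then have "poly_eval gs s co (\<phi> (emb c)) = 0" using co(2) by blast
    moreover have "poly_eval gs s co (\<phi> (emb c)) = poly_eval (map (\<lambda>i y. y i) [0..<K]) s co y"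
      unfolding gs_def
    proof (rule poly_eval_cong)
      fix i assume "i \<in> set [0..<K]"
      then have i: "i < K" by simp
      have "L i (\<phi> (emb c)) = G c $ i" using i by (simp add: G_def)
      then show "L i (\<phi> (emb c)) = y i" using i by (simp add: c(2))
    qed
    ultimately show "poly_eval (map (\<lambda>i y. y i) [0..<K]) s co y = 0" by simp
  qed (use \<tau>(1) that in auto)
  then show False using co(1) by blast
qed

lemma in_closure_of_vec_topology:
  assumes "x \<notin> Abstract_Topology.closure_of (vec_topology n) M" "x \<in> carrier_vec n" "M \<subseteq> carrier_vec n"
  shows "\<exists>r>0. \<forall>y\<in>M. r \<le> vdist n x y"
proof -
  have "openin (vec_topology n) (carrier_vec n - Abstract_Topology.closure_of (vec_topology n) M)"
    using openin_diff[OF openin_topspace closedin_closure_of, of "vec_topology n"] by simp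
  then obtain r where r: "r > 0" "\<And>y. y \<in> carrier_vec n \<Longrightarrow> vdist n x y < r \<Longrightarrow> y \<notin> Abstract_Topology.closure_of (vec_topology n) M"
    using assms(1,2) unfolding openin_vec_topology by blast
  have "M \<subseteq> Abstract_Topology.closure_of (vec_topology n) M" by (rule closure_of_subset) (use assms(3) in simp)
  then show ?thesis using r assms(3) by (intro exI[of _ r]) (meson not_le subsetD)
qed

text \<open>If A were in the closure of another stratum, the frontier condition would give that
  stratum a dimension above the maximum. So near A the set coincides with the stratum M, whose
  dimension is at most N, and the inverse chart is the embedding.\<close>

lemma real_regular_locally_embeds:
  assumes d: "length ns \<ge> 1" and ns: "\<forall>n\<in>set ns. n \<ge> 1"
    and A: "A \<in> real_regular (prod_list ns) (sigma ns r)"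
  shows "locally_embeds (prod_list ns) (sigma ns r) A (r * (Sigma_dim ns + 1))"
proof -
  let ?n = "prod_list ns" and ?N = "r * (Sigma_dim ns + 1)" and ?S = "sigma ns r :: real vec set"
  have S: "?S \<subseteq> carrier_vec ?n" by (auto simp: sigma_def)
  obtain \<M> \<delta> M where st: "nash_stratification ?n ?S \<M> \<delta>" and M: "M \<in> \<M>" "A \<in> M" "\<And>M'. M' \<in> \<M> \<Longrightarrow> \<delta> M' \<le> \<delta> M"
    using A by (auto simp: real_regular_def)
  have fin: "finite \<M>" and part: "partition_on ?S \<M>" and sub: "nash_submanifold ?n (\<delta> M) M"
    and fr: "\<And>M M'. M \<in> \<M> \<Longrightarrow> M' \<in> \<M> \<Longrightarrow> M \<noteq> M' \<Longrightarrow> M \<inter> Abstract_Topology.closure_of (vec_topology ?n) M' \<noteq> {} \<Longrightarrow> \<delta> M < \<delta> M'"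
    using st M(1) unfolding nash_stratification_def by blast+
  have US: "\<Union>\<M> = ?S" using part by (simp add: partition_on_def)
  have Ac: "A \<in> carrier_vec ?n" using M US S by blast
  have "\<exists>r>0. \<forall>y\<in>M'. r \<le> vdist ?n A y" if M': "M' \<in> \<M>" "M' \<noteq> M" for M'
  proof (rule in_closure_of_vec_topology[OF _ Ac])
    show "A \<notin> Abstract_Topology.closure_of (vec_topology ?n) M'"
      using fr[OF M(1) M'(1)] M(3)[OF M'(1)] M'(2) M(2) by fastforce
    show "M' \<subseteq> carrier_vec ?n" using M'(1) US S by blast
  qed
  then obtain R where R: "\<And>M'. M' \<in> \<M> \<Longrightarrow> M' \<noteq> M \<Longrightarrow> R M' > 0" "\<And>M' y. M' \<in> \<M> \<Longrightarrow> M' \<noteq> M \<Longrightarrow> y \<in> M' \<Longrightarrow> R M' \<le> vdist ?n A y"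
    by metis
  define r0 where "r0 = Min (insert 1 (R ` (\<M> - {M})))"
  have r0: "r0 > 0" "\<And>M'. M' \<in> \<M> \<Longrightarrow> M' \<noteq> M \<Longrightarrow> r0 \<le> R M'" using R(1) fin by (auto simp: r0_def Min_gr_iff)
  have SM: "x \<in> M" if x: "x \<in> ?S" "vdist ?n A x < r0" for x
  proof -
    obtain M' where M': "M' \<in> \<M>" "x \<in> M'" using x(1) US by blast
    show ?thesis
    proof (cases "M' = M")
      case False
      then show ?thesis using R(2)[OF M'(1) False M'(2)] r0(2)[OF M'(1) False] x(2) by simp
    qed (use M' in simp)
  qed
  define m where "m = \<delta> M"
  obtain U V \<phi> where diff: "nash_diffeo ?n U V \<phi>" and U0: "0\<^sub>v ?n \<in> U" and AV: "A \<in> V" "\<phi> (0\<^sub>v ?n) = A"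
    and im: "\<phi> ` {y \<in> U. \<forall>i\<in>{m..<?n}. y $ i = 0} = M \<inter> V" and mn: "m \<le> ?n"
    using sub M(2) unfolding nash_submanifold_def m_def by blast
  define \<psi> where "\<psi> = inv_into U \<phi>"
  have bij: "bij_betw \<phi> U V" and \<phi>: "nash_map ?n ?n U \<phi>" and \<psi>: "nash_map ?n ?n V \<psi>"
    using diff by (auto simp: nash_diffeo_def \<psi>_def)
  have Uc: "U \<subseteq> carrier_vec ?n" and Vo: "openin (vec_topology ?n) V" using \<phi> \<psi> by (auto simp: nash_map_def openin_vec_topology)
  have \<psi>\<phi>: "\<psi> (\<phi> x) = x" if "x \<in> U" for x using bij that by (simp add: \<psi>_def bij_betw_def inv_into_f_f)
  have mN: "m \<le> ?N"
  proof (rule submanifold_dim_le[OF diff U0 mn])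
    fix y assume "y \<in> U" "\<And>i. i \<in> {m..<?n} \<Longrightarrow> y $ i = 0"
    then show "\<phi> y \<in> ?S" using im M(1) US by blast
  qed (rule sigma_algebraically_dependent[OF d ns])
  obtain r1 where r1: "r1 > 0" "\<And>y. y \<in> carrier_vec ?n \<Longrightarrow> vdist ?n A y < r1 \<Longrightarrow> y \<in> V"
    using Vo AV(1) unfolding openin_vec_topology by blast
  define \<rho> where "\<rho> = min r0 r1"
  have loc: "\<exists>u\<in>U. (\<forall>i\<in>{m..<?n}. u $ i = 0) \<and> x = \<phi> u" "x \<in> V" if x: "x \<in> ?S" "vdist ?n A x < \<rho>" for x
  proof -
    show "x \<in> V" using r1(2)[of x] S x by (auto simp: \<rho>_def)
    then have "x \<in> M \<inter> V" using SM[of x] x by (simp add: \<rho>_def)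
    then show "\<exists>u\<in>U. (\<forall>i\<in>{m..<?n}. u $ i = 0) \<and> x = \<phi> u" unfolding im[symmetric] by blast
  qed
  \<comment> \<open>The chart coordinates from m on vanish on M near A, and m \<le> N, so truncating
    or padding to length N loses nothing.\<close>
  define h where "h = (\<lambda>x. vec ?N (\<lambda>i. if i < ?n then \<psi> x $ i else 0))"
  show ?thesis unfolding locally_embeds_def
  proof (rule exI[of _ \<rho>], intro exI[of _ h] conjI ballI impI allI)
    fix x y assume xy: "x \<in> ?S" "y \<in> ?S" "vdist ?n A x < \<rho>" "vdist ?n A y < \<rho>" "h x = h y"
    obtain u where u: "u \<in> U" "\<forall>i\<in>{m..<?n}. u $ i = 0" "x = \<phi> u" using loc(1)[OF xy(1,3)] by blast
    obtain w where w: "w \<in> U" "\<forall>i\<in>{m..<?n}. w $ i = 0" "y = \<phi> w" using loc(1)[OF xy(2,4)] by blast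
    have "u $ i = w $ i" if i: "i < ?n" for i
    proof (cases "i < m")
      case True
      then have "i < ?N" using mN by simp
      then have "h x $ i = u $ i" "h y $ i = w $ i" using i u w by (simp_all add: h_def \<psi>\<phi>)
      then show ?thesis using xy(5) by simp
    qed (use u w i in auto)
    moreover have "u \<in> carrier_vec ?n" "w \<in> carrier_vec ?n" using u(1) w(1) Uc by blast+
    ultimately have "u = w" by (intro eq_vecI) auto
    then show "x = y" using u w by simp
  next
    fix x and e :: real assume x: "x \<in> ?S" "vdist ?n A x < \<rho>" and e: "e > 0"
    define e' where "e' = e / (real ?N + 1)"
    have e': "e' > 0" unfolding e'_def using e by (intro divide_pos_pos add_nonneg_pos) auto
    have "\<exists>d>0. \<forall>y\<in>carrier_vec ?n. vdist ?n x y < d \<longrightarrow> y \<in> V \<and> \<bar>\<psi> y $ i - \<psi> x $ i\<bar> < e'" if "i < ?n" for i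
      by (rule continuous_map_vec_topologyD[OF nash_map_component(2)[OF \<psi> that AV(1)] Vo loc(2)[OF x] e'])
    then obtain D where D: "\<And>i. i < ?n \<Longrightarrow> D i > 0"
      "\<And>i y. i < ?n \<Longrightarrow> y \<in> carrier_vec ?n \<Longrightarrow> vdist ?n x y < D i \<Longrightarrow> \<bar>\<psi> y $ i - \<psi> x $ i\<bar> < e'" by metis
    define d' where "d' = Min (insert 1 (D ` {..<?n}))"
    have d': "d' > 0" "\<And>i. i < ?n \<Longrightarrow> d' \<le> D i" using D(1) by (auto simp: d'_def Min_gr_iff)
    show "\<exists>d>0. \<forall>y\<in>?S. vdist ?n A y < \<rho> \<longrightarrow> vdist ?n x y < d \<longrightarrow> vdist ?N (h x) (h y) < e"
    proof (intro exI[of _ d'] conjI ballI impI)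
      fix y assume y: "y \<in> ?S" "vdist ?n x y < d'"
      have "vdist ?N (h x) (h y) \<le> real ?N * e'"
      proof (rule vdist_leI)
        fix i assume i: "i < ?N"
        show "norm (h x $ i - h y $ i) \<le> e'"
        proof (cases "i < ?n")
          case True
          then show ?thesis using D(2)[OF True, of y] d'(2)[OF True] y S i by (force simp: h_def abs_minus_commute)
        qed (use i e' in \<open>simp add: h_def\<close>)
      qed
      also have "\<dots> < e" unfolding e'_def by (rule mult_divide_add_one_less[OF e])
      finally show "vdist ?N (h x) (h y) < e" .
    qed (rule d'(1))
  qed (use r0 r1 in \<open>auto simp: h_def \<rho>_def\<close>)
qed

section \<open>The condition number\<close>

lemma singular_basis_norms:
  fixes A :: "'a::rc_field mat"
  assumes A: "A \<in> carrier_mat m n"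
  obtains u where "\<And>i. i < n \<Longrightarrow> u i \<in> carrier_vec n"
    "\<And>i j. i < n \<Longrightarrow> j < n \<Longrightarrow> cinner n (u i) (u j) = (if i = j then 1 else 0)"
    "\<And>x. x \<in> carrier_vec n \<Longrightarrow> sqnorm n x = (\<Sum>i<n. (norm (cinner n (u i) x))\<^sup>2)"
    "\<And>x. x \<in> carrier_vec n \<Longrightarrow> sqnorm m (A *\<^sub>v x) = (\<Sum>i<n. (singular_values A ! i)\<^sup>2 * (norm (cinner n (u i) x))\<^sup>2)"
proof -
  from singular_basis[OF A] obtain u where "\<forall>i<n. u i \<in> carrier_vec n"
    "\<forall>i<n. \<forall>j<n. cinner n (u i) (u j) = (if i = j then 1 else 0)"
    "\<forall>i<n. \<forall>j<n. cinner m (A *\<^sub>v u i) (A *\<^sub>v u j) = (if i = j then of_real ((singular_values A ! i)\<^sup>2) else 0)"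
    by (elim conjE exE)
  then have u: "\<And>i. i < n \<Longrightarrow> u i \<in> carrier_vec n"
    and on: "\<And>i j. i < n \<Longrightarrow> j < n \<Longrightarrow> cinner n (u i) (u j) = (if i = j then 1 else 0)"
    and im: "\<And>i j. i < n \<Longrightarrow> j < n \<Longrightarrow> cinner m (A *\<^sub>v u i) (A *\<^sub>v u j) = (if i = j then of_real ((singular_values A ! i)\<^sup>2) else 0)"
    by blast+
  have exp: "x $ q = (\<Sum>i<n. u i $ q * cinner n (u i) x)" if "x \<in> carrier_vec n" "q < n" for x q
    by (rule orthonormal_expansion(3)[OF u on that])
  show thesis
  proof (rule that[OF u on])
    fix x :: "'a vec" assume x: "x \<in> carrier_vec n"
    have "sqnorm n x = (\<Sum>i<n. 1 * (norm (cinner n (u i) x))\<^sup>2)"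
      by (rule sqnorm_orthogonal_sum[where w = u]) (use exp[OF x] on in auto)
    then show "sqnorm n x = (\<Sum>i<n. (norm (cinner n (u i) x))\<^sup>2)" by simp
    show "sqnorm m (A *\<^sub>v x) = (\<Sum>i<n. (singular_values A ! i)\<^sup>2 * (norm (cinner n (u i) x))\<^sup>2)"
    proof (rule sqnorm_orthogonal_sum[where w = "\<lambda>i. A *\<^sub>v u i"])
      fix a assume a: "a < m"
      have "(A *\<^sub>v x) $ a = (\<Sum>q<n. \<Sum>i<n. A $$ (a, q) * u i $ q * cinner n (u i) x)"
        unfolding mult_mat_vec_entry[OF A x a]
        by (intro sum.cong refl) (use exp[OF x] in \<open>simp add: sum_distrib_left mult.assoc\<close>)
      also have "\<dots> = (\<Sum>i<n. (\<Sum>q<n. A $$ (a, q) * u i $ q) * cinner n (u i) x)"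
        by (subst sum.swap) (simp add: sum_distrib_right)
      also have "\<dots> = (\<Sum>i<n. (A *\<^sub>v u i) $ a * cinner n (u i) x)"
        by (intro sum.cong refl) (simp add: mult_mat_vec_entry[OF A u a] del: index_mult_mat_vec)
      finally show "(A *\<^sub>v x) $ a = (\<Sum>i<n. (A *\<^sub>v u i) $ a * cinner n (u i) x)" .
    qed (use im in auto)
  qed auto
qed

lemma singular_values_decreasing:
  fixes A :: "'a::rc_field mat"
  assumes A: "A \<in> carrier_mat m n" and ij: "i \<le> j" "j < n"
  shows "singular_values A ! j \<le> singular_values A ! i" "0 \<le> singular_values A ! j"
proof -
  have l: "length (singular_values A) = n" and s: "sorted (rev (singular_values A))" and p: "\<forall>s\<in>set (singular_values A). 0 \<le> s"
    using singular_basis[OF A] by blast+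
  show "0 \<le> singular_values A ! j" using p l ij by (metis nth_mem)
  have "rev (singular_values A) ! (n - Suc j) \<le> rev (singular_values A) ! (n - Suc i)"
    by (rule sorted_nth_mono[OF s]) (use l ij in auto)
  then show "singular_values A ! j \<le> singular_values A ! i" using l ij by (simp add: rev_nth)
qed

text \<open>The vector with coordinates c in the frame formed by the first N of the u; for an
  orthonormal frame this parametrises its span isometrically.\<close>

definition frame_comb :: "nat \<Rightarrow> nat \<Rightarrow> (nat \<Rightarrow> 'a::comm_ring_1 vec) \<Rightarrow> 'a vec \<Rightarrow> 'a vec" where
  "frame_comb n N u c = vec n (\<lambda>q. \<Sum>i<N. u i $ q * c $ i)"

lemma frame_comb_carrier [simp]: "frame_comb n N u c \<in> carrier_vec n"
  by (simp add: frame_comb_def)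

lemma frame_comb_diff:
  assumes "c \<in> carrier_vec N" "c' \<in> carrier_vec N"
  shows "frame_comb n N u c - frame_comb n N u c' = frame_comb n N u (c - c')"
  using assms by (intro eq_vecI) (auto simp: frame_comb_def algebra_simps sum_subtractf)

lemma cinner_frame_comb:
  fixes u :: "nat \<Rightarrow> 'a::rc_field vec"
  assumes on: "\<And>i j. i < n \<Longrightarrow> j < n \<Longrightarrow> cinner n (u i) (u j) = (if i = j then 1 else 0)" and N: "N \<le> n" and j: "j < n"
  shows "cinner n (u j) (frame_comb n N u c) = (if j < N then c $ j else 0)"
proof -
  have "cinner n (u j) (frame_comb n N u c) = (\<Sum>q<n. \<Sum>i<N. conjugate (u j $ q) * u i $ q * c $ i)"
    unfolding cinner_def frame_comb_def by (intro sum.cong refl) (simp add: sum_distrib_left mult.assoc)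
  also have "\<dots> = (\<Sum>i<N. cinner n (u j) (u i) * c $ i)"
    by (subst sum.swap) (simp add: cinner_def sum_distrib_right)
  also have "\<dots> = (\<Sum>i<N. if i = j then c $ i else 0)"
    by (intro sum.cong refl) (use on N j in auto)
  finally show ?thesis by simp
qed

lemma vnorm_eqI: "x \<in> carrier_vec n \<Longrightarrow> y \<in> carrier_vec m \<Longrightarrow> sqnorm n x = sqnorm m y \<Longrightarrow> vnorm x = vnorm y"
  by (metis vnorm_nonneg vnorm_sq power2_eq_iff_nonneg)

lemma vnorm_triangle_diff:
  assumes "x \<in> carrier_vec n" "y \<in> carrier_vec n"
  shows "vnorm x \<le> vnorm y + vdist n x y"
proof -
  have "vdist n x (0\<^sub>v n) \<le> vdist n x y + vdist n y (0\<^sub>v n)" by (rule vdist_triangle) (use assms in auto)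
  moreover have "vdist n z (0\<^sub>v n) = vnorm z" if "z \<in> carrier_vec n" for z :: "'a vec"
    using that by (auto simp: vdist_def vnorm_def intro!: L2_set_cong)
  ultimately show ?thesis using assms by simp
qed

text \<open>The classes of x and y are equal, as there is only one; and y belongs to its own class
  by the identity symmetry.\<close>

lemma unique_cpd_equiv:
  fixes B :: "'a::field vec"
  assumes d: "length ns \<ge> 1" and un: "unique_cpd ns r B" and x: "x \<in> cpd_fiber ns r B" and y: "y \<in> cpd_fiber ns r B"
  shows "\<exists>T\<in>symmetries ns r. x = T *\<^sub>v y"
proof -
  define F where "F = cpd_fiber ns r B"
  define R where "R = {(p, q). p \<in> F \<and> q \<in> F \<and> cpd_equiv ns r p q}"
  obtain X where X: "F // R = {X}"
    using un unfolding unique_cpd_def F_def[symmetric] R_def[symmetric] by (metis card_1_singletonE)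
  have "R `` {x} \<in> F // R" "R `` {y} \<in> F // R" using x y by (auto simp: F_def intro: quotientI)
  then have "R `` {x} = R `` {y}" unfolding X by auto
  moreover have "y \<in> R `` {y}"
  proof -
    have "y = 1\<^sub>m (r * sum_list ns) *\<^sub>v y" using y by (auto simp: cpd_fiber_def)
    then have "cpd_equiv ns r y y" unfolding cpd_equiv_def using one_in_symmetries[OF d] by metis
    then show ?thesis using y by (simp add: R_def F_def)
  qed
  ultimately have "y \<in> R `` {x}" by simp
  then show ?thesis by (auto simp: R_def cpd_equiv_def)
qed

lemma cpd_dist_le:
  assumes "T \<in> symmetries ns r" "vnorm (p - T *\<^sub>v q) \<le> b"
  shows "cpd_dist ns r p q \<le> b"
proof -
  have "cpd_dist ns r p q \<le> vnorm (p - T *\<^sub>v q)"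
    unfolding cpd_dist_def by (rule cINF_lower) (use assms in \<open>auto intro!: bdd_belowI2[of _ 0]\<close>)
  then show ?thesis using assms(2) by simp
qed

lemma cpd_dist_ge:
  assumes "length ns \<ge> 1" "\<And>T. T \<in> symmetries ns r \<Longrightarrow> b \<le> vnorm (p - T *\<^sub>v q)"
  shows "b \<le> cpd_dist ns r p q"
  unfolding cpd_dist_def by (rule cINF_greatest) (use assms one_in_symmetries in auto)

text \<open>Here x stands for the relative error of the linearisation at p. The two fractions are
  the bounds reached in \<open>max_ratio_upper\<close> and \<open>max_ratio_lower\<close>; both tend
  to 1 / s as x tends to 0.\<close>

lemma small_slack:
  fixes s e :: real
  assumes s: "s > 0" and e: "e > 0"
  shows "\<exists>x>0. x < s \<and> 1 / (s - x) < 1 / s + e \<and> 1 / s - e < (1 - 3 * x / s) / (s + x)"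
proof -
  have "((\<lambda>x. 1 / (s - x)) \<longlongrightarrow> 1 / (s - 0)) (at_right 0)" by (intro tendsto_intros) (use s in auto)
  then have 1: "\<forall>\<^sub>F x in at_right 0. 1 / (s - x) < 1 / s + e" using e by (intro order_tendstoD(2)) auto
  have "((\<lambda>x. (1 - 3 * x / s) / (s + x)) \<longlongrightarrow> (1 - 3 * 0 / s) / (s + 0)) (at_right 0)"
    by (intro tendsto_intros) (use s in auto)
  then have 2: "\<forall>\<^sub>F x in at_right 0. 1 / s - e < (1 - 3 * x / s) / (s + x)" using e by (intro order_tendstoD(1)) auto
  have 3: "\<forall>\<^sub>F x in at_right 0. x > (0::real)" by (simp add: eventually_at_right_less)
  have 4: "\<forall>\<^sub>F x in at_right 0. x < s" using s by (rule eventually_at_right_real[THEN eventually_mono]) auto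
  have "\<forall>\<^sub>F x in at_right 0. x > 0 \<and> x < s \<and> 1 / (s - x) < 1 / s + e \<and> 1 / s - e < (1 - 3 * x / s) / (s + x)"
    using 1 2 3 4 by eventually_elim auto
  then show ?thesis using eventually_happens'[OF trivial_limit_at_right_real] by blast
qed

text \<open>The situation once regularity has been reduced to \<open>locally_embeds\<close>. The
  right singular vectors \<open>u\<close> enter through the identities \<open>parseval\<close> and
  \<open>parseval_image\<close>; \<open>unique\<close> is the neighbourhood of robust
  identifiability in the form of a ball.\<close>

locale terracini_slice =
  fixes ns :: "nat list" and r N :: nat and p :: "'a::rc_field vec" and u :: "nat \<Rightarrow> 'a vec"
  assumes d: "length ns \<ge> 1" and pr: "prod_list ns > 0" and p: "p \<in> carrier_vec (r * sum_list ns)"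
    and N: "0 < N" "N \<le> r * sum_list ns"
    and pos_N: "singular_values (terracini ns r p) ! (N - 1) > 0"
    and emb: "locally_embeds (prod_list ns) (sigma ns r) (cpd_map ns r p) N"
    and unique: "\<exists>e>0. \<forall>B\<in>sigma ns r. vdist (prod_list ns) (cpd_map ns r p) B < e \<longrightarrow> unique_cpd ns r B"
    and u: "\<And>i. i < r * sum_list ns \<Longrightarrow> u i \<in> carrier_vec (r * sum_list ns)"
    and on: "\<And>i j. i < r * sum_list ns \<Longrightarrow> j < r * sum_list ns \<Longrightarrow> cinner (r * sum_list ns) (u i) (u j) = (if i = j then 1 else 0)"
    and parseval: "\<And>x. x \<in> carrier_vec (r * sum_list ns) \<Longrightarrow> sqnorm (r * sum_list ns) x = (\<Sum>i<r * sum_list ns. (norm (cinner (r * sum_list ns) (u i) x))\<^sup>2)"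
    and parseval_image: "\<And>x. x \<in> carrier_vec (r * sum_list ns) \<Longrightarrow> sqnorm (prod_list ns) (terracini ns r p *\<^sub>v x) =
        (\<Sum>i<r * sum_list ns. (singular_values (terracini ns r p) ! i)\<^sup>2 * (norm (cinner (r * sum_list ns) (u i) x))\<^sup>2)"
begin

abbreviation n where "n \<equiv> r * sum_list ns"
abbreviation m where "m \<equiv> prod_list ns"
abbreviation J where "J \<equiv> terracini ns r p"
abbreviation \<sigma> where "\<sigma> i \<equiv> singular_values J ! i"
abbreviation s where "s \<equiv> \<sigma> (N - 1)"
abbreviation S :: "'a vec set" where "S \<equiv> sigma ns r"
abbreviation f where "f \<equiv> cpd_map ns r"
abbreviation E where "E \<equiv> frame_comb n N u"
definition g where "g c = p + E c"

lemma J_carrier: "J \<in> carrier_mat m n"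
  by (rule terracini_carrier[OF pr])

lemma J_mult_carrier: "x \<in> carrier_vec n \<Longrightarrow> J *\<^sub>v x \<in> carrier_vec m"
  using J_carrier by simp

lemma g_carrier [simp]: "g c \<in> carrier_vec n"
  using p by (simp add: g_def)

lemma cpd_map_g_in_sigma: "f (g c) \<in> S"
  using g_carrier by (auto simp: sigma_def)

lemma g_zero: "g (0\<^sub>v N) = p"
  using p by (intro eq_vecI) (auto simp: g_def frame_comb_def)

lemma g_minus_p: "g c - p = E c"
  using p by (intro eq_vecI) (auto simp: g_def frame_comb_def)

lemma g_diff: "c \<in> carrier_vec N \<Longrightarrow> c' \<in> carrier_vec N \<Longrightarrow> g c - g c' = E (c - c')"
  unfolding frame_comb_diff[symmetric] using p by (intro eq_vecI) (auto simp: g_def frame_comb_def)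

lemma sum_frame_comb: "(\<Sum>i<n. a i * (norm (cinner n (u i) (E c)))\<^sup>2) = (\<Sum>i<N. a i * (norm (c $ i))\<^sup>2)"
  by (rule sum.mono_neutral_cong_right) (use N in \<open>auto simp: cinner_frame_comb[OF on]\<close>)

lemma slice_isometry: "c \<in> carrier_vec N \<Longrightarrow> c' \<in> carrier_vec N \<Longrightarrow> vdist n (g c) (g c') = vdist N c c'"
proof -
  assume c: "c \<in> carrier_vec N" "c' \<in> carrier_vec N"
  have "sqnorm n (E (c - c')) = sqnorm N (c - c')"
    using sum_frame_comb[of "\<lambda>_. 1" "c - c'"] unfolding parseval[OF frame_comb_carrier] by (simp add: sqnorm_def[of N])
  then have "vnorm (g c - g c') = vnorm (c - c')"
    unfolding g_diff[OF c] using c by (intro vnorm_eqI) auto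
  then show ?thesis using c by (simp add: vdist_eq_vnorm)
qed

lemma vdist_slice: "c \<in> carrier_vec N \<Longrightarrow> vdist n p (g c) = vnorm c"
proof -
  assume c: "c \<in> carrier_vec N"
  have "vdist N (0\<^sub>v N) c = vnorm c" using c by (auto simp: vdist_def vnorm_def intro!: L2_set_cong)
  with slice_isometry[OF zero_carrier_vec c] show ?thesis unfolding g_zero by (rule trans)
qed

text \<open>Along the slice only the first N singular values occur, and each of them is at least
  \<open>s\<close>.\<close>

lemma slice_expands:
  assumes c: "c \<in> carrier_vec N"
  shows "s * vnorm c \<le> vnorm (J *\<^sub>v E c)"
proof (rule power2_le_imp_le)
  have "(s * vnorm c)\<^sup>2 = (\<Sum>i<N. s\<^sup>2 * (norm (c $ i))\<^sup>2)"
    by (simp add: power_mult_distrib vnorm_sq[OF c] sqnorm_def sum_distrib_left)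
  also have "\<dots> \<le> (\<Sum>i<N. (\<sigma> i)\<^sup>2 * (norm (c $ i))\<^sup>2)"
    by (intro sum_mono mult_right_mono power_mono) (use singular_values_decreasing(1)[OF J_carrier, of _ "N - 1"] pos_N N in auto)
  also have "\<dots> = (vnorm (J *\<^sub>v E c))\<^sup>2"
    unfolding vnorm_sq[OF J_mult_carrier[OF frame_comb_carrier]] parseval_image[OF frame_comb_carrier] by (rule sum_frame_comb[symmetric])
  finally show "(s * vnorm c)\<^sup>2 \<le> (vnorm (J *\<^sub>v E c))\<^sup>2" .
qed simp

lemma singular_value_0_nonneg: "0 \<le> \<sigma> 0"
  by (rule singular_values_decreasing(2)[OF J_carrier order_refl]) (use N in linarith)

lemma slice_bounded:
  assumes c: "c \<in> carrier_vec N"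
  shows "vnorm (J *\<^sub>v E c) \<le> \<sigma> 0 * vnorm c"
proof (rule power2_le_imp_le)
  have "(vnorm (J *\<^sub>v E c))\<^sup>2 = (\<Sum>i<N. (\<sigma> i)\<^sup>2 * (norm (c $ i))\<^sup>2)"
    unfolding vnorm_sq[OF J_mult_carrier[OF frame_comb_carrier]] parseval_image[OF frame_comb_carrier] by (rule sum_frame_comb)
  also have "\<dots> \<le> (\<Sum>i<N. (\<sigma> 0)\<^sup>2 * (norm (c $ i))\<^sup>2)"
    by (intro sum_mono mult_right_mono power_mono) (use singular_values_decreasing[OF J_carrier, of 0] singular_values_decreasing(2)[OF J_carrier] N in auto)
  also have "\<dots> = (\<sigma> 0 * vnorm c)\<^sup>2"
    by (simp add: power_mult_distrib vnorm_sq[OF c] sqnorm_def sum_distrib_left)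
  finally show "(vnorm (J *\<^sub>v E c))\<^sup>2 \<le> (\<sigma> 0 * vnorm c)\<^sup>2" .
qed (simp add: singular_value_0_nonneg)

lemma differential_bound:
  assumes "x > 0"
  obtains \<delta> where "\<delta> > 0" "\<And>y z. y \<in> carrier_vec n \<Longrightarrow> z \<in> carrier_vec n \<Longrightarrow> vdist n p y < \<delta> \<Longrightarrow> vdist n p z < \<delta> \<Longrightarrow>
    vdist m (f y - f z) (J *\<^sub>v (y - z)) \<le> x * vdist n y z"
  using cpd_map_strictly_differentiable[OF p pr assms] by blast

text \<open>\<open>f \<circ> g\<close> parametrises the image of the affine slice through \<open>p\<close> spanned by \<open>u\<close>. It is injective near
  the origin, so that by invariance of domain it covers a neighbourhood.\<close>

lemma slice_covers:
  assumes \<rho>: "\<rho> > 0"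
  shows "\<exists>\<eta>>0. \<forall>B\<in>S. vdist m (f p) B < \<eta> \<longrightarrow> (\<exists>c\<in>carrier_vec N. vdist N (0\<^sub>v N) c < \<rho> \<and> f (g c) = B)"
proof -
  \<comment> \<open>An error of s / 2 against the expansion factor s leaves the lower bound s / 2
    along the slice, hence injectivity.\<close>
  obtain \<delta> where \<delta>: "\<delta> > 0" "\<And>x y. x \<in> carrier_vec n \<Longrightarrow> y \<in> carrier_vec n \<Longrightarrow> vdist n p x < \<delta> \<Longrightarrow> vdist n p y < \<delta> \<Longrightarrow>
      vdist m (f x - f y) (J *\<^sub>v (x - y)) \<le> s / 2 * vdist n x y"
    using differential_bound[OF half_gt_zero[OF pos_N]] by blast
  from emb[unfolded locally_embeds_def] obtain \<delta>h and h :: "'a vec \<Rightarrow> 'a vec" where \<delta>h: "\<delta>h > 0"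
    and hc: "\<forall>x\<in>S. vdist m (f p) x < \<delta>h \<longrightarrow> h x \<in> carrier_vec N"
    and hinj: "\<forall>x\<in>S. \<forall>y\<in>S. vdist m (f p) x < \<delta>h \<longrightarrow> vdist m (f p) y < \<delta>h \<longrightarrow> h x = h y \<longrightarrow> x = y"
    and hcont: "\<forall>x\<in>S. vdist m (f p) x < \<delta>h \<longrightarrow> (\<forall>e>0. \<exists>d>0. \<forall>y\<in>S. vdist m (f p) y < \<delta>h \<longrightarrow> vdist m x y < d \<longrightarrow> vdist N (h x) (h y) < e)"
    by (elim exE conjE)
  have h: "\<And>x. x \<in> S \<Longrightarrow> vdist m (f p) x < \<delta>h \<Longrightarrow> h x \<in> carrier_vec N"
    "\<And>x y. x \<in> S \<Longrightarrow> y \<in> S \<Longrightarrow> vdist m (f p) x < \<delta>h \<Longrightarrow> vdist m (f p) y < \<delta>h \<Longrightarrow> h x = h y \<Longrightarrow> x = y"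
    "\<And>x e. x \<in> S \<Longrightarrow> vdist m (f p) x < \<delta>h \<Longrightarrow> e > 0 \<Longrightarrow>
      \<exists>d>0. \<forall>y\<in>S. vdist m (f p) y < \<delta>h \<longrightarrow> vdist m x y < d \<longrightarrow> vdist N (h x) (h y) < e"
    using hc hinj hcont by simp_all
  \<comment> \<open>A Lipschitz constant of f along the slice: \<open>\<sigma> 0\<close> bounds the
    linear part, and s the error of the linearisation.\<close>
  define C where "C = \<sigma> 0 + s"
  have C: "C > 0" using singular_value_0_nonneg pos_N by (simp add: C_def)
  \<comment> \<open>The three radii keep c in the required ball, \<open>g c\<close> where the
    linearisation is valid, and \<open>f (g c)\<close> where \<open>h\<close> is injective.\<close>
  define \<rho>' where "\<rho>' = min (min \<rho> \<delta>) (\<delta>h / C)"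
  have \<rho>': "\<rho>' > 0" using \<rho> \<delta>(1) \<delta>h C by (simp add: \<rho>'_def)
  define Bl where "Bl = {c \<in> carrier_vec N. vdist N (0\<^sub>v N) (c :: 'a vec) < \<rho>'}"
  have zB: "0\<^sub>v N \<in> Bl" using \<rho>' by (simp add: Bl_def)
  have near: "vdist n p (g c) < \<delta>" if "c \<in> Bl" for c
    using slice_isometry[of "0\<^sub>v N" c] that by (simp add: Bl_def g_zero \<rho>'_def)
  have bounds: "s / 2 * vdist N c c' \<le> vdist m (f (g c)) (f (g c'))" "vdist m (f (g c)) (f (g c')) \<le> C * vdist N c c'"
    if c: "c \<in> Bl" "c' \<in> Bl" for c c'
  proof -
    have cc: "c \<in> carrier_vec N" "c' \<in> carrier_vec N" "c - c' \<in> carrier_vec N" using c by (auto simp: Bl_def)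
    have v: "vdist N c c' = vnorm (c - c')" by (rule vdist_eq_vnorm[OF cc(1,2)])
    have vf: "vdist m (f (g c)) (f (g c')) = vnorm (f (g c) - f (g c'))" by (rule vdist_eq_vnorm) auto
    have fc: "f (g c) - f (g c') \<in> carrier_vec m" by simp
    have JE: "J *\<^sub>v E (c - c') \<in> carrier_vec m" by (rule J_mult_carrier[OF frame_comb_carrier])
    have d: "vdist m (f (g c) - f (g c')) (J *\<^sub>v E (c - c')) \<le> s / 2 * vdist N c c'"
      using \<delta>(2)[OF g_carrier g_carrier near near, OF c] unfolding g_diff[OF cc(1,2)] slice_isometry[OF cc(1,2)] .
    have l: "s * vdist N c c' \<le> vnorm (J *\<^sub>v E (c - c'))" using slice_expands[OF cc(3)] v by simp
    have "vnorm (J *\<^sub>v E (c - c')) \<le> vnorm (f (g c) - f (g c')) + s / 2 * vdist N c c'"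
      using vnorm_triangle_diff[OF JE fc] d by (simp add: vdist_commute)
    then show "s / 2 * vdist N c c' \<le> vdist m (f (g c)) (f (g c'))" using l vf by simp
    have "vnorm (f (g c) - f (g c')) \<le> \<sigma> 0 * vdist N c c' + s / 2 * vdist N c c'"
      using vnorm_triangle_diff[OF fc JE] d slice_bounded[OF cc(3)] v by simp
    also have "\<dots> \<le> \<sigma> 0 * vdist N c c' + s * vdist N c c'" using pos_N by (simp add: mult_right_mono)
    finally show "vdist m (f (g c)) (f (g c')) \<le> C * vdist N c c'" using vf by (simp add: C_def algebra_simps)
  qed
  have fnear: "vdist m (f p) (f (g c)) < \<delta>h" if c: "c \<in> Bl" for c
  proof -
    have "vdist m (f p) (f (g c)) \<le> C * vdist N (0\<^sub>v N) c" using bounds(2)[OF zB c] by (simp add: g_zero)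
    also have "\<dots> < C * (\<delta>h / C)" using c C by (intro mult_strict_left_mono) (auto simp: Bl_def \<rho>'_def)
    finally show ?thesis using C by simp
  qed
  have "\<exists>\<eta>>0. \<forall>y\<in>carrier_vec N. vdist N (h (f (g (0\<^sub>v N)))) y < \<eta> \<longrightarrow> (\<exists>c\<in>Bl. h (f (g c)) = y)"
    unfolding Bl_def
  proof (rule invariance_of_domain_vec[OF \<rho>'], fold Bl_def)
    show "h (f (g c)) \<in> carrier_vec N" if "c \<in> Bl" for c by (rule h(1)[OF cpd_map_g_in_sigma fnear[OF that]])
    show "inj_on (\<lambda>c. h (f (g c))) Bl"
    proof (rule inj_onI)
      fix c c' assume c: "c \<in> Bl" "c' \<in> Bl" "h (f (g c)) = h (f (g c'))"
      have "f (g c) = f (g c')" by (rule h(2)[OF cpd_map_g_in_sigma cpd_map_g_in_sigma fnear fnear]) (use c in auto)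
      then have "s / 2 * vdist N c c' \<le> 0" using bounds(1)[OF c(1,2)] by simp
      then have "vdist N c c' = 0" using pos_N vdist_nonneg[of N c c'] by (simp add: mult_le_0_iff)
      then show "c = c'" using c vdist_eq_0[of c N c'] by (simp add: Bl_def)
    qed
    fix c and e :: real assume c: "c \<in> Bl" and e: "e > 0"
    obtain d where d: "d > 0" "\<forall>y\<in>S. vdist m (f p) y < \<delta>h \<longrightarrow> vdist m (f (g c)) y < d \<longrightarrow> vdist N (h (f (g c))) (h y) < e"
      using h(3)[OF cpd_map_g_in_sigma fnear[OF c] e] by blast
    show "\<exists>d>0. \<forall>c'\<in>Bl. vdist N c c' < d \<longrightarrow> vdist N (h (f (g c))) (h (f (g c'))) < e"
    proof (intro exI[of _ "d / C"] conjI ballI impI)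
      fix c' assume c': "c' \<in> Bl" "vdist N c c' < d / C"
      have "vdist m (f (g c)) (f (g c')) < d"
        using bounds(2)[OF c c'(1)] c'(2) C by (simp add: field_simps)
      then show "vdist N (h (f (g c))) (h (f (g c'))) < e" using d(2) cpd_map_g_in_sigma fnear[OF c'(1)] by blast
    qed (use d C in simp)
  qed
  then obtain \<eta> where \<eta>: "\<eta> > 0" "\<And>y. y \<in> carrier_vec N \<Longrightarrow> vdist N (h (f p)) y < \<eta> \<Longrightarrow> \<exists>c\<in>Bl. h (f (g c)) = y"
    unfolding g_zero by blast
  have pS: "f p \<in> S" using cpd_map_g_in_sigma[of "0\<^sub>v N"] by (simp add: g_zero)
  obtain d where d: "d > 0" "\<forall>y\<in>S. vdist m (f p) y < \<delta>h \<longrightarrow> vdist m (f p) y < d \<longrightarrow> vdist N (h (f p)) (h y) < \<eta>"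
    using h(3)[OF pS _ \<eta>(1)] \<delta>h by auto
  have "\<exists>c\<in>carrier_vec N. vdist N (0\<^sub>v N) c < \<rho> \<and> f (g c) = B" if B: "B \<in> S" "vdist m (f p) B < min d \<delta>h" for B
  proof -
    have "vdist N (h (f p)) (h B) < \<eta>" using d(2) B by auto
    then obtain c where c: "c \<in> Bl" "h (f (g c)) = h B" using \<eta>(2)[OF h(1)[OF B(1)]] B(2) by auto
    \<comment> \<open>The covering was obtained for the images under \<open>h\<close>; injectivity
      of \<open>h\<close> on \<open>sigma\<close> near \<open>f p\<close> carries it back to
      tensors.\<close>
    have "f (g c) = B" by (rule h(2)[OF cpd_map_g_in_sigma B(1) fnear[OF c(1)] _ c(2)]) (use B in simp)
    then show ?thesis using c by (auto simp: Bl_def \<rho>'_def)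
  qed
  then show ?thesis using d(1) \<delta>h by (intro exI[of _ "min d \<delta>h"]) auto
qed

lemma max_ratio_upper:
  assumes e: "e > 0"
  shows "\<exists>\<eta>>0. \<forall>\<epsilon>. 0 < \<epsilon> \<and> \<epsilon> < \<eta> \<longrightarrow> max_ratio ns r p \<epsilon> \<le> ereal (1 / s + e)"
proof -
  obtain rU where rU: "rU > 0" "\<And>B. B \<in> S \<Longrightarrow> vdist m (f p) B < rU \<Longrightarrow> unique_cpd ns r B"
    using unique by blast
  obtain x where x: "x > 0" "x < s" "1 / (s - x) < 1 / s + e" using small_slack[OF pos_N e] by blast
  obtain \<delta> where \<delta>: "\<delta> > 0" "\<And>y z. y \<in> carrier_vec n \<Longrightarrow> z \<in> carrier_vec n \<Longrightarrow> vdist n p y < \<delta> \<Longrightarrow> vdist n p z < \<delta> \<Longrightarrow>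
      vdist m (f y - f z) (J *\<^sub>v (y - z)) \<le> x * vdist n y z" using differential_bound[OF x(1)] by blast
  obtain \<eta> where \<eta>: "\<eta> > 0" "\<And>B. B \<in> S \<Longrightarrow> vdist m (f p) B < \<eta> \<Longrightarrow>
      \<exists>c\<in>carrier_vec N. vdist N (0\<^sub>v N) c < \<delta> \<and> f (g c) = B" using slice_covers[OF \<delta>(1)] by blast
  have "max_ratio ns r p \<epsilon> \<le> ereal (1 / s + e)" if \<epsilon>: "0 < \<epsilon>" "\<epsilon> < min \<eta> rU" for \<epsilon>
    unfolding max_ratio_def
  proof (rule SUP_least)
    fix \<Delta> assume "\<Delta> \<in> {\<Delta> \<in> carrier_vec m. 0 < vnorm \<Delta> \<and> vnorm \<Delta> \<le> \<epsilon> \<and> f p + \<Delta> \<in> S}"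
    then have \<Delta>: "\<Delta> \<in> carrier_vec m" "0 < vnorm \<Delta>" "vnorm \<Delta> \<le> \<epsilon>" "f p + \<Delta> \<in> S" by auto
    define B where "B = f p + \<Delta>"
    have B: "B \<in> S" using \<Delta> by (simp add: B_def)
    have Bd: "vdist m (f p) B = vnorm \<Delta>"
      using \<Delta>(1) by (auto simp: vdist_def vnorm_def B_def intro!: L2_set_cong)
    obtain c where c: "c \<in> carrier_vec N" "vdist N (0\<^sub>v N) c < \<delta>" "f (g c) = B"
      using \<eta>(2)[OF B] Bd \<Delta> \<epsilon> by auto
    have cd: "vdist n p (g c) < \<delta>" using slice_isometry[OF zero_carrier_vec c(1)] c(2) unfolding g_zero by (rule ord_eq_less_trans)
    have "vdist m (f (g c) - f p) (J *\<^sub>v (g c - p)) \<le> x * vdist n (g c) p"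
      by (rule \<delta>(2)[OF g_carrier p cd]) (use \<delta> in simp)
    then have "vdist m \<Delta> (J *\<^sub>v (g c - p)) \<le> x * vnorm c"
    proof -
      have "f (g c) - f p = \<Delta>" using \<Delta>(1) unfolding c(3) B_def by (intro eq_vecI) auto
      then show ?thesis using \<open>vdist m (f (g c) - f p) (J *\<^sub>v (g c - p)) \<le> x * vdist n (g c) p\<close>
        vdist_slice[OF c(1)] by (simp add: vdist_commute)
    qed
    moreover have "vnorm (J *\<^sub>v (g c - p)) \<le> vnorm \<Delta> + vdist m (J *\<^sub>v (g c - p)) \<Delta>"
      by (rule vnorm_triangle_diff[OF J_mult_carrier \<Delta>(1)]) (use g_carrier p in auto)
    moreover have "s * vnorm c \<le> vnorm (J *\<^sub>v (g c - p))"
      unfolding g_minus_p by (rule slice_expands[OF c(1)])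
    ultimately have low: "(s - x) * vnorm c \<le> vnorm \<Delta>" by (simp add: vdist_commute algebra_simps)
    have fib: "g c \<in> cpd_fiber ns r B" using g_carrier c(3) by (simp add: cpd_fiber_def)
    then have q: "(SOME q. q \<in> cpd_fiber ns r B) \<in> cpd_fiber ns r B" by (rule someI)
    have "unique_cpd ns r B" by (rule rU(2)[OF B]) (use Bd \<Delta> \<epsilon> in simp)
    \<comment> \<open>\<open>fiber_dist\<close> measures from an arbitrarily chosen decomposition,
      possibly far from p; uniqueness gives a symmetry that carries it to
      \<open>g c\<close>.\<close>
    then obtain T where T: "T \<in> symmetries ns r" "g c = T *\<^sub>v (SOME q. q \<in> cpd_fiber ns r B)"
      using unique_cpd_equiv[OF d _ fib q] by blast
    have "fiber_dist ns r p B \<le> vnorm c"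
      unfolding fiber_dist_def
      by (rule cpd_dist_le[OF T(1)]) (simp add: T(2)[symmetric] vdist_slice[OF c(1)] flip: vdist_eq_vnorm[OF p g_carrier])
    also have "\<dots> \<le> vnorm \<Delta> / (s - x)" using low x by (simp add: field_simps)
    finally have "fiber_dist ns r p B / vnorm \<Delta> \<le> 1 / (s - x)" using \<Delta>(2) x by (simp add: field_simps)
    then show "ereal (fiber_dist ns r p (f p + \<Delta>) / vnorm \<Delta>) \<le> ereal (1 / s + e)" using x(3) by (simp add: B_def)
  qed
  then show ?thesis using \<eta>(1) rU(1) by (intro exI[of _ "min \<eta> rU"]) auto
qed

lemma max_ratio_lower:
  assumes e: "e > 0" and \<epsilon>: "\<epsilon> > 0"
  shows "ereal (1 / s - e) \<le> max_ratio ns r p \<epsilon>"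
proof -
  obtain x where x: "x > 0" "x < s" "1 / s - e < (1 - 3 * x / s) / (s + x)" using small_slack[OF pos_N e] by blast
  obtain \<delta> where \<delta>: "\<delta> > 0" "\<And>y z. y \<in> carrier_vec n \<Longrightarrow> z \<in> carrier_vec n \<Longrightarrow> vdist n p y < \<delta> \<Longrightarrow> vdist n p z < \<delta> \<Longrightarrow>
      vdist m (f y - f z) (J *\<^sub>v (y - z)) \<le> x * vdist n y z" using differential_bound[OF x(1)] by blast
  \<comment> \<open>The first bound keeps everything within 2 t of p where the linearisation is
    valid, the second yields \<open>vnorm \<Delta> \<le> \<epsilon>\<close>.\<close>
  define t where "t = min (\<delta> / 3) (\<epsilon> / (s + x))"
  have t: "t > 0" "2 * t < \<delta>" "t * (s + x) \<le> \<epsilon>"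
  proof -
    show "t > 0" "2 * t < \<delta>" using \<delta>(1) \<epsilon> pos_N x by (auto simp: t_def min_def)
    have "t * (s + x) \<le> \<epsilon> / (s + x) * (s + x)" using pos_N x by (intro mult_right_mono) (auto simp: t_def)
    then show "t * (s + x) \<le> \<epsilon>" using pos_N x by simp
  qed
  let ?i = "N - 1"
  have i: "?i < n" "?i < N" using N by auto
  have ui: "u ?i \<in> carrier_vec n" by (rule u[OF i(1)])
  \<comment> \<open>A step of length t in the direction that J stretches least among the first N, by
    the factor s.\<close>
  define v where "v = of_real t \<cdot>\<^sub>v u ?i"
  have v: "v \<in> carrier_vec n" using ui by (simp add: v_def)
  have ipv: "cinner n (u j) v = (if j = ?i then of_real t else 0)" if "j < n" for j
    using on[OF that i(1)] ui by (simp add: v_def cinner_smult_right)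
  have vn: "vnorm v = t"
  proof -
    have "(vnorm v)\<^sup>2 = (\<Sum>j<n. if j = ?i then t\<^sup>2 else 0)"
      unfolding vnorm_sq[OF v] parseval[OF v] by (intro sum.cong refl) (auto simp: ipv)
    then have "(vnorm v)\<^sup>2 = t\<^sup>2" using i by simp
    then show ?thesis using t by (simp add: power2_eq_iff_nonneg)
  qed
  have Jv: "vnorm (J *\<^sub>v v) = s * t"
  proof -
    have "(vnorm (J *\<^sub>v v))\<^sup>2 = (\<Sum>j<n. if j = ?i then s\<^sup>2 * t\<^sup>2 else 0)"
      unfolding vnorm_sq[OF J_mult_carrier[OF v]] parseval_image[OF v] by (intro sum.cong refl) (auto simp: ipv)
    then have "(vnorm (J *\<^sub>v v))\<^sup>2 = (s * t)\<^sup>2" using i by (simp add: power_mult_distrib)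
    then show ?thesis using t pos_N by (simp add: power2_eq_iff_nonneg)
  qed
  define P where "P = p + v"
  have P: "P \<in> carrier_vec n" using p v by (simp add: P_def)
  have Pp: "P - p = v" using p v by (intro eq_vecI) (auto simp: P_def)
  have Pd: "vdist n P p = t" using vdist_eq_vnorm[OF P p] by (simp add: Pp vn)
  define B where "B = f P"
  define \<Delta> where "\<Delta> = B - f p"
  have \<Delta>: "\<Delta> \<in> carrier_vec m" by (simp add: \<Delta>_def B_def)
  have B_eq: "f p + \<Delta> = B" by (intro eq_vecI) (auto simp: \<Delta>_def B_def)
  have "vdist m (f P - f p) (J *\<^sub>v (P - p)) \<le> x * vdist n P p"
    by (rule \<delta>(2)[OF P p]) (use Pd t \<delta> in \<open>auto simp: vdist_commute\<close>)
  then have d1: "vdist m \<Delta> (J *\<^sub>v v) \<le> x * t" by (simp add: Pp Pd \<Delta>_def B_def)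
  have \<Delta>u: "vnorm \<Delta> \<le> t * (s + x)"
    using vnorm_triangle_diff[OF \<Delta> J_mult_carrier[OF v]] d1 Jv by (simp add: algebra_simps)
  have "s * t \<le> vnorm \<Delta> + x * t"
    using vnorm_triangle_diff[OF J_mult_carrier[OF v] \<Delta>] d1 Jv by (simp add: vdist_commute)
  moreover have "x * t < s * t" using x t by (intro mult_strict_right_mono) auto
  ultimately have \<Delta>0: "vnorm \<Delta> > 0" by simp
  have BS: "B \<in> S" using P by (auto simp: B_def sigma_def)
  \<comment> \<open>The step length t, less the bound 3 x t / s on the component along
    \<open>u ?i\<close> of y - P, for decompositions y of \<open>B\<close> within 2 t of p.\<close>
  define b where "b = t * (1 - 3 * x / s)"
  have "b \<le> fiber_dist ns r p B"
    unfolding fiber_dist_def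
  proof (rule cpd_dist_ge[OF d])
    fix T :: "'a mat" assume T: "T \<in> symmetries ns r"
    define q where "q = (SOME q. q \<in> cpd_fiber ns r B)"
    have "P \<in> cpd_fiber ns r B" using P by (simp add: cpd_fiber_def B_def)
    then have q: "q \<in> cpd_fiber ns r B" unfolding q_def by (rule someI)
    define y where "y = T *\<^sub>v q"
    have y: "y \<in> carrier_vec n" "f y = B"
      using cpd_map_symmetries[OF T d, of q] q by (auto simp: cpd_fiber_def y_def)
    have dist: "vnorm (p - y) = vdist n p y" by (rule vdist_eq_vnorm[OF p y(1), symmetric])
    have "b \<le> vdist n p y"
    \<comment> \<open>Decompositions farther than 2 t from p are harmless because b \<le> t; the
      others lie where the linearisation is valid.\<close>
    proof (cases "vdist n p y \<le> 2 * t")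
      case False
      have "b \<le> t * 1" unfolding b_def using t x pos_N by (intro mult_left_mono) auto
      then show ?thesis using False t by simp
    next
      case True
      have yP: "vdist n y P \<le> 3 * t"
        using vdist_triangle[OF y(1) p P] True Pd by (simp add: vdist_commute)
      have "vdist m (f y - f P) (J *\<^sub>v (y - P)) \<le> x * vdist n y P"
        by (rule \<delta>(2)[OF y(1) P]) (use True t Pd in \<open>auto simp: vdist_commute\<close>)
      also have "\<dots> \<le> x * (3 * t)" using yP x by (intro mult_left_mono) auto
      finally have d2: "vdist m (f y - f P) (J *\<^sub>v (y - P)) \<le> x * (3 * t)" .
      have yPc: "y - P \<in> carrier_vec n" using y P by simp
      \<comment> \<open>y and P decompose the same tensor, so J (y - P) is nothing but the error of
        the linearisation.\<close>
      have "f y - f P = 0\<^sub>v m" unfolding y(2) B_def by (intro eq_vecI) auto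
      moreover have "vnorm (0\<^sub>v m :: 'a vec) = 0" by (simp add: vnorm_def L2_set_def)
      ultimately have d3: "vnorm (J *\<^sub>v (y - P)) \<le> x * (3 * t)"
        using vnorm_triangle_diff[OF J_mult_carrier[OF yPc] zero_carrier_vec] d2 by (simp add: vdist_commute)
      have "(s * norm (cinner n (u ?i) (y - P)))\<^sup>2 \<le> (vnorm (J *\<^sub>v (y - P)))\<^sup>2"
        unfolding vnorm_sq[OF J_mult_carrier[OF yPc]] parseval_image[OF yPc] power_mult_distrib
        using member_le_sum[of ?i "{..<n}" "\<lambda>i. (singular_values J ! i)\<^sup>2 * (norm (cinner n (u i) (y - P)))\<^sup>2"] i by simp
      then have "s * norm (cinner n (u ?i) (y - P)) \<le> vnorm (J *\<^sub>v (y - P))" by (rule power2_le_imp_le) simp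
      then have d4: "norm (cinner n (u ?i) (y - P)) \<le> x * (3 * t) / s"
        using d3 pos_N by (simp add: field_simps)
      have ypc: "y - p \<in> carrier_vec n" using y p by simp
      have "y - P = (y - p) - v" using y p v by (intro eq_vecI) (auto simp: P_def)
      then have e1: "cinner n (u ?i) (y - P) = cinner n (u ?i) (y - p) - of_real t"
        using cinner_minus_right[OF ypc v, of "u ?i"] ipv[OF i(1)] by simp
      have "t = norm (of_real t :: 'a)" using t by simp
      also have "\<dots> = norm (cinner n (u ?i) (y - p) - cinner n (u ?i) (y - P))" unfolding e1 by simp
      also have "\<dots> \<le> norm (cinner n (u ?i) (y - p)) + norm (cinner n (u ?i) (y - P))" by (rule norm_triangle_ineq4)
      finally have d5: "t - x * (3 * t) / s \<le> norm (cinner n (u ?i) (y - p))" using d4 by simp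
      have "(norm (cinner n (u ?i) (y - p)))\<^sup>2 \<le> (vnorm (y - p))\<^sup>2"
        unfolding vnorm_sq[OF ypc] parseval[OF ypc]
        using member_le_sum[of ?i "{..<n}" "\<lambda>i. (norm (cinner n (u i) (y - p)))\<^sup>2"] i by simp
      then have "norm (cinner n (u ?i) (y - p)) \<le> vnorm (y - p)" by (rule power2_le_imp_le) simp
      then have "t - x * (3 * t) / s \<le> vdist n p y"
        using d5 vdist_eq_vnorm[OF y(1) p] by (simp add: vdist_commute)
      then show ?thesis by (simp add: b_def algebra_simps)
    qed
    then show "b \<le> vnorm (p - T *\<^sub>v (SOME q. q \<in> cpd_fiber ns r B))" using dist by (simp add: y_def q_def)
  qed
  then have ratio: "b / vnorm \<Delta> \<le> fiber_dist ns r p B / vnorm \<Delta>" using \<Delta>0 by (simp add: divide_right_mono)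
  have fd0: "0 \<le> fiber_dist ns r p B"
    unfolding fiber_dist_def by (rule cpd_dist_ge[OF d]) simp
  have "1 / s - e \<le> fiber_dist ns r p B / vnorm \<Delta>"
  \<comment> \<open>b is negative when x exceeds s / 3; then 1 / s - e is negative too, while the
    ratio is nonnegative.\<close>
  proof (cases "0 \<le> b")
    case True
    have "1 / s - e \<le> b / (t * (s + x))" using x(3) t by (simp add: b_def)
    also have "\<dots> \<le> b / vnorm \<Delta>" using True \<Delta>u \<Delta>0 t(1) pos_N x(1) by (intro divide_left_mono mult_pos_pos) auto
    finally show ?thesis using ratio by simp
  next
    case False
    then have "1 - 3 * x / s < 0" using t by (simp add: b_def zero_le_mult_iff)
    then have "(1 - 3 * x / s) / (s + x) < 0" using x pos_N by (intro divide_neg_pos) auto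
    then have "1 / s - e < 0" using x(3) by simp
    also have "0 \<le> fiber_dist ns r p B / vnorm \<Delta>" using fd0 by simp
    finally show ?thesis by simp
  qed
  then show ?thesis unfolding max_ratio_def
    by (intro SUP_upper2[of \<Delta>]) (use \<Delta> \<Delta>0 \<Delta>u t BS B_eq in auto)
qed

lemma max_ratio_tendsto: "(max_ratio ns r p \<longlongrightarrow> ereal (inverse s)) (at_right 0)"
proof (rule order_tendstoI)
  fix a assume a: "a < ereal (inverse s)"
  have "\<exists>e>0. a < ereal (1 / s - e)"
  proof (cases a)
    case (real a')
    then show ?thesis using a by (intro exI[of _ "(1 / s - a') / 2"]) (simp add: field_simps)
  qed (use a in \<open>auto intro: exI[of _ 1]\<close>)
  then obtain e where e: "e > 0" "a < ereal (1 / s - e)" by blast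
  have "\<forall>\<^sub>F \<epsilon> in at_right 0. (0::real) < \<epsilon>" by (simp add: eventually_at_right_less)
  then show "\<forall>\<^sub>F \<epsilon> in at_right 0. a < max_ratio ns r p \<epsilon>"
    by (rule eventually_mono) (use max_ratio_lower[OF e(1)] e(2) in \<open>auto intro: less_le_trans\<close>)
next
  fix a assume a: "ereal (inverse s) < a"
  have "\<exists>e>0. ereal (1 / s + e) < a"
  proof (cases a)
    case (real a')
    then show ?thesis using a by (intro exI[of _ "(a' - 1 / s) / 2"]) (simp add: field_simps)
  qed (use a in \<open>auto intro: exI[of _ 1]\<close>)
  then obtain e where e: "e > 0" "ereal (1 / s + e) < a" by blast
  obtain \<eta> where \<eta>: "\<eta> > 0" "\<And>\<epsilon>. 0 < \<epsilon> \<Longrightarrow> \<epsilon> < \<eta> \<Longrightarrow> max_ratio ns r p \<epsilon> \<le> ereal (1 / s + e)"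
    using max_ratio_upper[OF e(1)] by blast
  have "\<forall>\<^sub>F \<epsilon> in at_right 0. 0 < \<epsilon> \<and> \<epsilon> < \<eta>" using eventually_at_right_real[OF \<eta>(1)] by simp
  then show "\<forall>\<^sub>F \<epsilon> in at_right 0. max_ratio ns r p \<epsilon> < a"
    by (rule eventually_mono) (use \<eta>(2) e(2) in \<open>auto intro: le_less_trans\<close>)
qed

end

section \<open>The condition number over both fields\<close>

lemma vecr_carrier: "bs \<in> decompositions ns r \<Longrightarrow> vecr bs \<in> carrier_vec (r * sum_list ns)"
proof -
  assume bs: "bs \<in> decompositions ns r"
  then have "map dim_vec (map stack bs) = replicate r (sum_list ns)"
    by (intro nth_equalityI) (auto simp: decompositions_def dim_stack)
  then show ?thesis unfolding vecr_def by (intro carrier_vecI) (simp only: dim_stack sum_list_replicate, simp)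
qed

text \<open>Stated for any notion \<open>reg\<close> of regular points that implies
  \<open>locally_embeds\<close>; the real and the complex statement are instances.\<close>

lemma cond_number_eq:
  fixes bs :: "'a::rc_field vec list list"
  assumes d: "length ns \<ge> 1" and ns: "\<forall>n\<in>set ns. n \<ge> 1" and r: "r \<ge> 1" and bs: "bs \<in> decompositions ns r"
    and reg: "\<And>A. A \<in> reg (prod_list ns) (sigma ns r) \<Longrightarrow> locally_embeds (prod_list ns) (sigma ns r) A (r * (Sigma_dim ns + 1))"
  shows "let p = vecr bs; A = cpd_map ns r p; \<kappa> = cond_number reg ns r p in
      (robustly_identifiable reg ns r A \<and> varsigma ns r p > 0 \<longrightarrow>
         (max_ratio ns r p \<longlongrightarrow> \<kappa>) (at_right 0) \<and> \<kappa> = ereal (inverse (varsigma ns r p))) \<and>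
      (varsigma ns r p = 0 \<or> \<not> robustly_identifiable reg ns r A \<longrightarrow> \<kappa> = \<infinity>)"
proof -
  define p where "p = vecr bs"
  have p: "p \<in> carrier_vec (r * sum_list ns)" using vecr_carrier[OF bs] by (simp add: p_def)
  have lim: "(max_ratio ns r p \<longlongrightarrow> ereal (inverse (varsigma ns r p))) (at_right 0)"
    if rob: "robustly_identifiable reg ns r (cpd_map ns r p)" and pos: "varsigma ns r p > 0"
  proof -
    let ?n = "r * sum_list ns" and ?m = "prod_list ns" and ?N = "r * (Sigma_dim ns + 1)"
    have pr: "?m > 0" using ns by (auto intro!: Nat.gr0I simp: prod_list_zero_iff)
    have s: "varsigma ns r p = singular_values (terracini ns r p) ! (?N - 1)" by (simp add: varsigma_def sing_val_def)
    have emb: "locally_embeds ?m (sigma ns r) (cpd_map ns r p) ?N"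
      by (rule reg) (use rob in \<open>simp add: robustly_identifiable_def\<close>)
    have unique: "\<exists>e>0. \<forall>B\<in>sigma ns r. vdist ?m (cpd_map ns r p) B < e \<longrightarrow> unique_cpd ns r B"
    proof -
      obtain U where U: "openin (subtopology (vec_topology ?m) (sigma ns r)) U" "cpd_map ns r p \<in> U" "\<And>B. B \<in> U \<Longrightarrow> unique_cpd ns r B"
        using rob unfolding robustly_identifiable_def by blast
      then obtain W where W: "openin (vec_topology ?m) W" "U = W \<inter> sigma ns r" by (auto simp: openin_subtopology)
      then obtain e where e: "e > 0" "\<And>y. y \<in> carrier_vec ?m \<Longrightarrow> vdist ?m (cpd_map ns r p) y < e \<Longrightarrow> y \<in> W"
        using U(2) unfolding openin_vec_topology by blast
      have "unique_cpd ns r B" if B: "B \<in> sigma ns r" "vdist ?m (cpd_map ns r p) B < e" for B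
      proof -
        have "B \<in> carrier_vec ?m" using B(1) by (auto simp: sigma_def)
        then show ?thesis using e(2) U(3) W(2) B by blast
      qed
      then show ?thesis using e(1) by (intro exI[of _ e] conjI ballI impI)
    qed
    obtain u where u: "\<And>i. i < ?n \<Longrightarrow> u i \<in> carrier_vec ?n"
      "\<And>i j. i < ?n \<Longrightarrow> j < ?n \<Longrightarrow> cinner ?n (u i) (u j) = (if i = j then 1 else 0)"
      "\<And>x. x \<in> carrier_vec ?n \<Longrightarrow> sqnorm ?n x = (\<Sum>i<?n. (norm (cinner ?n (u i) x))\<^sup>2)"
      "\<And>x. x \<in> carrier_vec ?n \<Longrightarrow> sqnorm ?m (terracini ns r p *\<^sub>v x) =
        (\<Sum>i<?n. (singular_values (terracini ns r p) ! i)\<^sup>2 * (norm (cinner ?n (u i) x))\<^sup>2)"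
      using singular_basis_norms[OF terracini_carrier[OF pr]] by blast
    \<comment> \<open>The second part is \<Sigma> + 1 \<le> \<Sigma> + d, multiplied by r.\<close>
    have "0 < ?N" "?N \<le> ?n"
      using r d unfolding sum_list_eq_Sigma_dim[OF ns] by (simp, intro mult_le_mono2, simp)
    then have "terracini_slice ns r ?N p u"
      using d pr p pos emb unique u unfolding s by unfold_locales
    then show ?thesis unfolding s by (rule terracini_slice.max_ratio_tendsto)
  qed
  have "Lim (at_right 0) (max_ratio ns r p) = ereal (inverse (varsigma ns r p))"
    if "robustly_identifiable reg ns r (cpd_map ns r p)" "varsigma ns r p > 0"
    by (rule tendsto_Lim[OF trivial_limit_at_right_real lim[OF that]])
  then show ?thesis using lim unfolding Let_def p_def[symmetric] by (auto simp: cond_number_def)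
qed

theorem theorem7:
  fixes ns :: "nat list" and r :: nat
  assumes "length ns \<ge> 2"
    and "\<forall>n\<in>set ns. n \<ge> 2"
    and "r \<ge> 1"
    and "r * (Sigma_dim ns + 1) < prod_list ns"
  shows "(\<forall>bs :: real Matrix.vec list list. bs \<in> decompositions ns r \<longrightarrow>
            (let p = vecr bs; A = cpd_map ns r p; \<kappa> = cond_number real_regular ns r p in
              (robustly_identifiable real_regular ns r A \<and> varsigma ns r p > 0 \<longrightarrow>
                 (max_ratio ns r p \<longlongrightarrow> \<kappa>) (at_right 0) \<and>
                 \<kappa> = ereal (inverse (varsigma ns r p))) \<and>
              (varsigma ns r p = 0 \<or> \<not> robustly_identifiable real_regular ns r A \<longrightarrow> \<kappa> = \<infinity>)))
       \<and> (\<forall>bs :: complex Matrix.vec list list. bs \<in> decompositions ns r \<longrightarrow>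
            (let p = vecr bs; A = cpd_map ns r p; \<kappa> = cond_number complex_regular ns r p in
              (robustly_identifiable complex_regular ns r A \<and> varsigma ns r p > 0 \<longrightarrow>
                 (max_ratio ns r p \<longlongrightarrow> \<kappa>) (at_right 0) \<and>
                 \<kappa> = ereal (inverse (varsigma ns r p))) \<and>
              (varsigma ns r p = 0 \<or> \<not> robustly_identifiable complex_regular ns r A \<longrightarrow> \<kappa> = \<infinity>)))"
proof -
  have d: "length ns \<ge> 1" using assms(1) by simp
  have ns: "\<forall>n\<in>set ns. n \<ge> 1" using assms(2) by fastforce
  show ?thesis
    using cond_number_eq[OF d ns assms(3) _ real_regular_locally_embeds[OF d ns]]
      cond_number_eq[OF d ns assms(3) _ complex_regular_locally_embeds[OF d ns]]
    by blast
qed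

end
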